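(* Let $\Theta=(\theta_{jk})$ be a real $n\times n$ matrix with invertible diagonal part $\Theta_d=\mathrm{diag}\,\Theta$, let $\Theta_o=\Theta-\Theta_d$, and let $\vec\psi=\mathrm{Col}(\psi_1,\dots,\psi_n)$ with $\psi_j\in L^2(I_j)$ real-valued. If $\vec\varphi\in L^2(I)$ is a solution of $\chi\Theta\mathcal H\vec\varphi=\vec\psi$, then $$\chi\Theta_o\mathcal H\vec\varphi-\vec c[\vec\psi]\in\mathcal R.$$
   Context: Let $n\in\mathbb N$, $I_j=[\alpha_j,\beta_j]$ with $-\infty<\alpha_1<\beta_1<\alpha_2<\dots<\alpha_n<\beta_n<\infty$, $I=\bigcup_{j=1}^n I_j$. Let $\chi_j$ be the characteristic function of (or restriction to) $I_j$, $\chi=\mathrm{diag}(\chi_1,\dots,\chi_n)$. For $\phi\in L^2(I_j)$ put $(\mathcal H_j\phi)(z)=\frac1\pi\int_{I_j}\frac{\phi(\zeta)}{\zeta-z}d\zeta$ (principal value if $z\in I_j$), and $\mathcal H=\mathrm{diag}(\mathcal H_1,\dots,\mathcal H_n)$. A vector $\vec\varphi=\mathrm{Col}(\varphi_1,\dots,\varphi_n)$ with $\varphi_j\in L^2(I_j)$ is identified with the function $\varphi\in L^2(I)$ equal to $\varphi_j$ on $I_j$. The equation $\chi\Theta\mathcal H\vec\varphi=\vec\psi$ means $\sum_k\theta_{mk}(\mathcal H_k\varphi_k)(z)=\psi_m(z)$ for a.e. $z\in I_m$, $m=1,\dots,n$. $\mathcal R\subset L^2(I)$ is the range of $\chi\mathcal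 H=\mathrm{diag}(\chi_1\mathcal H_1,\dots,\chi_n\mathcal H_n)$ on $L^2(I)$. A constant vector $\vec c$ is regarded as the element of $L^2(I)$ equal to $c_j$ on $I_j$. If $\chi\Theta\mathcal H\vec\varphi=\vec\psi$ is solvable in $L^2(I)$, there is a unique constant vector $\vec c\in\mathbb R^n$ with $\vec\psi-\vec c\in\mathcal R$; it is denoted $\vec c[\vec\psi]$. *)

theory Defs
  imports "HOL-Analysis.Analysis"
begin

text \<open>Elements of \<open>L\<^sup>2\<close> are represented by functions, not by classes modulo null sets; equations
  between them are therefore always stated almost everywhere.  Only the values on \<open>S\<close> matter.\<close>

definition L2_on :: "real set \<Rightarrow> (real \<Rightarrow> complex) set" where
  "L2_on S = {f. f \<in> borel_measurable (lebesgue_on S) \<and>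
                 integrable (lebesgue_on S) (\<lambda>x. (cmod (f x))\<^sup>2)}"

text \<open>On \<open>[a, b]\<close> the integral is a principal value.  The function \<open>Lim\<close> is total, so the value is
  arbitrary at points where the principal value does not exist; for square integrable \<open>\<phi>\<close>
  these form a null set.\<close>

definition finite_Hilbert :: "real \<Rightarrow> real \<Rightarrow> (real \<Rightarrow> complex) \<Rightarrow> real \<Rightarrow> complex" where
  "finite_Hilbert a b \<phi> z = complex_of_real (1 / pi) *
     (if z \<in> {a..b}
      then Lim (at_right 0) (\<lambda>\<epsilon>. LINT \<zeta>:{a..b} - {z - \<epsilon><..<z + \<epsilon>}|lebesgue. \<phi> \<zeta> / of_real (\<zeta> - z))
      else (LINT \<zeta>:{a..b}|lebesgue. \<phi> \<zeta> / of_real (\<zeta> - z)))"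

text \<open>A function on the disjoint union of the intervals \<open>I\<^sub>j = [\<alpha> j, \<beta> j]\<close> is represented by the
  vector of its restrictions to the \<open>I\<^sub>j\<close>: the \<open>j\<close>-th component is only considered on \<open>I\<^sub>j\<close>.\<close>

definition L2_vec :: "('n \<Rightarrow> real) \<Rightarrow> ('n \<Rightarrow> real) \<Rightarrow> ('n \<Rightarrow> real \<Rightarrow> complex) set" where
  "L2_vec \<alpha> \<beta> = {f. \<forall>j. f j \<in> L2_on {\<alpha> j..\<beta> j}}"

text \<open>The restriction operator \<open>\<chi>\<close> is built into the following equality: the \<open>m\<close>-th components are
  compared on \<open>I\<^sub>m\<close> only.\<close>

definition eq_ae :: "('n \<Rightarrow> real) \<Rightarrow> ('n \<Rightarrow> real) \<Rightarrow>
    ('n \<Rightarrow> real \<Rightarrow> complex) \<Rightarrow> ('n \<Rightarrow> real \<Rightarrow> complex) \<Rightarrow> bool" where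
  "eq_ae \<alpha> \<beta> f g \<longleftrightarrow> (\<forall>m. AE z in lebesgue_on {\<alpha> m..\<beta> m}. f m z = g m z)"

definition Hilbert_vec :: "('n \<Rightarrow> real) \<Rightarrow> ('n \<Rightarrow> real) \<Rightarrow>
    ('n \<Rightarrow> real \<Rightarrow> complex) \<Rightarrow> 'n \<Rightarrow> real \<Rightarrow> complex" where
  "Hilbert_vec \<alpha> \<beta> \<phi> = (\<lambda>k. finite_Hilbert (\<alpha> k) (\<beta> k) (\<phi> k))"

definition mat_app :: "real ^ 'n ^ 'n \<Rightarrow> ('n::finite \<Rightarrow> real \<Rightarrow> complex) \<Rightarrow> 'n \<Rightarrow> real \<Rightarrow> complex" where
  "mat_app A f = (\<lambda>m z. \<Sum>k\<in>UNIV. of_real (A $ m $ k) * f k z)"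

definition diag_part :: "real ^ 'n ^ 'n \<Rightarrow> real ^ 'n ^ 'n" where
  "diag_part A = (\<chi> i j. if i = j then A $ i $ j else 0)"

definition minus_const :: "('n \<Rightarrow> real \<Rightarrow> complex) \<Rightarrow> real ^ 'n \<Rightarrow> 'n \<Rightarrow> real \<Rightarrow> complex" where
  "minus_const f c = (\<lambda>j z. f j z - of_real (c $ j))"

definition Hilbert_range :: "('n \<Rightarrow> real) \<Rightarrow> ('n \<Rightarrow> real) \<Rightarrow> ('n \<Rightarrow> real \<Rightarrow> complex) set" where
  "Hilbert_range \<alpha> \<beta> =
     {f \<in> L2_vec \<alpha> \<beta>. \<exists>\<phi>\<in>L2_vec \<alpha> \<beta>. eq_ae \<alpha> \<beta> (Hilbert_vec \<alpha> \<beta> \<phi>) f}"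

text \<open>The vector \<open>c[\<psi>]\<close>.  It is meaningful only for \<open>\<psi>\<close> for which such a constant vector exists and is
  unique, in particular for the right-hand sides of the solvable equations.\<close>

definition const_vec :: "('n \<Rightarrow> real) \<Rightarrow> ('n \<Rightarrow> real) \<Rightarrow> ('n \<Rightarrow> real \<Rightarrow> complex) \<Rightarrow> real ^ 'n" where
  "const_vec \<alpha> \<beta> \<psi> = (THE c. minus_const \<psi> c \<in> Hilbert_range \<alpha> \<beta>)"

end

(* On I_m the equation reads theta_mm H phi_m + g = psi_m, where the off-diagonal part g is a Cauchy
   integral over the other intervals.  Let w be the square root of (y - a)(b - y) on I_m = [a, b], and
   kappa(s)^2 = (s - a)(s - b).  For s outside [a, b] the function w(y) / (y - s) has the explicit
   principal value pi (kappa(s) / (s - x) - 1), so integrating it against f(s) / kappa(s) exhibits every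
   Cauchy integral over a set at positive distance from [a, b], minus a constant, as a finite Hilbert
   transform.  Hence g - c, and by linearity psi_m - c, lies in the range for some constant c.
   The constant is unique: if H phi is a constant, pairing with w(y) / (y - s) and letting s tend to
   both end points determines the constant times (b - a), which must vanish.
   Both the linearity of the principal value and this duality need that principal values of square
   integrable functions exist almost everywhere.  This follows from the maximal inequality for
   truncated transforms: a kernel correlation estimate gives their L2 bound, and Cotlar's argument
   reduces the maximal truncation to averages over balls. *)

theory Submission
  imports Defs "HOL-Real_Asymp.Real_Asymp"
begin

section \<open>Truncated Hilbert transforms in L2\<close>

text \<open>The total limit operator in \<open>finite_Hilbert\<close> returns an arbitrary value
  where no limit exists, so even additivity of the transform is usable only at points where the
  limits exist. This is why the almost everywhere existence precedes every statement about the
  range. No dense class of smooth functions occurs. Existence is elementary for indicators of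
  intervals, it survives L2 limits by the maximal inequality, and so it spreads by induction over
  Borel sets and measurable functions. Duality of principal values is likewise obtained from the
  truncations: these are antisymmetric by Fubini at each fixed level, and weak convergence carries
  the relation to the limit. Square integrability is what makes the constant unique: (x - (a + b) /
  2) / w(x) has the constant transform 1 on (a, b) and misses L2 only by a logarithmic divergence at
  the end points. The uniqueness argument therefore needs L2 bounds that stay uniform as s
  approaches an end point.\<close>

definition kern :: "real \<Rightarrow> real \<Rightarrow> real" where
  "kern e s = (if \<bar>s\<bar> < e then 0 else 1 / s)"

definition trunc :: "real \<Rightarrow> (real \<Rightarrow> real) \<Rightarrow> real \<Rightarrow> real" where
  "trunc e f x = (LINT t|lborel. kern e (t - x) * f t)"

text \<open>Bounded support makes these functions integrable as well, which supplies the majorants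
  for Fubini. Genuine Borel functions on the whole line are used so that measurability in the
  product space is automatic.\<close>

definition cL2 :: "(real \<Rightarrow> real) set" where
  "cL2 = {f. f \<in> borel_measurable borel \<and> (\<exists>R. \<forall>t. R < \<bar>t\<bar> \<longrightarrow> f t = 0) \<and> integrable lborel (\<lambda>t. (f t)\<^sup>2)}"

lemma kern_measurable[measurable]: "kern e \<in> borel_measurable borel"
  unfolding kern_def by measurable

lemma kern_bound: "0 < e \<Longrightarrow> \<bar>kern e s\<bar> \<le> 1 / e"
  by (auto simp: kern_def intro!: frac_le)

lemma kern_odd: "kern e (- s) = - kern e s"
  by (simp add: kern_def)

lemma kern_sq: "(kern e s)\<^sup>2 = (if \<bar>s\<bar> < e then 0 else 1 / s\<^sup>2)"
  by (simp add: kern_def power_divide)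

lemma kern_sq_integral:
  assumes e: "0 < e"
  shows "has_bochner_integral lborel (\<lambda>s. (kern e s)\<^sup>2) (2 / e)"
proof -
  have "(\<integral>\<^sup>+s. ennreal (1 / s\<^sup>2) * indicator {e ..} s \<partial>lborel) = ennreal (0 - (- 1 / e))"
  proof (rule nn_integral_FTC_atLeast[where F = "\<lambda>s. - 1 / s"])
    show "(\<lambda>s::real. 1 / s\<^sup>2) \<in> borel_measurable borel" by measurable
    show "((\<lambda>s. - 1 / s) has_real_derivative 1 / s\<^sup>2) (at s)" if "e \<le> s" for s
      using that e by (auto intro!: derivative_eq_intros simp: power2_eq_square)
    show "((\<lambda>s::real. - 1 / s) \<longlongrightarrow> 0) at_top"
      by (rule real_tendsto_divide_at_top[OF tendsto_const filterlim_ident])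
  qed simp
  moreover have "(\<integral>\<^sup>+s. ennreal (1 / s\<^sup>2) * indicator {e ..} s \<partial>lborel)
      = (\<integral>\<^sup>+s. ennreal (indicator {0..} s *\<^sub>R (kern e s)\<^sup>2) \<partial>lborel)"
    by (intro nn_integral_cong) (use e in \<open>auto simp: kern_sq indicator_def\<close>)
  ultimately have nn: "(\<integral>\<^sup>+s. ennreal (indicator {0..} s *\<^sub>R (kern e s)\<^sup>2) \<partial>lborel) = ennreal (1 / e)"
    by simp
  have "has_bochner_integral lborel (\<lambda>s. indicator {0..} s *\<^sub>R (kern e s)\<^sup>2) (1 / e)"
    by (rule has_bochner_integral_nn_integral[OF _ _ _ nn]) (use e in auto)
  from has_bochner_integral_even_function[OF this]
  show ?thesis by (simp add: kern_odd)
qed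

lemma kern_sq_shift_integral:
  assumes "0 < e"
  shows "has_bochner_integral lborel (\<lambda>s. (kern e (s - d))\<^sup>2) (2 / e)"
  using lborel_has_bochner_integral_real_affine_iff[of 1 "\<lambda>s. (kern e s)\<^sup>2" "2 / e" "- d"]
    kern_sq_integral[OF assms]
  by simp

lemma abs_mult_le_squares:
  fixes x y :: real
  shows "\<bar>x * y\<bar> \<le> (x\<^sup>2 + y\<^sup>2) / 2"
proof -
  have "0 \<le> (\<bar>x\<bar> - \<bar>y\<bar>)\<^sup>2" by simp
  then show ?thesis by (simp add: power2_diff abs_mult)
qed

lemma kern_prod_integrable:
  assumes "0 < e"
  shows "integrable lborel (\<lambda>s. kern e (s - p) * kern e (s - q))"
    and "(LINT s|lborel. \<bar>kern e (s - p) * kern e (s - q)\<bar>) \<le> 2 / e"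
proof -
  have *: "integrable lborel (\<lambda>s. ((kern e (s - p))\<^sup>2 + (kern e (s - q))\<^sup>2) / 2)"
    "(LINT s|lborel. ((kern e (s - p))\<^sup>2 + (kern e (s - q))\<^sup>2) / 2) = 2 / e"
    using kern_sq_shift_integral[OF assms, of p] kern_sq_shift_integral[OF assms, of q]
    by (auto simp: has_bochner_integral_iff)
  note b = abs_mult_le_squares
  show i: "integrable lborel (\<lambda>s. kern e (s - p) * kern e (s - q))"
    by (rule Bochner_Integration.integrable_bound[OF *(1)]) (use b in auto)
  show "(LINT s|lborel. \<bar>kern e (s - p) * kern e (s - q)\<bar>) \<le> 2 / e"
    unfolding *(2)[symmetric]
    by (rule integral_mono[OF integrable_abs[OF i] *(1)]) (rule b)
qed

text \<open>Off the two windows the product of the kernels is the derivative of \<open>ln \<bar>s / (s + d)\<bar> / d\<close>.\<close>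

lemma kern_corr_far:
  assumes e: "0 < e" and d: "2 * e < d"
  shows "(LINT s|lborel. kern e s * kern e (s + d)) = 2 / d * ln ((d + e) / (d - e))"
proof -
  define F where "F s = ln (s / (s + d)) / d" for s
  \<comment> \<open>The argument of the logarithm in \<open>F\<close> is negative between the poles
    -d and 0; \<open>G\<close> is the primitive with the same derivative there. The middle piece is
    nonempty because 2e < d.\<close>
  define G where "G s = ln (- s / (s + d)) / d" for s
  define k where "k s = 1 / (s * (s + d))" for s
  have d0: "0 < d" "d \<noteq> 0" using e d by linarith+
  have dF: "(F has_real_derivative k s) (at s)" if "0 < s / (s + d)" for s
    unfolding F_def k_def using that d0
    by (auto intro!: derivative_eq_intros simp: divide_simps; argo?)
  have dG: "(G has_real_derivative k s) (at s)" if "0 < - s / (s + d)" for s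
    unfolding G_def k_def using that d0
    by (auto intro!: derivative_eq_intros simp: divide_simps; argo?)
  have kc: "isCont k s" if "s \<noteq> 0" "s + d \<noteq> 0" for s
    unfolding k_def using that by (auto intro!: continuous_intros)
  have limR: "(F \<longlongrightarrow> F s) (at_right s)" "(F \<longlongrightarrow> F s) (at_left s)" if "0 < s / (s + d)" for s
    using DERIV_isCont[OF dF[OF that]] by (simp_all add: isCont_def filterlim_at_split)
  have limG: "(G \<longlongrightarrow> G s) (at_right s)" "(G \<longlongrightarrow> G s) (at_left s)" if "0 < - s / (s + d)" for s
    using DERIV_isCont[OF dG[OF that]] by (simp_all add: isCont_def filterlim_at_split)
  have 1: "set_integrable lborel (einterval e \<infinity>) k \<and> (LBINT s=e..\<infinity>. k s) = 0 - F e"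
  proof -
    have pos: "0 < s / (s + d)" "s \<noteq> 0" "s + d \<noteq> 0" "0 \<le> k s" if "e < s" for s
      using that e d0 by (auto simp: k_def)
    have A: "((F \<circ> real_of_ereal) \<longlongrightarrow> F e) (at_right (ereal e))"
      unfolding ereal_tendsto_simps using e d0 by (intro limR) simp
    have B: "((F \<circ> real_of_ereal) \<longlongrightarrow> 0) (at_left \<infinity>)"
      unfolding ereal_tendsto_simps F_def using d0 by real_asymp
    from interval_integral_FTC_nonneg[where F = F and f = k, OF _ dF kc _ A B] pos
    show ?thesis by simp
  qed
  have 2: "set_integrable lborel (einterval (-\<infinity>) (-d-e)) k \<and> (LBINT s=-\<infinity>..(-d-e). k s) = F (-d-e) - 0"
  proof -
    have pos: "0 < s / (s + d)" "s \<noteq> 0" "s + d \<noteq> 0" "0 \<le> k s" if "s < - d - e" for s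
      using that e d0 by (auto simp: k_def divide_neg_neg zero_le_mult_iff)
    have A: "((F \<circ> real_of_ereal) \<longlongrightarrow> F (-d-e)) (at_left (ereal (-d-e)))"
      unfolding ereal_tendsto_simps using e d0 by (intro limR) (simp add: divide_less_0_iff zero_less_divide_iff)
    have B: "((F \<circ> real_of_ereal) \<longlongrightarrow> 0) (at_right (-\<infinity>))"
      unfolding ereal_tendsto_simps F_def using d0 by real_asymp
    from interval_integral_FTC_nonneg[where F = F and f = k, OF _ dF kc _ B A] pos
    show ?thesis by simp
  qed
  \<comment> \<open>Between the poles \<open>k\<close> is negative, so the fundamental theorem for
    nonnegative integrands is applied to \<open>- k\<close>.\<close>
  have 3: "set_integrable lborel (einterval (-d+e) (-e)) (\<lambda>s. - k s) \<and>
      (LBINT s=(-d+e)..(-e). - k s) = - G (-e) - (- G (-d+e))"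
  proof -
    have pos: "0 < - s / (s + d)" "s \<noteq> 0" "s + d \<noteq> 0" "0 \<le> - k s" if "- d + e < s" "s < - e" for s
      using that e d0 by (auto simp: k_def divide_less_0_iff zero_less_divide_iff divide_le_0_iff mult_le_0_iff)
    have A: "(((\<lambda>x. - G x) \<circ> real_of_ereal) \<longlongrightarrow> - G (-e)) (at_left (ereal (-e)))"
      unfolding ereal_tendsto_simps using e d0 d by (intro limG tendsto_minus) (simp add: divide_less_0_iff zero_less_divide_iff)
    have B: "(((\<lambda>x. - G x) \<circ> real_of_ereal) \<longlongrightarrow> - G (-d+e)) (at_right (ereal (-d+e)))"
      unfolding ereal_tendsto_simps using e d0 d by (intro limG tendsto_minus) (simp add: divide_less_0_iff zero_less_divide_iff)
    from interval_integral_FTC_nonneg[where F = "\<lambda>x. - G x" and f = "\<lambda>x. - k x", OF _ DERIV_minus[OF dG] isCont_minus[OF kc] _ B A] pos d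
    show ?thesis by simp
  qed
  have i1: "integrable lborel (\<lambda>s. k s * indicator {e<..} s)" "(LINT s|lborel. k s * indicator {e<..} s) = - F e"
    using 1 e by (auto simp: set_integrable_def interval_integral_to_infinity_eq set_lebesgue_integral_def einterval_eq_Ici mult.commute)
  have i2: "integrable lborel (\<lambda>s. k s * indicator {..<-d-e} s)" "(LINT s|lborel. k s * indicator {..<-d-e} s) = F (-d-e)"
    using 2 e by (auto simp: set_integrable_def interval_lebesgue_integral_def set_lebesgue_integral_def einterval_eq mult.commute)
  have i3: "integrable lborel (\<lambda>s. k s * indicator {-d+e<..<-e} s)" "(LINT s|lborel. k s * indicator {-d+e<..<-e} s) = G (-e) - G (-d+e)"
    using 3 e d by (auto simp: set_integrable_def interval_lebesgue_integral_def set_lebesgue_integral_def einterval_eq mult.commute)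
  have "(LINT s|lborel. kern e s * kern e (s + d)) =
      (LINT s|lborel. k s * indicator {e<..} s + k s * indicator {..<-d-e} s + k s * indicator {-d+e<..<-e} s)"
  proof (rule integral_cong_AE)
    have "AE s in lborel. s \<noteq> e \<and> s \<noteq> - e \<and> s \<noteq> - d - e \<and> s \<noteq> - d + e"
      by (intro AE_conjI AE_lborel_singleton)
    then show "AE s in lborel. kern e s * kern e (s + d) = k s * indicator {e<..} s + k s * indicator {..<-d-e} s + k s * indicator {-d+e<..<-e} s"
      by eventually_elim (use e d in \<open>auto simp: kern_def k_def indicator_def abs_if split: if_splits\<close>)
  qed (auto simp: k_def)
  also have "\<dots> = - F e + F (-d-e) + (G (-e) - G (-d+e))"
    using i1 i2 i3 by simp
  also have "\<dots> = (- ln (e / (e + d)) + ln ((d + e) / e) + (ln (e / (d - e)) - ln ((d - e) / e))) / d"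
  proof -
    have "(-d-e) / (-d-e+d) = (d + e) / e" "- (-d+e) / (-d+e+d) = (d - e) / e" "- (-e) / (-e+d) = e / (d - e)"
      using e d by (auto simp: divide_simps)
    then show ?thesis
      unfolding F_def G_def by (simp only: diff_divide_distrib add_divide_distrib minus_divide_left)
  qed
  also have "\<dots> = 2 / d * ln ((d + e) / (d - e))"
    using e d d0 by (simp add: ln_div divide_simps add.commute)
  finally show ?thesis .
qed


text \<open>A majorant of the correlation of two shifted kernels whose total mass does not depend on
  e. The first term is 8e / d^2 on the range \<bar>d\<bar> \<ge> 2e, from the explicit logarithm;
  the second is the squared L2 norm 2 / e of the kernel, which bounds every correlation and is
  needed only for small d.\<close>

definition corr_bound :: "real \<Rightarrow> real \<Rightarrow> real" where
  "corr_bound e d = 8 * e * (kern (2 * e) d)\<^sup>2 + 2 / e * indicator {- (2 * e)..2 * e} d"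

lemma corr_bound_measurable[measurable]: "corr_bound e \<in> borel_measurable borel"
  unfolding corr_bound_def by measurable

lemma corr_bound_nonneg: "0 < e \<Longrightarrow> 0 \<le> corr_bound e d"
  by (simp add: corr_bound_def)

lemma corr_bound_minus: "corr_bound e (- d) = corr_bound e d"
  by (auto simp: corr_bound_def kern_odd indicator_def)

lemma corr_bound_integral:
  assumes "0 < e"
  shows "has_bochner_integral lborel (\<lambda>s. corr_bound e (t - s)) 16"
proof -
  have "has_bochner_integral lborel (\<lambda>s. (kern (2 * e) s)\<^sup>2) (1 / e)"
    using kern_sq_integral[of "2 * e"] assms by simp
  moreover have "has_bochner_integral lborel (indicator {- (2 * e)..2 * e} :: real \<Rightarrow> real) (4 * e)"
    using has_bochner_integral_real_indicator[of "{- (2 * e)..2 * e}" lborel] assms by simp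
  ultimately have "has_bochner_integral lborel (corr_bound e) (8 * e * (1 / e) + 2 / e * (4 * e))"
    unfolding corr_bound_def
    by (intro has_bochner_integral_add has_bochner_integral_mult_right) auto
  moreover have "8 * e * (1 / e) + 2 / e * (4 * e) = 16" using assms by simp
  ultimately show ?thesis
    using lborel_has_bochner_integral_real_affine_iff[of "-1" "corr_bound e" 16 t] by simp
qed

lemma kern_corr_le:
  assumes e: "0 < e"
  shows "\<bar>LINT x|lborel. kern e (t - x) * kern e (s - x)\<bar> \<le> corr_bound e (t - s)"
proof -
  have flip: "kern e (t - x) * kern e (s - x) = kern e (x - t) * kern e (x - s)" for t s x
    using kern_odd[of e "x - t"] kern_odd[of e "x - s"] by simp
  have far: "\<bar>LINT x|lborel. kern e (x - t) * kern e (x - s)\<bar> \<le> corr_bound e (t - s)"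
    if "2 * e < t - s" for t s
  proof -
    define d where "d = t - s"
    have d: "2 * e < d" "0 < d" using that e by (auto simp: d_def)
    have "(LINT x|lborel. kern e (x - t) * kern e (x - s)) = (LINT x|lborel. kern e x * kern e (x + d))"
      by (subst lborel_integral_real_affine[of 1 _ t]) (simp_all add: d_def algebra_simps)
    also have "\<dots> = 2 / d * ln ((d + e) / (d - e))"
      by (rule kern_corr_far[OF e d(1)])
    finally have eq: "(LINT x|lborel. kern e (x - t) * kern e (x - s)) = 2 / d * ln ((d + e) / (d - e))" .
    have q: "(d + e) / (d - e) = 1 + 2 * e / (d - e)" using d e by (simp add: field_simps)
    have "ln ((d + e) / (d - e)) \<le> 2 * e / (d - e)"
      unfolding q using d e by (intro ln_add_one_self_le_self) simp
    \<comment> \<open>From d > 2e follows d - e > d / 2.\<close>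
    also have "\<dots> \<le> 4 * e / d" using d e by (simp add: field_simps)
    finally have "2 / d * ln ((d + e) / (d - e)) \<le> 2 / d * (4 * e / d)"
      using d by (intro mult_left_mono) auto
    also have "\<dots> = corr_bound e d"
      using d e by (simp add: corr_bound_def kern_sq) (simp add: power2_eq_square)
    finally have "2 / d * ln ((d + e) / (d - e)) \<le> corr_bound e d" .
    moreover have "0 \<le> 2 / d * ln ((d + e) / (d - e))" using d e by simp
    ultimately show ?thesis unfolding eq by (simp only: d_def abs_of_nonneg)
  qed
  consider "2 * e < t - s" | "2 * e < s - t" | "\<bar>t - s\<bar> \<le> 2 * e" by linarith
  then show ?thesis
  proof cases
    case 1
    then show ?thesis unfolding flip by (rule far)
  next
    case 2
    then show ?thesis
      unfolding flip using far[of t s] far[OF 2] corr_bound_minus[of e "s - t"] by (simp add: mult.commute)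
  next
    case 3
    have "\<bar>LINT x|lborel. kern e (t - x) * kern e (s - x)\<bar> \<le> (LINT x|lborel. \<bar>kern e (t - x) * kern e (s - x)\<bar>)"
      by (rule integral_abs_bound)
    also have "\<dots> \<le> 2 / e"
      unfolding flip by (rule kern_prod_integrable[OF e])
    also have "\<dots> \<le> corr_bound e (t - s)"
      using 3 e by (auto simp: corr_bound_def indicator_def abs_le_iff)
    finally show ?thesis .
  qed
qed

lemma integrable_tensor:
  fixes a b :: "real \<Rightarrow> real"
  assumes a: "integrable lborel a" and b: "integrable lborel b"
  shows "integrable (lborel \<Otimes>\<^sub>M lborel) (\<lambda>(t, s). a t * b s)"
proof -
  have [measurable]: "a \<in> borel_measurable borel" "b \<in> borel_measurable borel" using a b by auto
  show ?thesis
    by (rule lborel_pair.Fubini_integrable) (use a b in \<open>auto simp: abs_mult\<close>)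
qed

lemma cL2D:
  assumes "f \<in> cL2"
  shows "f \<in> borel_measurable borel" "integrable lborel (\<lambda>t. (f t)\<^sup>2)" "integrable lborel f"
proof -
  from assms obtain R where [measurable]: "f \<in> borel_measurable borel"
    and R: "\<And>t. R < \<bar>t\<bar> \<Longrightarrow> f t = 0" and i: "integrable lborel (\<lambda>t. (f t)\<^sup>2)"
    by (auto simp: cL2_def)
  show "f \<in> borel_measurable borel" "integrable lborel (\<lambda>t. (f t)\<^sup>2)" by fact+
  have b: "\<bar>f t\<bar> \<le> (f t)\<^sup>2 + indicator {-R..R} t" for t
  proof (cases "\<bar>t\<bar> \<le> R")
    case True
    have "0 \<le> (\<bar>f t\<bar> - 1)\<^sup>2" by simp
    then have "2 * \<bar>f t\<bar> \<le> (f t)\<^sup>2 + 1" by (simp add: power2_diff)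
    then have "\<bar>f t\<bar> \<le> (f t)\<^sup>2 + 1" by linarith
    moreover have "t \<in> {-R..R}" using True by auto
    ultimately show ?thesis by simp
  qed (use R[of t] in auto)
  show "integrable lborel f"
    by (rule Bochner_Integration.integrable_bound[of _ "\<lambda>t. (f t)\<^sup>2 + indicator {-R..R} t"])
      (use i b in \<open>auto intro!: integrable_real_indicator Bochner_Integration.integrable_add
         order.trans[OF b abs_ge_self] simp: emeasure_lborel_Icc_eq\<close>)
qed

lemma trunc_integrable:
  assumes "f \<in> cL2" "0 < e"
  shows "integrable lborel (\<lambda>t. kern e (t - x) * f t)"
  by (rule Bochner_Integration.integrable_bound[of _ "\<lambda>t. 1 / e * f t"])
    (use cL2D[OF assms(1)] assms(2) kern_bound[OF assms(2)] in
      \<open>auto simp: abs_mult intro!: mult_mono order.trans[OF mult_right_mono[OF kern_bound[OF assms(2)]]]\<close>)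

lemma trunc_measurable:
  assumes [measurable]: "f \<in> borel_measurable borel"
  shows "trunc e f \<in> borel_measurable borel"
  unfolding trunc_def by measurable

text \<open>A Schur test. Expanding the square and integrating in x first leaves f(t) f(s) times the
  kernel correlation; with \<bar>f(t) f(s)\<bar> \<le> (f(t)^2 + f(s)^2) / 2 only the mass 16 of
  \<open>corr_bound\<close> remains. What matters later is that the constant is independent of
  e.\<close>

lemma trunc_L2:
  assumes f: "f \<in> cL2" and e: "0 < e"
  shows "integrable lborel (\<lambda>x. (trunc e f x)\<^sup>2)"
    and "(LINT x|lborel. (trunc e f x)\<^sup>2) \<le> 16 * (LINT x|lborel. (f x)\<^sup>2)"
proof -
  note [measurable] = cL2D(1)[OF f]
  let ?P = "lborel \<Otimes>\<^sub>M lborel :: (real \<times> real) measure"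
  interpret P: pair_sigma_finite ?P "lborel :: real measure" ..
  define h where "h p x = (kern e (fst p - x) * kern e (snd p - x)) * (f (fst p) * f (snd p))" for p x
  have [measurable]: "(\<lambda>(p, x). h p x) \<in> borel_measurable (?P \<Otimes>\<^sub>M lborel)"
    unfolding h_def by measurable
  have ff: "integrable ?P (\<lambda>p. f (fst p) * f (snd p))"
    using integrable_tensor[OF cL2D(3)[OF f] cL2D(3)[OF f]] by (simp add: case_prod_unfold)
  have kk: "integrable lborel (\<lambda>x. kern e (t - x) * kern e (s - x))"
    "(LINT x|lborel. \<bar>kern e (t - x) * kern e (s - x)\<bar>) \<le> 2 / e" for t s
    using kern_prod_integrable[OF e, of t s] kern_odd[of e "_ - t"] kern_odd[of e "_ - s"] by simp_all
  \<comment> \<open>Absolute integrability of the triple integral: the products of two kernels have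
    L1 norm at most 2 / e in x, uniformly in t and s, and \<open>f\<close> is integrable. This crude
    bound, which depends on e, serves only to justify Fubini.\<close>
  have h: "integrable (?P \<Otimes>\<^sub>M lborel) (\<lambda>(p, x). h p x)"
  proof (rule P.Fubini_integrable)
    show "AE p in ?P. integrable lborel (\<lambda>x. case (p, x) of (p, x) \<Rightarrow> h p x)"
      unfolding h_def using kk(1) by auto
    have eq: "(LINT x|lborel. norm (case (p, x) of (p, x) \<Rightarrow> h p x)) =
        (LINT x|lborel. \<bar>kern e (fst p - x) * kern e (snd p - x)\<bar>) * \<bar>f (fst p) * f (snd p)\<bar>" for p
      unfolding h_def by (simp add: abs_mult)
    show "integrable ?P (\<lambda>p. LINT x|lborel. norm (case (p, x) of (p, x) \<Rightarrow> h p x))"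
      unfolding eq
    proof (rule Bochner_Integration.integrable_bound)
      show "integrable ?P (\<lambda>p. 2 / e * (f (fst p) * f (snd p)))" using ff by simp
      have "(LINT x|lborel. \<bar>kern e (t - x) * kern e (s - x)\<bar>) * \<bar>f t * f s\<bar> \<le> 2 / e * \<bar>f t * f s\<bar>" for t s
        using kk(2) by (intro mult_right_mono) auto
      then
      show "AE p in ?P. norm ((LINT x|lborel. \<bar>kern e (fst p - x) * kern e (snd p - x)\<bar>) * \<bar>f (fst p) * f (snd p)\<bar>)
          \<le> norm (2 / e * (f (fst p) * f (snd p)))"
        using e by (auto simp: abs_mult)
    qed measurable
  qed measurable
  have inner: "(LINT p|?P. h p x) = (trunc e f x)\<^sup>2" for x
  proof -
    have "(LINT p|?P. h p x) = (LINT p|?P. (case p of (t, s) \<Rightarrow> (kern e (t - x) * f t) * (kern e (s - x) * f s)))"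
      unfolding h_def by (intro Bochner_Integration.integral_cong) (auto simp: algebra_simps)
    also have "\<dots> = (LINT t|lborel. LINT s|lborel. (kern e (t - x) * f t) * (kern e (s - x) * f s))"
      using lborel_pair.integral_fst'[OF integrable_tensor[OF trunc_integrable[OF f e, of x] trunc_integrable[OF f e, of x]]]
      by simp
    also have "\<dots> = (trunc e f x)\<^sup>2"
      by (simp add: trunc_def power2_eq_square)
    finally show ?thesis .
  qed
  show "integrable lborel (\<lambda>x. (trunc e f x)\<^sup>2)"
    using P.integrable_snd[OF h] unfolding inner .
  note b = abs_mult_le_squares
  have c: "LINT s|lborel. corr_bound e (t - s) = 16" "integrable lborel (\<lambda>s. corr_bound e (t - s))" for t
    using corr_bound_integral[OF e, of t] by (auto simp: has_bochner_integral_iff)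
  have g1: "integrable ?P (\<lambda>(t, s). (f t)\<^sup>2 * corr_bound e (t - s))"
    by (rule lborel_pair.Fubini_integrable)
      (use c cL2D(2)[OF f] corr_bound_nonneg[OF e] in \<open>auto simp: abs_mult\<close>)
  have g1i: "(LINT p|?P. (case p of (t, s) \<Rightarrow> (f t)\<^sup>2 * corr_bound e (t - s))) = 16 * (LINT x|lborel. (f x)\<^sup>2)"
    using lborel_pair.integral_fst'[OF g1] by (simp add: c)
  have sym: "corr_bound e (s - t) = corr_bound e (t - s)" for s t
    using corr_bound_minus[of e "t - s"] by simp
  have g2: "integrable ?P (\<lambda>(t, s). (f s)\<^sup>2 * corr_bound e (t - s))"
    using lborel_pair.integrable_product_swap[OF g1] by (simp add: sym)
  have g2i: "(LINT p|?P. (case p of (t, s) \<Rightarrow> (f s)\<^sup>2 * corr_bound e (t - s))) = 16 * (LINT x|lborel. (f x)\<^sup>2)"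
    using lborel_pair.integral_product_swap[of "\<lambda>(t, s). (f t)\<^sup>2 * corr_bound e (t - s)"] g1i
    by (simp add: sym)
  have "(LINT x|lborel. (trunc e f x)\<^sup>2) = (LINT x|lborel. LINT p|?P. h p x)"
    by (simp add: inner)
  also have "\<dots> = (LINT p|?P. LINT x|lborel. h p x)"
    by (rule P.Fubini_integral[OF h])
  also have "\<dots> \<le> (LINT p|?P. ((case p of (t, s) \<Rightarrow> (f t)\<^sup>2 * corr_bound e (t - s)) +
      (case p of (t, s) \<Rightarrow> (f s)\<^sup>2 * corr_bound e (t - s))) / 2)"
  proof (rule integral_mono)
    show "integrable ?P (\<lambda>p. LINT x|lborel. h p x)"
      using P.integrable_fst'[OF h] by simp
    show "integrable ?P (\<lambda>p. ((case p of (t, s) \<Rightarrow> (f t)\<^sup>2 * corr_bound e (t - s)) +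
      (case p of (t, s) \<Rightarrow> (f s)\<^sup>2 * corr_bound e (t - s))) / 2)"
      using g1 g2 by auto
    fix p :: "real \<times> real"
    obtain t s where p: "p = (t, s)" by force
    have "(LINT x|lborel. h p x) = (LINT x|lborel. kern e (t - x) * kern e (s - x)) * (f t * f s)"
      by (simp add: h_def p)
    also have "\<dots> \<le> \<bar>LINT x|lborel. kern e (t - x) * kern e (s - x)\<bar> * \<bar>f t * f s\<bar>"
      unfolding abs_mult[symmetric] by (rule abs_ge_self)
    also have "\<dots> \<le> corr_bound e (t - s) * (((f t)\<^sup>2 + (f s)\<^sup>2) / 2)"
      by (intro mult_mono kern_corr_le b) (use e corr_bound_nonneg in auto)
    finally show "(LINT x|lborel. h p x) \<le> ((case p of (t, s) \<Rightarrow> (f t)\<^sup>2 * corr_bound e (t - s)) +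
      (case p of (t, s) \<Rightarrow> (f s)\<^sup>2 * corr_bound e (t - s))) / 2"
      by (simp add: p algebra_simps)
  qed
  also have "\<dots> = 16 * (LINT x|lborel. (f x)\<^sup>2)"
    using g1 g2 g1i g2i by simp
  finally show "(LINT x|lborel. (trunc e f x)\<^sup>2) \<le> 16 * (LINT x|lborel. (f x)\<^sup>2)" .
qed

section \<open>Maximal inequalities\<close>

text \<open>Vitali covering: \<open>E\<close> is the union of all balls on which the mean of
  \<open>h\<close> exceeds c. A disjoint subfamily, enlarged five times, still covers
  \<open>E\<close>, and on each of its balls c times the length is below the integral of
  \<open>h\<close>. Taking the whole union rather than the set of bad centres makes \<open>E\<close>
  open.\<close>

lemma maximal_weak_type:
  fixes h :: "real \<Rightarrow> real"
  assumes h: "integrable lborel h" and nn: "\<And>t. 0 \<le> h t" and c: "0 < c"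
  obtains E where "open E" "emeasure lborel E \<le> ennreal (5 / c * (LINT t|lborel. h t))"
    "\<And>x r. x \<notin> E \<Longrightarrow> 0 < r \<Longrightarrow> (LINT t:ball x r|lborel. h t) \<le> c * (2 * r)"
proof
  define K where "K = {(y, r). 0 < r \<and> c * (2 * r) < (LINT t:ball y r|lborel. h t)}"
  define E where "E = (\<Union>i\<in>K. ball (fst i) (snd i))"
  have [measurable]: "h \<in> borel_measurable borel" using h by auto
  have si: "set_integrable lborel A h" if "A \<in> sets borel" for A
    unfolding set_integrable_def using h that by (intro integrable_mult_indicator) auto
  show "open E" unfolding E_def by auto
  show "(LINT t:ball x r|lborel. h t) \<le> c * (2 * r)" if "x \<notin> E" "0 < r" for x r
  proof (rule ccontr)
    assume "\<not> ?thesis"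
    then have "(x, r) \<in> K" using that by (auto simp: K_def)
    moreover have "x \<in> ball x r" using that by simp
    ultimately show False using that(1) unfolding E_def by force
  qed
  have le: "(LINT t:A|lborel. h t) \<le> (LINT t|lborel. h t)" if "A \<in> sets borel" for A
    unfolding set_lebesgue_integral_def
    by (intro integral_mono) (use si[OF that] h nn in \<open>auto simp: set_integrable_def indicator_def\<close>)
  \<comment> \<open>The covering lemma needs bounded radii; integrability of \<open>h\<close> bounds
    the radius of a bad ball.\<close>
  have r: "0 < snd i \<and> snd i \<le> (LINT t|lborel. h t) / (2 * c)" if "i \<in> K" for i
    using that le[of "ball (fst i) (snd i)"] c by (auto simp: K_def field_simps)
  obtain C where C: "countable C" "C \<subseteq> K"
    and pw: "pairwise (\<lambda>i j. disjnt (ball (fst i) (snd i)) (ball (fst j) (snd j))) C"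
    and cov: "E \<subseteq> (\<Union>i\<in>C. ball (fst i) (5 * snd i))"
    by (rule Vitali_covering_lemma_balls[where a = fst and r = snd and S = E, OF _ r]) (auto simp: E_def)
  define I where "I = to_nat_on C ` C"
  define p where "p = from_nat_into C"
  define A where "A n = (if n \<in> I then ball (fst (p n)) (snd (p n)) else {})" for n
  define B where "B n = (if n \<in> I then ball (fst (p n)) (5 * snd (p n)) else {})" for n
  have pC: "p n \<in> C" "to_nat_on C (p n) = n" if "n \<in> I" for n
    using that C(1) by (auto simp: p_def I_def)
  have B: "E \<subseteq> (\<Union>n. B n)"
  proof
    fix x assume "x \<in> E"
    then obtain i where i: "i \<in> C" "x \<in> ball (fst i) (5 * snd i)" using cov by blast
    then have "to_nat_on C i \<in> I" "p (to_nat_on C i) = i" using C(1) by (auto simp: I_def p_def)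
    then show "x \<in> (\<Union>n. B n)" using i by (auto simp: B_def intro!: bexI[of _ "to_nat_on C i"])
  qed
  have disj: "disjoint_family A"
    unfolding disjoint_family_on_def
  proof (intro ballI impI)
    fix m n :: nat assume mn: "m \<noteq> n"
    show "A m \<inter> A n = {}"
    proof (cases "m \<in> I \<and> n \<in> I")
      case True
      then have "p m \<noteq> p n" using pC mn by metis
      with pw True pC have "disjnt (ball (fst (p m)) (snd (p m))) (ball (fst (p n)) (snd (p n)))"
        by (auto simp: pairwise_def)
      then show ?thesis using True by (simp add: A_def disjnt_def)
    qed (auto simp: A_def)
  qed
  have [measurable]: "A n \<in> sets borel" "B n \<in> sets borel" for n by (auto simp: A_def B_def)
  \<comment> \<open>With \<open>h\<close> as a density, the sum of its integrals over disjoint balls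
    is the measure of their union.\<close>
  let ?D = "density lborel (\<lambda>t. ennreal (h t))"
  have each: "emeasure lborel (B n) \<le> ennreal (5 / c) * emeasure ?D (A n)" for n
  proof (cases "n \<in> I")
    case True
    obtain y r where yr: "p n = (y, r)" by force
    have K: "0 < r" "c * (2 * r) < (LINT t:ball y r|lborel. h t)"
      using pC(1)[OF True] C(2) yr by (auto simp: K_def)
    have "emeasure ?D (A n) = ennreal (LINT t:ball y r|lborel. h t)"
    proof -
      have "emeasure ?D (A n) = (\<integral>\<^sup>+t. ennreal (indicator (ball y r) t *\<^sub>R h t) \<partial>lborel)"
        using True yr by (auto simp: emeasure_density A_def intro!: nn_integral_cong split: split_indicator)
      also have "\<dots> = ennreal (LINT t:ball y r|lborel. h t)"
        unfolding set_lebesgue_integral_def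
        using si[of "ball y r"] nn by (intro nn_integral_eq_integral) (auto simp: set_integrable_def)
      finally show ?thesis .
    qed
    moreover have "emeasure lborel (B n) = ennreal (10 * r)"
      using True yr K(1) by (simp add: B_def ball_eq_greaterThanLessThan)
    moreover have "0 \<le> (LINT t:ball y r|lborel. h t)"
      unfolding set_lebesgue_integral_def using nn by (intro integral_nonneg_AE) auto
    then have "ennreal (10 * r) \<le> ennreal (5 / c) * ennreal (LINT t:ball y r|lborel. h t)"
      using K c by (subst ennreal_mult[symmetric]) (auto intro!: ennreal_leI simp: field_simps)
    ultimately show ?thesis by simp
  qed (simp add: B_def)
  have "emeasure lborel E \<le> emeasure lborel (\<Union>n. B n)"
    by (rule emeasure_mono[OF B]) measurable
  also have "\<dots> \<le> (\<Sum>n. emeasure lborel (B n))"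
    by (rule emeasure_subadditive_countably) auto
  also have "\<dots> \<le> (\<Sum>n. ennreal (5 / c) * emeasure ?D (A n))"
    by (intro suminf_le each) auto
  also have "\<dots> = ennreal (5 / c) * emeasure ?D (\<Union>n. A n)"
    by (subst ennreal_suminf_cmult, subst suminf_emeasure) (use disj in auto)
  also have "\<dots> \<le> ennreal (5 / c) * emeasure ?D UNIV"
    by (intro mult_left_mono emeasure_mono) auto
  also have "emeasure ?D UNIV = ennreal (LINT t|lborel. h t)"
    using nn h by (simp add: emeasure_density nn_integral_eq_integral)
  also have "ennreal (5 / c) * ennreal (LINT t|lborel. h t) = ennreal (5 / c * (LINT t|lborel. h t))"
    using c nn by (intro ennreal_mult[symmetric]) auto
  finally show "emeasure lborel E \<le> ennreal (5 / c * (LINT t|lborel. h t))" .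
qed

lemma cL2_mult_indicator:
  assumes "f \<in> cL2" and [measurable]: "A \<in> sets borel"
  shows "(\<lambda>t. f t * indicator A t) \<in> cL2"
proof -
  have "integrable lborel (\<lambda>t. (f t)\<^sup>2 * indicator A t)"
    using cL2D(2)[OF assms(1)] integrable_mult_indicator[of A lborel "\<lambda>t. (f t)\<^sup>2"] by (simp add: mult.commute)
  moreover have "(f t * indicator A t)\<^sup>2 = (f t)\<^sup>2 * indicator A t" for t by (simp add: indicator_def)
  ultimately show ?thesis
    using assms cL2D(1)[OF assms(1)] unfolding cL2_def by (auto intro!: borel_measurable_times)
qed

lemma trunc_add:
  assumes "f \<in> cL2" "g \<in> cL2" "0 < e"
  shows "trunc e (\<lambda>t. f t + g t) x = trunc e f x + trunc e g x"
  using trunc_integrable[OF assms(1,3), of x] trunc_integrable[OF assms(2,3), of x]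
  by (simp add: trunc_def distrib_left)

lemma trunc_cmult: "trunc e (\<lambda>t. c * f t) x = c * trunc e f x"
  unfolding trunc_def by (subst integral_mult_right_zero[symmetric]) (simp add: mult.left_commute)

text \<open>The kernel is summed over the dyadic annuli \<open>2\<^sup>N e \<le> \<bar>t - x\<bar> < 2\<^sup>N\<^sup>+\<^sup>1 e\<close>.\<close>

lemma kern_sq_average:
  assumes f: "f \<in> cL2" and e: "0 < e"
    and avg: "\<And>r. 0 < r \<Longrightarrow> (LINT t:ball x r|lborel. (f t)\<^sup>2) \<le> lam\<^sup>2 * (2 * r)"
  shows "integrable lborel (\<lambda>t. (kern e (t - x))\<^sup>2 * (f t)\<^sup>2)"
    and "e * (LINT t|lborel. (kern e (t - x))\<^sup>2 * (f t)\<^sup>2) \<le> 8 * lam\<^sup>2"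
proof -
  note [measurable] = cL2D(1)[OF f]
  note f2 = cL2D(2)[OF f]
  have kb: "(kern e s)\<^sup>2 \<le> 1 / e\<^sup>2" for s
    using power_mono[OF kern_bound[OF e, of s], of 2] by (simp add: power_divide)
  show i: "integrable lborel (\<lambda>t. (kern e (t - x))\<^sup>2 * (f t)\<^sup>2)"
    by (rule Bochner_Integration.integrable_bound[of _ "\<lambda>t. 1 / e\<^sup>2 * (f t)\<^sup>2"])
      (use f2 kb in \<open>auto intro!: mult_right_mono simp del: times_divide_eq_left\<close>)
  define b where "b N = ball x (2 ^ N * e)" for N :: nat
  have [measurable]: "b N \<in> sets borel" for N by (simp add: b_def)
  have ib: "integrable lborel (\<lambda>t. indicator (b N) t * (f t)\<^sup>2)" for N
    using integrable_mult_indicator[OF _ f2, of "b N"] by simp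
  have ik: "integrable lborel (\<lambda>t. indicator (b N) t * ((kern e (t - x))\<^sup>2 * (f t)\<^sup>2))" for N
    using integrable_mult_indicator[OF _ i, of "b N"] by simp
  \<comment> \<open>The N-th annulus contributes at most e / (2^N e)^2 times lam^2 * 2 * 2^(N+1) e,
    that is 4 lam^2 / 2^N; the right-hand side is the partial sum of this geometric series.\<close>
  have *: "e * (LINT t|lborel. indicator (b N) t * ((kern e (t - x))\<^sup>2 * (f t)\<^sup>2)) \<le> 8 * lam\<^sup>2 * (1 - 1 / 2 ^ N)" for N
  proof (induction N)
    case 0
    have "indicator (b 0) t * ((kern e (t - x))\<^sup>2 * (f t)\<^sup>2) = 0" for t
      by (auto simp: b_def kern_def dist_real_def abs_minus_commute)
    then have "(LINT t|lborel. indicator (b 0) t * ((kern e (t - x))\<^sup>2 * (f t)\<^sup>2)) = 0" by (simp only: integral_zero)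
    then show ?case by simp
  next
    case (Suc N)
    have pt: "indicator (b (Suc N)) t * ((kern e (t - x))\<^sup>2 * (f t)\<^sup>2) \<le>
        indicator (b N) t * ((kern e (t - x))\<^sup>2 * (f t)\<^sup>2) + 1 / (2 ^ N * e)\<^sup>2 * (indicator (b (Suc N)) t * (f t)\<^sup>2)" for t
    proof (cases "t \<in> b N")
      case False
      then have ge: "2 ^ N * e \<le> \<bar>t - x\<bar>" by (auto simp: b_def dist_real_def abs_minus_commute)
      have "0 < 2 ^ N * e" using e by simp
      with ge have "(2 ^ N * e)\<^sup>2 \<le> (t - x)\<^sup>2" "0 < (2 ^ N * e)\<^sup>2"
        using power_mono[OF ge, of 2] by auto
      then have "(kern e (t - x))\<^sup>2 \<le> 1 / (2 ^ N * e)\<^sup>2"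
        by (auto simp: kern_sq intro!: frac_le)
      then have "indicator (b (Suc N)) t * ((kern e (t - x))\<^sup>2 * (f t)\<^sup>2) \<le> 1 / (2 ^ N * e)\<^sup>2 * (indicator (b (Suc N)) t * (f t)\<^sup>2)"
        by (auto simp: indicator_def intro!: mult_right_mono simp del: times_divide_eq_left)
      then show ?thesis using False by simp
    qed (auto simp: indicator_def)
    have bs: "(LINT t|lborel. indicator (b (Suc N)) t * (f t)\<^sup>2) \<le> lam\<^sup>2 * (2 * (2 ^ Suc N * e))"
      using avg[of "2 ^ Suc N * e"] e by (simp add: b_def set_lebesgue_integral_def)
    have "(LINT t|lborel. indicator (b (Suc N)) t * ((kern e (t - x))\<^sup>2 * (f t)\<^sup>2)) \<le>
      (LINT t|lborel. indicator (b N) t * ((kern e (t - x))\<^sup>2 * (f t)\<^sup>2) + 1 / (2 ^ N * e)\<^sup>2 * (indicator (b (Suc N)) t * (f t)\<^sup>2))"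
      using ik ib by (intro integral_mono pt Bochner_Integration.integrable_add integrable_mult_right)
    also have "\<dots> = (LINT t|lborel. indicator (b N) t * ((kern e (t - x))\<^sup>2 * (f t)\<^sup>2))
        + 1 / (2 ^ N * e)\<^sup>2 * (LINT t|lborel. indicator (b (Suc N)) t * (f t)\<^sup>2)"
      using ik ib by simp
    also have "\<dots> \<le> (LINT t|lborel. indicator (b N) t * ((kern e (t - x))\<^sup>2 * (f t)\<^sup>2))
        + 1 / (2 ^ N * e)\<^sup>2 * (lam\<^sup>2 * (2 * (2 ^ Suc N * e)))"
      by (intro add_left_mono mult_left_mono bs) auto
    finally have "e * (LINT t|lborel. indicator (b (Suc N)) t * ((kern e (t - x))\<^sup>2 * (f t)\<^sup>2)) \<le>
       e * ((LINT t|lborel. indicator (b N) t * ((kern e (t - x))\<^sup>2 * (f t)\<^sup>2))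
        + 1 / (2 ^ N * e)\<^sup>2 * (lam\<^sup>2 * (2 * (2 ^ Suc N * e))))"
      using e by (intro mult_left_mono) auto
    also have "\<dots> = e * (LINT t|lborel. indicator (b N) t * ((kern e (t - x))\<^sup>2 * (f t)\<^sup>2)) + 4 * lam\<^sup>2 / 2 ^ N"
      using e by (simp add: field_simps power2_eq_square)
    also have "\<dots> \<le> 8 * lam\<^sup>2 * (1 - 1 / 2 ^ N) + 4 * lam\<^sup>2 / 2 ^ N"
      by (intro add_right_mono Suc.IH)
    also have "\<dots> = 8 * lam\<^sup>2 * (1 - 1 / 2 ^ Suc N)"
      by (simp add: field_simps)
    finally show ?case .
  qed
  \<comment> \<open>The bounded support lies in a single ball \<open>b N\<close>, so a finite stage
    of the induction suffices and no limit in N is taken.\<close>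
  obtain R where R: "\<And>t. R < \<bar>t\<bar> \<Longrightarrow> f t = 0" using f by (auto simp: cL2_def)
  obtain N :: nat where N: "(R + \<bar>x\<bar>) / e < 2 ^ N"
    using real_arch_pow[of 2] by auto
  have "indicator (b N) t * ((kern e (t - x))\<^sup>2 * (f t)\<^sup>2) = (kern e (t - x))\<^sup>2 * (f t)\<^sup>2" for t
  proof (cases "t \<in> b N")
    case False
    then have "2 ^ N * e \<le> \<bar>t - x\<bar>" by (auto simp: b_def dist_real_def abs_minus_commute)
    moreover have "R + \<bar>x\<bar> < 2 ^ N * e" using N e by (simp add: pos_divide_less_eq)
    ultimately have "R < \<bar>t\<bar>" by linarith
    then show ?thesis using R by simp
  qed simp
  then have eq: "(LINT t|lborel. indicator (b N) t * ((kern e (t - x))\<^sup>2 * (f t)\<^sup>2)) = (LINT t|lborel. (kern e (t - x))\<^sup>2 * (f t)\<^sup>2)"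
    by (simp only:)
  have "e * (LINT t|lborel. (kern e (t - x))\<^sup>2 * (f t)\<^sup>2) \<le> 8 * lam\<^sup>2 * (1 - 1 / 2 ^ N)"
    using *[of N] unfolding eq .  also have "\<dots> \<le> 8 * lam\<^sup>2 * 1" by (intro mult_left_mono) auto
  finally show "e * (LINT t|lborel. (kern e (t - x))\<^sup>2 * (f t)\<^sup>2) \<le> 8 * lam\<^sup>2" by simp
qed

text \<open>The inequality \<bar>f\<bar> \<le> f^2 / (2 lam) + lam / 2 leaves two known integrals,
  of sizes 4 lam and lam. The integrand is the error made when the kernel centred at x is replaced
  by one centred at a point within e / 2 of x.\<close>

lemma kern_far_error:
  assumes f: "f \<in> cL2" and e: "0 < e" and lam: "0 < lam"
    and avg: "\<And>r. 0 < r \<Longrightarrow> (LINT t:ball x r|lborel. (f t)\<^sup>2) \<le> lam\<^sup>2 * (2 * r)"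
  shows "integrable lborel (\<lambda>t. e * (kern e (t - x))\<^sup>2 * \<bar>f t\<bar>)"
    and "(LINT t|lborel. e * (kern e (t - x))\<^sup>2 * \<bar>f t\<bar>) \<le> 5 * lam"
proof -
  note [measurable] = cL2D(1)[OF f]
  note K = kern_sq_average[OF f e avg]
  have k2: "integrable lborel (\<lambda>t. (kern e (t - x))\<^sup>2)" "(LINT t|lborel. (kern e (t - x))\<^sup>2) = 2 / e"
    using kern_sq_shift_integral[OF e, of x] by (auto simp: has_bochner_integral_iff)
  define g where "g t = e / (2 * lam) * ((kern e (t - x))\<^sup>2 * (f t)\<^sup>2) + e * lam / 2 * (kern e (t - x))\<^sup>2" for t
  have g: "integrable lborel g" unfolding g_def using K(1) k2(1) by simp
  have b: "e * (kern e (t - x))\<^sup>2 * \<bar>f t\<bar> \<le> g t" for t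
  proof -
    have "0 \<le> (\<bar>f t\<bar> - lam)\<^sup>2" by simp
    then have "\<bar>f t\<bar> \<le> (f t)\<^sup>2 / (2 * lam) + lam / 2"
      using lam by (simp add: power2_diff field_simps power2_eq_square)
    then have "e * (kern e (t - x))\<^sup>2 * \<bar>f t\<bar> \<le> e * (kern e (t - x))\<^sup>2 * ((f t)\<^sup>2 / (2 * lam) + lam / 2)"
      using e by (intro mult_left_mono) auto
    then show ?thesis by (simp add: g_def algebra_simps)
  qed
  show i: "integrable lborel (\<lambda>t. e * (kern e (t - x))\<^sup>2 * \<bar>f t\<bar>)"
    by (rule Bochner_Integration.integrable_bound[OF g]) (use b e in \<open>auto simp: abs_mult intro!: order.trans[OF b abs_ge_self]\<close>)
  have "(LINT t|lborel. e * (kern e (t - x))\<^sup>2 * \<bar>f t\<bar>) \<le> (LINT t|lborel. g t)"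
    by (rule integral_mono[OF i g b])
  also have "\<dots> = 1 / (2 * lam) * (e * (LINT t|lborel. (kern e (t - x))\<^sup>2 * (f t)\<^sup>2)) + e * lam / 2 * (2 / e)"
    unfolding g_def using K(1) k2 by simp
  also have "\<dots> \<le> 1 / (2 * lam) * (8 * lam\<^sup>2) + e * lam / 2 * (2 / e)"
    by (intro add_right_mono mult_left_mono K(2)) (use lam in auto)
  also have "\<dots> = 5 * lam" using lam e by (simp add: field_simps power2_eq_square)
  finally show "(LINT t|lborel. e * (kern e (t - x))\<^sup>2 * \<bar>f t\<bar>) \<le> 5 * lam" .
qed

text \<open>Cotlar's argument: the truncation at the coarse level \<open>e\<close> is compared with the fine one at a
  point \<open>u\<close> near \<open>x\<close> where both the fine truncation of \<open>f\<close> and that of its local part are of average size.\<close>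

lemma cotlar:
  assumes f: "f \<in> cL2" and d: "0 < d" "2 * d \<le> e" and lam: "0 < lam"
    and avg: "\<And>r. 0 < r \<Longrightarrow> (LINT t:ball x r|lborel. (f t)\<^sup>2 + (trunc d f t)\<^sup>2) \<le> lam\<^sup>2 * (2 * r)"
  shows "\<bar>trunc e f x\<bar> \<le> 14 * lam"
proof -
  have e: "0 < e" using d by linarith
  note [measurable] = cL2D(1)[OF f] trunc_measurable[OF cL2D(1)[OF f]]
  define f1 where "f1 t = f t * indicator (ball x e) t" for t
  define f2 where "f2 t = f t * indicator (- ball x e) t" for t
  have f12: "f1 \<in> cL2" "f2 \<in> cL2"
    unfolding f1_def f2_def by (auto intro!: cL2_mult_indicator[OF f])
  have tf: "trunc d f u = trunc d f1 u + trunc d f2 u" for u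
  proof -
    have "f = (\<lambda>t. f1 t + f2 t)" by (auto simp: f1_def f2_def indicator_def)
    then show ?thesis using trunc_add[OF f12 d(1), of u] by simp
  qed
  have ind: "integrable lborel (\<lambda>t. indicator A t * g t)" if "integrable lborel g" "A \<in> sets borel"
    for A and g :: "real \<Rightarrow> real"
    using integrable_mult_indicator[of A lborel g] that by simp
  have avgs: "(LINT t|lborel. indicator (ball x r) t * (f t)\<^sup>2) \<le> lam\<^sup>2 * (2 * r)"
    "(LINT t|lborel. indicator (ball x r) t * (trunc d f t)\<^sup>2) \<le> lam\<^sup>2 * (2 * r)" if r: "0 < r" for r
  proof -
    have sum: "(LINT t|lborel. indicator (ball x r) t * (f t)\<^sup>2) + (LINT t|lborel. indicator (ball x r) t * (trunc d f t)\<^sup>2) \<le> lam\<^sup>2 * (2 * r)"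
      using avg[OF r] ind[OF cL2D(2)[OF f], of "ball x r"] ind[OF trunc_L2(1)[OF f d(1)], of "ball x r"]
      by (simp add: set_lebesgue_integral_def distrib_left)
    moreover have "0 \<le> (LINT t|lborel. indicator (ball x r) t * (f t)\<^sup>2)"
      "0 \<le> (LINT t|lborel. indicator (ball x r) t * (trunc d f t)\<^sup>2)"
      by (auto intro!: integral_nonneg_AE)
    ultimately show "(LINT t|lborel. indicator (ball x r) t * (f t)\<^sup>2) \<le> lam\<^sup>2 * (2 * r)"
      "(LINT t|lborel. indicator (ball x r) t * (trunc d f t)\<^sup>2) \<le> lam\<^sup>2 * (2 * r)" by linarith+
  qed
  \<comment> \<open>On the support of \<open>f2\<close> both kernels are reciprocals, and their
    difference is (x - u) / ((t - x)(t - u)). Since \<bar>x - u\<bar> < e / 2 and \<bar>t - u\<bar>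
    \<ge> \<bar>t - x\<bar> / 2, it is at most e / (t - x)^2.\<close>
  have near: "\<bar>trunc e f x - trunc d f2 u\<bar> \<le> 5 * lam" if u: "u \<in> ball x (e / 2)" for u
  proof -
    have "\<bar>kern e (t - x) * f t - kern d (t - u) * f2 t\<bar> \<le> e * (kern e (t - x))\<^sup>2 * \<bar>f t\<bar>" for t
    proof (cases "t \<in> ball x e")
      case True
      then show ?thesis by (simp add: f2_def kern_def dist_real_def abs_minus_commute)
    next
      case False
      then have tx: "e \<le> \<bar>t - x\<bar>" by (simp add: dist_real_def abs_minus_commute)
      have xu: "\<bar>x - u\<bar> < e / 2" using u by (simp add: dist_real_def)
      moreover have "\<bar>t - x\<bar> \<le> \<bar>t - u\<bar> + \<bar>x - u\<bar>" by linarith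
      moreover have "p / 2 \<le> q" if "r < e / 2" "p \<le> q + r" "e \<le> p" for p q r :: real
        using that by linarith
      ultimately have tu: "\<bar>t - x\<bar> / 2 \<le> \<bar>t - u\<bar>" using tx by blast
      \<comment> \<open>Because of 2d \<le> e the fine window around \<open>u\<close> does not reach
        the support of \<open>f2\<close>.\<close>
      have "d \<le> q" if "p / 2 \<le> q" "e \<le> p" for p q :: real
        using that d by linarith
      with tu tx have tu2: "d \<le> \<bar>t - u\<bar>" by blast
      with d have tu3: "0 < \<bar>t - u\<bar>" by (rule_tac less_le_trans) auto
      note tu = tu tu2 tu3
      have k: "kern e (t - x) = 1 / (t - x)" "kern d (t - u) = 1 / (t - u)" using tx tu by (auto simp: kern_def)
      have "kern e (t - x) - kern d (t - u) = (x - u) / ((t - x) * (t - u))"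
        unfolding k using tx e tu by (simp add: divide_simps)
      then have "\<bar>kern e (t - x) - kern d (t - u)\<bar> = \<bar>x - u\<bar> / (\<bar>t - x\<bar> * \<bar>t - u\<bar>)"
        by (simp add: abs_mult)
      also have "\<dots> \<le> (e / 2) / (\<bar>t - x\<bar> * (\<bar>t - x\<bar> / 2))"
        using tx e tu xu by (intro frac_le mult_left_mono mult_pos_pos) auto
      also have "\<dots> = e * (kern e (t - x))\<^sup>2"
        unfolding k(1) using tx e by (simp add: power2_eq_square field_simps)
      finally have "\<bar>kern e (t - x) - kern d (t - u)\<bar> * \<bar>f t\<bar> \<le> e * (kern e (t - x))\<^sup>2 * \<bar>f t\<bar>"
        by (intro mult_right_mono) auto
      moreover have "f2 t = f t" using False by (simp add: f2_def)
      ultimately show ?thesis by (simp add: abs_mult[symmetric] left_diff_distrib)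
    qed
    note pt = this
    note err = kern_far_error[OF f e lam, of x]
    have i: "integrable lborel (\<lambda>t. kern e (t - x) * f t - kern d (t - u) * f2 t)"
      using trunc_integrable[OF f e, of x] trunc_integrable[OF f12(2) d(1), of u] by simp
    have "\<bar>trunc e f x - trunc d f2 u\<bar> = \<bar>LINT t|lborel. kern e (t - x) * f t - kern d (t - u) * f2 t\<bar>"
      using trunc_integrable[OF f e, of x] trunc_integrable[OF f12(2) d(1), of u] by (simp add: trunc_def)
    also have "\<dots> \<le> (LINT t|lborel. \<bar>kern e (t - x) * f t - kern d (t - u) * f2 t\<bar>)"
      by (rule integral_abs_bound)
    also have "\<dots> \<le> (LINT t|lborel. e * (kern e (t - x))\<^sup>2 * \<bar>f t\<bar>)"
      by (rule integral_mono[OF integrable_abs[OF i] err(1) pt]) (use avgs(1) in \<open>simp add: set_lebesgue_integral_def\<close>)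
    also have "\<dots> \<le> 5 * lam"
      by (rule err(2)) (use avgs(1) in \<open>simp add: set_lebesgue_integral_def\<close>)
    finally show ?thesis .
  qed
  \<comment> \<open>Over the ball of length e, the square of the truncation of \<open>f\<close>
    integrates to at most lam^2 e, and that of \<open>f1\<close> to at most 16 * 2 lam^2 e. The
    total 33 lam^2 e forces a point where the sum is at most 34 lam^2.\<close>
  obtain u where u: "u \<in> ball x (e / 2)" "(trunc d f u)\<^sup>2 + (trunc d f1 u)\<^sup>2 \<le> 34 * lam\<^sup>2"
  proof (rule ccontr)
    assume "\<not> thesis"
    with that have big: "34 * lam\<^sup>2 < (trunc d f u)\<^sup>2 + (trunc d f1 u)\<^sup>2" if "u \<in> ball x (e / 2)" for u
      using that by force
    let ?B = "ball x (e / 2)"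
    have em: "emeasure lborel ?B = ennreal e" using e by (simp add: ball_eq_greaterThanLessThan)
    have iA: "integrable lborel (\<lambda>t. indicator ?B t * (trunc d f t)\<^sup>2)"
      by (rule ind[OF trunc_L2(1)[OF f d(1)]]) simp
    have iC: "integrable lborel (\<lambda>t. indicator ?B t * (trunc d f1 t)\<^sup>2)"
      by (rule ind[OF trunc_L2(1)[OF f12(1) d(1)]]) simp
    have "34 * lam\<^sup>2 * e = (LINT t|lborel. indicator ?B t * (34 * lam\<^sup>2))"
      using em e by (simp add: measure_def)
    also have "\<dots> \<le> (LINT t|lborel. indicator ?B t * (trunc d f t)\<^sup>2 + indicator ?B t * (trunc d f1 t)\<^sup>2)"
    proof (rule integral_mono)
      show "integrable lborel (\<lambda>t. indicator ?B t * (34 * lam\<^sup>2))"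
        using em by (intro integrable_mult_left integrable_real_indicator) auto
      show "integrable lborel (\<lambda>t. indicator ?B t * (trunc d f t)\<^sup>2 + indicator ?B t * (trunc d f1 t)\<^sup>2)"
        using iA iC by simp
      show "indicator ?B t * (34 * lam\<^sup>2) \<le> indicator ?B t * (trunc d f t)\<^sup>2 + indicator ?B t * (trunc d f1 t)\<^sup>2" for t
        using big[of t] by (cases "t \<in> ?B") auto
    qed
    also have "\<dots> = (LINT t|lborel. indicator ?B t * (trunc d f t)\<^sup>2) + (LINT t|lborel. indicator ?B t * (trunc d f1 t)\<^sup>2)"
      using iA iC by simp
    also have "(LINT t|lborel. indicator ?B t * (trunc d f t)\<^sup>2) \<le> lam\<^sup>2 * e"
      using avgs(2)[of "e / 2"] e by simp
    also have "(LINT t|lborel. indicator ?B t * (trunc d f1 t)\<^sup>2) \<le> (LINT t|lborel. (trunc d f1 t)\<^sup>2)"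
      using iC trunc_L2(1)[OF f12(1) d(1)] by (intro integral_mono) (auto simp: indicator_def)
    also have "\<dots> \<le> 16 * (LINT t|lborel. (f1 t)\<^sup>2)"
      by (rule trunc_L2(2)[OF f12(1) d(1)])
    also have "(LINT t|lborel. (f1 t)\<^sup>2) = (LINT t|lborel. indicator (ball x e) t * (f t)\<^sup>2)"
      by (intro Bochner_Integration.integral_cong) (auto simp: f1_def indicator_def)
    also have "\<dots> \<le> lam\<^sup>2 * (2 * e)"
      using avgs(1)[of e] e by simp
    finally have "34 * lam\<^sup>2 * e \<le> 33 * lam\<^sup>2 * e" by (simp add: algebra_simps)
    moreover have "0 < lam\<^sup>2 * e" using e lam by simp
    ultimately show False by (simp add: algebra_simps)
  qed
  \<comment> \<open>The square of the sum is at most 2 * 34 lam^2 = 68 lam^2, rounded up to the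
    square of 9 lam; together with the error 5 lam this gives 14 lam.\<close>
  have "(\<bar>trunc d f u\<bar> + \<bar>trunc d f1 u\<bar>)\<^sup>2 \<le> 2 * ((trunc d f u)\<^sup>2 + (trunc d f1 u)\<^sup>2)"
  proof -
    have "0 \<le> (\<bar>trunc d f u\<bar> - \<bar>trunc d f1 u\<bar>)\<^sup>2" by simp
    then show ?thesis by (simp add: power2_diff power2_sum)
  qed
  also have "\<dots> \<le> 81 * lam\<^sup>2" using u(2) by (simp add: order.trans[OF _ mult_right_mono[of 68 81]])
  finally have "(\<bar>trunc d f u\<bar> + \<bar>trunc d f1 u\<bar>)\<^sup>2 \<le> (9 * lam)\<^sup>2" by (simp add: power_mult_distrib)
  then have "\<bar>trunc d f u\<bar> + \<bar>trunc d f1 u\<bar> \<le> 9 * lam" by (rule power2_le_imp_le) (use lam in auto)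
  then show ?thesis using near[OF u(1)] tf[of u] by linarith
qed

section \<open>Existence of principal values almost everywhere\<close>

definition has_pv :: "(real \<Rightarrow> real) \<Rightarrow> real \<Rightarrow> real \<Rightarrow> bool" where
  "has_pv f x l \<longleftrightarrow> ((\<lambda>e. trunc e f x) \<longlongrightarrow> l) (at_right 0)"

lemma cL2_bound:
  assumes f: "f \<in> cL2" and g: "g \<in> borel_measurable borel" and le: "\<And>t. \<bar>g t\<bar> \<le> \<bar>f t\<bar>"
  shows "g \<in> cL2"
proof -
  have sq: "(g t)\<^sup>2 \<le> (f t)\<^sup>2" for t using le[of t] by (simp add: abs_le_square_iff)
  have "integrable lborel (\<lambda>t. (g t)\<^sup>2)"
    by (rule Bochner_Integration.integrable_bound[OF cL2D(2)[OF f]]) (use sq g in auto)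
  moreover obtain R where "\<And>t. R < \<bar>t\<bar> \<Longrightarrow> f t = 0" using f by (auto simp: cL2_def)
  then have "g t = 0" if "R < \<bar>t\<bar>" for t using that le[of t] by simp
  ultimately show ?thesis using g by (auto simp: cL2_def)
qed

lemma cL2_cmult: "f \<in> cL2 \<Longrightarrow> (\<lambda>t. c * f t) \<in> cL2"
  by (auto simp: cL2_def power_mult_distrib)

lemma cL2_add:
  assumes f: "f \<in> cL2" and g: "g \<in> cL2"
  shows "(\<lambda>t. f t + g t) \<in> cL2"
proof -
  have [measurable]: "f \<in> borel_measurable borel" "g \<in> borel_measurable borel"
    using cL2D[OF f] cL2D[OF g] by auto
  have b: "(x + y)\<^sup>2 \<le> 2 * x\<^sup>2 + 2 * y\<^sup>2" for x y :: real
  proof -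
    have "0 \<le> (x - y)\<^sup>2" by simp
    then show ?thesis by (simp add: power2_diff power2_sum)
  qed
  have "integrable lborel (\<lambda>t. (f t + g t)\<^sup>2)"
    by (rule Bochner_Integration.integrable_bound[of _ "\<lambda>t. 2 * (f t)\<^sup>2 + 2 * (g t)\<^sup>2"])
      (use cL2D(2)[OF f] cL2D(2)[OF g] b in auto)
  moreover obtain R S where "\<And>t. R < \<bar>t\<bar> \<Longrightarrow> f t = 0" "\<And>t. S < \<bar>t\<bar> \<Longrightarrow> g t = 0"
    using f g by (auto simp: cL2_def)
  then have "\<exists>R. \<forall>t. R < \<bar>t\<bar> \<longrightarrow> f t + g t = 0" by (intro exI[of _ "max R S"]) auto
  ultimately show ?thesis by (auto simp: cL2_def)
qed

lemma cL2_diff: "f \<in> cL2 \<Longrightarrow> g \<in> cL2 \<Longrightarrow> (\<lambda>t. f t - g t) \<in> cL2"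
  using cL2_add[of f "\<lambda>t. -1 * g t"] cL2_cmult[of g "-1"] by simp

lemma trunc_diff:
  assumes "f \<in> cL2" "g \<in> cL2" "0 < e"
  shows "trunc e (\<lambda>t. f t - g t) x = trunc e f x - trunc e g x"
  using trunc_add[OF assms(1) cL2_cmult[OF assms(2), of "-1"] assms(3), of x] trunc_cmult[of e "-1" g x] by simp

lemma has_pv_add:
  assumes "f \<in> cL2" "g \<in> cL2" "has_pv f x l" "has_pv g x m"
  shows "has_pv (\<lambda>t. f t + g t) x (l + m)"
  unfolding has_pv_def
proof (rule Lim_transform_eventually)
  show "((\<lambda>e. trunc e f x + trunc e g x) \<longlongrightarrow> l + m) (at_right 0)"
    using assms(3,4) unfolding has_pv_def by (rule tendsto_add)
  show "\<forall>\<^sub>F e in at_right 0. trunc e f x + trunc e g x = trunc e (\<lambda>t. f t + g t) x"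
    using eventually_at_right_less[of 0] by eventually_elim (simp add: trunc_add assms)
qed

lemma has_pv_cmult: "has_pv f x l \<Longrightarrow> has_pv (\<lambda>t. c * f t) x (c * l)"
  unfolding has_pv_def trunc_cmult by (rule tendsto_mult_left)

lemma has_pv_diff:
  assumes "f \<in> cL2" "g \<in> cL2" "has_pv f x l" "has_pv g x m"
  shows "has_pv (\<lambda>t. f t - g t) x (l - m)"
  using has_pv_add[OF assms(1) cL2_cmult[OF assms(2)] assms(3) has_pv_cmult[OF assms(4)], of "-1"] by simp

text \<open>Cotlar's bound at fine level d covers only e \<ge> 2d, and its exceptional set depends
  on d. Let d run through 1 / (n + 1) and discard the points lying in \<open>E n\<close> for all
  large n: any other point avoids \<open>E n\<close> for arbitrarily large n, hence for some n with
  2 \<open>d n\<close> \<le> e. The constant is 85 = 5 * 17, with 17 = 1 + 16 from the integral of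
  f^2 plus that of the squared truncation.\<close>

lemma maximal_trunc:
  assumes f: "f \<in> cL2" and lam: "0 < lam"
  shows "\<exists>B\<in>sets borel. emeasure lborel B \<le> ennreal (85 / lam\<^sup>2 * (LINT t|lborel. (f t)\<^sup>2)) \<and>
    (\<forall>x. x \<notin> B \<longrightarrow> (\<forall>e>0. \<bar>trunc e f x\<bar> \<le> 14 * lam))"
proof -
  define d where "d n = 1 / real (Suc n)" for n
  have d0: "0 < d n" for n by (simp add: d_def)
  define h where "h n t = (f t)\<^sup>2 + (trunc (d n) f t)\<^sup>2" for n t
  have h: "integrable lborel (h n)" "(LINT t|lborel. h n t) \<le> 17 * (LINT t|lborel. (f t)\<^sup>2)" for n
    unfolding h_def using cL2D(2)[OF f] trunc_L2[OF f d0, of n] by auto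
  have "\<exists>E. open E \<and> emeasure lborel E \<le> ennreal (85 / lam\<^sup>2 * (LINT t|lborel. (f t)\<^sup>2)) \<and>
    (\<forall>x r. x \<notin> E \<longrightarrow> 0 < r \<longrightarrow> (LINT t:ball x r|lborel. h n t) \<le> lam\<^sup>2 * (2 * r))" for n
  proof -
    obtain E where E: "open E" "emeasure lborel E \<le> ennreal (5 / lam\<^sup>2 * (LINT t|lborel. h n t))"
      "\<And>x r. x \<notin> E \<Longrightarrow> 0 < r \<Longrightarrow> (LINT t:ball x r|lborel. h n t) \<le> lam\<^sup>2 * (2 * r)"
      using maximal_weak_type[OF h(1)[of n], of "lam\<^sup>2"] lam by (auto simp: h_def)
    have "5 / lam\<^sup>2 * (LINT t|lborel. h n t) \<le> 5 / lam\<^sup>2 * (17 * (LINT t|lborel. (f t)\<^sup>2))"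
      using h(2) by (intro mult_left_mono) auto
    then have "5 / lam\<^sup>2 * (LINT t|lborel. h n t) \<le> 85 / lam\<^sup>2 * (LINT t|lborel. (f t)\<^sup>2)" by simp
    with E show ?thesis by (meson ennreal_leI order_trans)
  qed
  then obtain E where E: "\<And>n. open (E n)"
    "\<And>n. emeasure lborel (E n) \<le> ennreal (85 / lam\<^sup>2 * (LINT t|lborel. (f t)\<^sup>2))"
    "\<And>n x r. x \<notin> E n \<Longrightarrow> 0 < r \<Longrightarrow> (LINT t:ball x r|lborel. h n t) \<le> lam\<^sup>2 * (2 * r)"
    by metis
  have [measurable]: "E n \<in> sets borel" for n using E(1) by auto
  \<comment> \<open>These intersections increase with N, so the measure of their union is the
    supremum of measures that all obey the same bound. The union of the \<open>E n\<close> would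
    obey no such bound.\<close>
  define B where "B N = (\<Inter>n\<in>{N..}. E n)" for N
  have B[measurable]: "B N \<in> sets borel" for N unfolding B_def by measurable
  have "emeasure lborel (\<Union>N. B N) = (SUP N. emeasure lborel (B N))"
    by (rule SUP_emeasure_incseq[symmetric]) (auto simp: B_def incseq_def)
  also have "\<dots> \<le> ennreal (85 / lam\<^sup>2 * (LINT t|lborel. (f t)\<^sup>2))"
  proof (rule SUP_least)
    fix N
    have "emeasure lborel (B N) \<le> emeasure lborel (E N)"
      by (rule emeasure_mono) (auto simp: B_def)
    also note E(2)
    finally show "emeasure lborel (B N) \<le> ennreal (85 / lam\<^sup>2 * (LINT t|lborel. (f t)\<^sup>2))" .
  qed
  finally have "emeasure lborel (\<Union>N. B N) \<le> ennreal (85 / lam\<^sup>2 * (LINT t|lborel. (f t)\<^sup>2))" .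
  moreover have "\<bar>trunc e f x\<bar> \<le> 14 * lam" if x: "x \<notin> (\<Union>N. B N)" and e: "0 < e" for x e
  proof -
    obtain N where N: "2 / e < real N" using reals_Archimedean2 by blast
    obtain n where n: "N \<le> n" "x \<notin> E n" using x by (auto simp: B_def)
    have "2 / e < real (Suc n)" using N n(1) by linarith
    then have "2 * d n \<le> e" using e by (simp add: d_def field_simps)
    then show ?thesis
      using cotlar[OF f d0 _ lam, of n e x] E(3)[OF n(2)] by (simp add: h_def)
  qed
  ultimately show ?thesis using B by (intro bexI[of _ "\<Union>N. B N"]) auto
qed

section \<open>From the maximal inequality to almost everywhere convergence\<close>

text \<open>The oscillation of the truncations of \<open>f\<close> near e = 0 is at most that of
  \<open>g n\<close>, which vanishes in the limit, plus twice the maximal truncation of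
  \<open>f - g n\<close>, which is small outside a set of measure proportional to the squared L2
  distance.\<close>

lemma pv_exists_closed:
  assumes f: "f \<in> cL2" and g: "\<And>n. g n \<in> cL2" "\<And>n. AE x in lborel. \<exists>l. has_pv (g n) x l"
    and lim: "(\<lambda>n. LINT t|lborel. (f t - g n t)\<^sup>2) \<longlonglongrightarrow> 0"
  shows "AE x in lborel. \<exists>l. has_pv f x l"
proof -
  have main: "AE x in lborel. \<exists>\<eta>>0. \<forall>e e'. 0 < e \<and> e < \<eta> \<and> 0 < e' \<and> e' < \<eta> \<longrightarrow> \<bar>trunc e f x - trunc e' f x\<bar> \<le> 29 * lam"
    if lam: "0 < lam" for lam
  proof -
    have "\<forall>n. \<exists>B. B \<in> sets borel \<and> emeasure lborel B \<le> ennreal (85 / lam\<^sup>2 * (LINT t|lborel. (f t - g n t)\<^sup>2)) \<and>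
      (\<forall>x. x \<notin> B \<longrightarrow> (\<forall>e>0. \<bar>trunc e (\<lambda>t. f t - g n t) x\<bar> \<le> 14 * lam))"
      using maximal_trunc[OF cL2_diff[OF f g(1)] lam] unfolding Bex_def by (rule allI)
    from choice[OF this] obtain B where B_all: "\<forall>n. B n \<in> sets borel \<and>
        emeasure lborel (B n) \<le> ennreal (85 / lam\<^sup>2 * (LINT t|lborel. (f t - g n t)\<^sup>2)) \<and>
      (\<forall>x. x \<notin> B n \<longrightarrow> (\<forall>e>0. \<bar>trunc e (\<lambda>t. f t - g n t) x\<bar> \<le> 14 * lam))" ..
    then have B[measurable]: "\<And>n. B n \<in> sets borel"
      and Be: "\<And>n. emeasure lborel (B n) \<le> ennreal (85 / lam\<^sup>2 * (LINT t|lborel. (f t - g n t)\<^sup>2))"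
      and Bx: "\<And>n x e. x \<notin> B n \<Longrightarrow> 0 < e \<Longrightarrow> \<bar>trunc e (\<lambda>t. f t - g n t) x\<bar> \<le> 14 * lam"
      by simp_all
    \<comment> \<open>The intersection of the exceptional sets is null, since it is contained in
      each of them. Off it, each point has some good n, which may depend on the point.\<close>
    have "emeasure lborel (\<Inter>n. B n) \<le> ennreal (85 / lam\<^sup>2 * (LINT t|lborel. (f t - g n t)\<^sup>2))" for n
      using Be[of n] emeasure_mono[of "\<Inter>n. B n" "B n" lborel] by (auto intro: order.trans)
    moreover have "(\<lambda>n. ennreal (85 / lam\<^sup>2 * (LINT t|lborel. (f t - g n t)\<^sup>2))) \<longlonglongrightarrow> ennreal (85 / lam\<^sup>2 * 0)"
      by (intro tendsto_ennrealI tendsto_mult_left lim)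
    ultimately have "emeasure lborel (\<Inter>n. B n) \<le> ennreal (85 / lam\<^sup>2 * 0)"
      by (meson LIMSEQ_le_const)
    then have "(\<Inter>n. B n) \<in> null_sets lborel" by (auto simp: null_sets_def)
    then have "AE x in lborel. x \<notin> (\<Inter>n. B n)" by (rule AE_not_in)
    moreover have "AE x in lborel. \<forall>n. \<exists>l. has_pv (g n) x l"
      using g(2) by (simp add: AE_all_countable)
    ultimately show ?thesis
    proof eventually_elim
      fix x assume "x \<notin> (\<Inter>n. B n)" and pv: "\<forall>n. \<exists>l. has_pv (g n) x l"
      then obtain n where n: "x \<notin> B n" by auto
      from pv obtain l where "((\<lambda>e. trunc e (g n) x) \<longlongrightarrow> l) (at_right 0)" by (auto simp: has_pv_def)
      from tendstoD[OF this, of "lam / 2"] lam obtain \<eta> where \<eta>: "0 < \<eta>"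
        "\<And>e. 0 < e \<Longrightarrow> e < \<eta> \<Longrightarrow> \<bar>trunc e (g n) x - l\<bar> < lam / 2"
        by (auto simp: eventually_at_right[of 0 1, simplified] dist_real_def)
      \<comment> \<open>The factor 29 is 14 + 14 for the two truncations of \<open>f - g n\<close>,
        plus 1/2 + 1/2 for those of \<open>g n\<close> around their limit.\<close>
      have "\<bar>trunc e f x - trunc e' f x\<bar> \<le> 29 * lam" if e: "0 < e" "e < \<eta>" "0 < e'" "e' < \<eta>" for e e'
      proof -
        have "trunc e f x = trunc e (g n) x + trunc e (\<lambda>t. f t - g n t) x"
          "trunc e' f x = trunc e' (g n) x + trunc e' (\<lambda>t. f t - g n t) x"
          using trunc_diff[OF f g(1)] e by simp_all
        moreover note \<eta>(2)[OF e(1,2)] \<eta>(2)[OF e(3,4)] Bx[OF n e(1)] Bx[OF n e(3)]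
        ultimately show ?thesis by linarith
      qed
      then show "\<exists>\<eta>>0. \<forall>e e'. 0 < e \<and> e < \<eta> \<and> 0 < e' \<and> e' < \<eta> \<longrightarrow> \<bar>trunc e f x - trunc e' f x\<bar> \<le> 29 * lam"
        using \<eta>(1) by blast
    qed
  qed
  have "AE x in lborel. \<forall>k. \<exists>\<eta>>0. \<forall>e e'. 0 < e \<and> e < \<eta> \<and> 0 < e' \<and> e' < \<eta> \<longrightarrow>
      \<bar>trunc e f x - trunc e' f x\<bar> \<le> 29 * (1 / real (Suc k))"
    unfolding AE_all_countable by (intro allI main) simp
  then show ?thesis
  proof eventually_elim
    fix x assume ev: "\<forall>k. \<exists>\<eta>>0. \<forall>e e'. 0 < e \<and> e < \<eta> \<and> 0 < e' \<and> e' < \<eta> \<longrightarrow>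
      \<bar>trunc e f x - trunc e' f x\<bar> \<le> 29 * (1 / real (Suc k))"
    have cau: "\<exists>\<eta>>0. \<forall>e e'. 0 < e \<and> e < \<eta> \<and> 0 < e' \<and> e' < \<eta> \<longrightarrow> \<bar>trunc e f x - trunc e' f x\<bar> < r" if r: "0 < r" for r
    proof -
      obtain k where "29 / r < real k" using reals_Archimedean2 by blast
      then have "29 / r < real (Suc k)" by simp
      then have k: "29 * (1 / real (Suc k)) < r" using r by (simp add: field_simps)
      from ev obtain \<eta> where "0 < \<eta>" "\<forall>e e'. 0 < e \<and> e < \<eta> \<and> 0 < e' \<and> e' < \<eta> \<longrightarrow>
        \<bar>trunc e f x - trunc e' f x\<bar> \<le> 29 * (1 / real (Suc k))" by blast
      then show ?thesis using k by (meson order.strict_trans1)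
    qed
    \<comment> \<open>The sequence 1 / (n + 1) only produces a candidate for the limit; the Cauchy
      estimate in e and e' then covers all small e.\<close>
    define s where "s n = trunc (1 / real (Suc n)) f x" for n
    have small: "\<exists>N. \<forall>n\<ge>N. 1 / real (Suc n) < \<eta>" if pos: "0 < \<eta>" for \<eta>
    proof -
      obtain N where N: "1 / real (Suc N) < \<eta>" using nat_approx_posE[OF pos] by blast
      have "1 / real (Suc n) < \<eta>" if "N \<le> n" for n
        by (rule order.strict_trans1[OF _ N]) (use that in \<open>simp add: frac_le\<close>)
      then show ?thesis by blast
    qed
    have "Cauchy s"
      unfolding Cauchy_altdef2 dist_real_def s_def
    proof (intro allI impI)
      fix r :: real assume "0 < r"
      then obtain \<eta> where \<eta>: "0 < \<eta>" "\<forall>e e'. 0 < e \<and> e < \<eta> \<and> 0 < e' \<and> e' < \<eta> \<longrightarrow> \<bar>trunc e f x - trunc e' f x\<bar> < r"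
        using cau by blast
      obtain N where "\<forall>n\<ge>N. 1 / real (Suc n) < \<eta>" using small[OF \<eta>(1)] by blast
      then show "\<exists>N. \<forall>n\<ge>N. \<bar>trunc (1 / real (Suc n)) f x - trunc (1 / real (Suc N)) f x\<bar> < r"
        using \<eta>(2) by (intro exI[of _ N]) auto
    qed
    then obtain l where l: "s \<longlonglongrightarrow> l" using Cauchy_convergent_iff convergent_def by blast
    have "has_pv f x l"
      unfolding has_pv_def
    proof (rule tendstoI)
      fix r :: real assume r: "0 < r"
      obtain \<eta> where \<eta>: "0 < \<eta>" "\<forall>e e'. 0 < e \<and> e < \<eta> \<and> 0 < e' \<and> e' < \<eta> \<longrightarrow> \<bar>trunc e f x - trunc e' f x\<bar> < r / 2"
        using cau[of "r / 2"] r by auto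
      obtain N where N: "\<forall>n\<ge>N. 1 / real (Suc n) < \<eta>" using small[OF \<eta>(1)] by blast
      obtain M where M: "\<forall>n\<ge>M. \<bar>s n - l\<bar> < r / 2" using LIMSEQ_D[OF l, of "r / 2"] r by auto
      define n where "n = max N M"
      have n: "1 / real (Suc n) < \<eta>" "\<bar>s n - l\<bar> < r / 2" using N M by (auto simp: n_def)
      have "dist (trunc e f x) l < r" if "0 < e" "e < \<eta>" for e
      proof -
        have "\<bar>trunc e f x - s n\<bar> < r / 2" using \<eta>(2) that n(1) by (simp add: s_def)
        with n(2) show ?thesis unfolding dist_real_def by linarith
      qed
      then show "\<forall>\<^sub>F e in at_right 0. dist (trunc e f x) l < r"
        using \<eta>(1) by (auto simp: eventually_at_right[of 0 1, simplified])
    qed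
    then show "\<exists>l. has_pv f x l" by blast
  qed
qed

text \<open>Domination by \<open>f\<close> turns pointwise convergence into L2 convergence. This is
  the limit step in both measure-theoretic inductions that follow.\<close>

lemma pv_exists_dominated:
  assumes f: "f \<in> cL2" and g: "\<And>n. g n \<in> borel_measurable borel" "\<And>n t. \<bar>g n t\<bar> \<le> \<bar>f t\<bar>"
    and lim: "\<And>t. (\<lambda>n. g n t) \<longlonglongrightarrow> f t"
    and pv: "\<And>n. AE x in lborel. \<exists>l. has_pv (g n) x l"
  shows "AE x in lborel. \<exists>l. has_pv f x l"
proof (rule pv_exists_closed[OF f _ pv])
  note [measurable] = g(1) cL2D(1)[OF f]
  show "g n \<in> cL2" for n by (rule cL2_bound[OF f g])
  have "(\<lambda>n. LINT t|lborel. (f t - g n t)\<^sup>2) \<longlonglongrightarrow> (LINT t::real|lborel. 0::real)"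
  proof (rule integral_dominated_convergence[where M = lborel and s = "\<lambda>n t. (f t - g n t)\<^sup>2" and f = "\<lambda>t. 0::real" and w = "\<lambda>t. 4 * (f t)\<^sup>2"])
    show "integrable lborel (\<lambda>t. 4 * (f t)\<^sup>2)" using cL2D(2)[OF f] by simp
    have "(\<lambda>n. (f t - g n t)\<^sup>2) \<longlonglongrightarrow> (f t - f t)\<^sup>2" for t by (intro tendsto_intros lim)
    then show "AE t in lborel. (\<lambda>n. (f t - g n t)\<^sup>2) \<longlonglongrightarrow> 0" by simp
    have "(f t - g n t)\<^sup>2 \<le> (2 * f t)\<^sup>2" for n t
      unfolding abs_le_square_iff[symmetric] using g(2)[of n t] by linarith
    then show "AE t in lborel. norm ((f t - g n t)\<^sup>2) \<le> 4 * (f t)\<^sup>2" for n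
      by (simp add: power_mult_distrib)
  qed auto
  then show "(\<lambda>n. LINT t|lborel. (f t - g n t)\<^sup>2) \<longlonglongrightarrow> 0" by simp
qed

text \<open>By oddness of the kernel the truncations are independent of \<open>e\<close> while the window stays inside the
  set where the function is constant.\<close>

lemma pv_exists_locally_constant:
  assumes f: "f \<in> cL2" and r: "0 < r" and const: "\<And>t. \<bar>t - x\<bar> < r \<Longrightarrow> f t = c"
  shows "\<exists>l. has_pv f x l"
proof -
  have eq: "trunc e f x = trunc r f x" if e: "0 < e" "e < r" for e
  proof -
    define k where "k s = kern e s - kern r s" for s
    have "(LINT s|lborel. k s) = (LINT s|lborel. k (- s))"
      using lborel_integral_real_affine[of "-1" k 0] by simp
    also have "\<dots> = - (LINT s|lborel. k s)"
      by (simp add: k_def kern_odd flip: integral_minus)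
    finally have k0: "(LINT s|lborel. k s) = 0" by simp
    have "trunc e f x - trunc r f x = (LINT t|lborel. kern e (t - x) * f t - kern r (t - x) * f t)"
      unfolding trunc_def using trunc_integrable[OF f e(1)] trunc_integrable[OF f r] by simp
    also have "\<dots> = (LINT t|lborel. c * k (t - x))"
      by (intro Bochner_Integration.integral_cong refl)
        (use const e in \<open>auto simp: k_def kern_def\<close>)
    also have "\<dots> = c * (LINT s|lborel. k s)"
      using lborel_integral_real_affine[of 1 k "- x"] by simp
    finally show ?thesis using k0 by simp
  qed
  have "\<forall>\<^sub>F e in at_right 0. trunc r f x = trunc e f x"
    using r eq by (auto simp: eventually_at_right[of 0 1, simplified])
  then have "has_pv f x (trunc r f x)"
    unfolding has_pv_def by (rule Lim_transform_eventually[OF tendsto_const])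
  then show ?thesis ..
qed

section \<open>Induction from intervals to square integrable functions\<close>

lemma indicator_cL2: "A \<in> sets borel \<Longrightarrow> (\<lambda>t. indicator (A \<inter> {-R..R}) t :: real) \<in> cL2"
proof -
  assume [measurable]: "A \<in> sets borel"
  have "integrable lborel (indicator (A \<inter> {-R..R}) :: real \<Rightarrow> real)"
  proof (rule integrable_real_indicator)
    have "emeasure lborel (A \<inter> {-R..R}) \<le> emeasure lborel {-R..R}" by (rule emeasure_mono) auto
    also have "\<dots> < \<infinity>" by (simp add: emeasure_lborel_Icc_eq)
    finally show "emeasure lborel (A \<inter> {-R..R}) < \<infinity>" .
  qed simp
  moreover have "(indicator (A \<inter> {-R..R}) t :: real)\<^sup>2 = indicator (A \<inter> {-R..R}) t" for t :: real
    by (simp add: indicator_def)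
  moreover have "\<forall>t. R < \<bar>t\<bar> \<longrightarrow> indicator (A \<inter> {-R..R}) t = (0::real)" by (auto simp: indicator_def)
  ultimately show ?thesis by (auto simp: cL2_def)
qed

text \<open>Closed intervals form an intersection-stable generator, and for them only the two end
  points are exceptional. The fixed window \<open>{-R..R}\<close> keeps the support bounded when
  passing to complements, where the indicator is a difference.\<close>

lemma pv_exists_indicator:
  assumes "A \<in> sets borel"
  shows "AE x in lborel. \<exists>l. has_pv (\<lambda>t. indicator (A \<inter> {-R..R}) t) x l"
proof -
  have int: "AE x in lborel. \<exists>l. has_pv (\<lambda>t. indicator (A \<inter> {-R..R}) t) x l" if A: "A = {a..b}" for A a b
  proof -
    define a' b' where "a' = max a (-R)" and "b' = min b R"
    have eq: "A \<inter> {-R..R} = {a'..b'}" by (auto simp: A a'_def b'_def)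
    have c: "(\<lambda>t. indicator (A \<inter> {-R..R}) t :: real) \<in> cL2" by (rule indicator_cL2) (simp add: A)
    have "AE x in lborel. x \<noteq> a' \<and> x \<noteq> b'"
      by (intro AE_conjI AE_lborel_singleton)
    then show ?thesis
    proof eventually_elim
      fix x assume x: "x \<noteq> a' \<and> x \<noteq> b'"
      define r where "r = min \<bar>x - a'\<bar> \<bar>x - b'\<bar>"
      show "\<exists>l. has_pv (\<lambda>t. indicator (A \<inter> {-R..R}) t) x l"
        by (rule pv_exists_locally_constant[OF c, of r _ "indicator {a'..b'} x"])
          (use x in \<open>auto simp: r_def eq indicator_def\<close>)
    qed
  qed
  let ?G = "range (\<lambda>(a, b). {a..b}) :: real set set"
  have "Int_stable ?G"
    unfolding Int_stable_def by (auto simp: Int_atLeastAtMost)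
  moreover have "?G \<subseteq> Pow UNIV" by simp
  moreover have "A \<in> sigma_sets UNIV ?G"
    using assms unfolding borel_eq_atLeastAtMost by simp
  ultimately show ?thesis
  proof (induction rule: sigma_sets_induct_disjoint)
    case (basic A)
    then show ?case using int by auto
  next
    case empty
    show ?case using pv_exists_locally_constant[OF indicator_cL2[of "{}" R], of 1 _ 0] by auto
  next
    case (compl A)
    have A: "A \<in> sets borel" using compl.hyps unfolding borel_eq_atLeastAtMost by simp
    have eq: "(\<lambda>t. indicator ((UNIV - A) \<inter> {-R..R}) t :: real) =
        (\<lambda>t. indicator {-R..R} t - indicator (A \<inter> {-R..R}) t)"
      by (auto simp: indicator_def)
    have R: "(\<lambda>t. indicator {-R..R} t :: real) \<in> cL2" using indicator_cL2[of "{-R..R}" R] by simp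
    have pv: "AE x in lborel. \<exists>l. has_pv (\<lambda>t. indicator {-R..R} t) x l"
      using int[OF refl, of "-R" R] by simp
    show ?case
      using pv compl.IH unfolding eq
      by eventually_elim (elim exE, rule exI, rule has_pv_diff[OF R indicator_cL2[OF A]])
  next
    case (union A)
    have A: "A n \<in> sets borel" for n
      using union.hyps(2) unfolding borel_eq_atLeastAtMost by auto
    \<comment> \<open>Partial unions of the disjoint family have indicators that are finite sums, so
      additivity handles them; the full union is then a dominated limit.\<close>
    define B where "B n = (\<Union>i<n. A i)" for n
    have B: "B n \<in> sets borel" for n unfolding B_def using A by auto
    have UA: "(\<Union>i. A i) \<in> sets borel" using A by auto
    show ?case
    proof (rule pv_exists_dominated[where g = "\<lambda>n t. indicator (B n \<inter> {-R..R}) t", OF indicator_cL2[OF UA]])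
      show "(\<lambda>t. indicator (B n \<inter> {-R..R}) t :: real) \<in> borel_measurable borel" for n
        using B by (intro borel_measurable_indicator) auto
      show "\<bar>indicator (B n \<inter> {-R..R}) t\<bar> \<le> \<bar>indicator ((\<Union>i. A i) \<inter> {-R..R}) t :: real\<bar>" for n t
        by (auto simp: indicator_def B_def)
      show "(\<lambda>n. indicator (B n \<inter> {-R..R}) t :: real) \<longlonglongrightarrow> indicator ((\<Union>i. A i) \<inter> {-R..R}) t" for t
      proof (cases "t \<in> (\<Union>i. A i) \<inter> {-R..R}")
        case True
        then obtain i where i: "t \<in> A i" by auto
        have "\<forall>\<^sub>F n in sequentially. indicator ((\<Union>i. A i) \<inter> {-R..R}) t = (indicator (B n \<inter> {-R..R}) t :: real)"
          using eventually_gt_at_top[of i]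
          by eventually_elim (use True i in \<open>auto simp: B_def indicator_def\<close>)
        then show ?thesis by (rule Lim_transform_eventually[OF tendsto_const])
      next
        case False
        then have "(\<lambda>n. indicator (B n \<inter> {-R..R}) t :: real) = (\<lambda>n. 0)" by (auto simp: B_def indicator_def)
        moreover have "indicator ((\<Union>i. A i) \<inter> {-R..R}) t = (0::real)" using False by (auto simp: indicator_def)
        ultimately show ?thesis by (simp only: tendsto_const)
      qed
      show "AE x in lborel. \<exists>l. has_pv (\<lambda>t. indicator (B n \<inter> {-R..R}) t) x l" for n
      proof (induction n)
        case 0
        show ?case using pv_exists_locally_constant[OF indicator_cL2[of "{}" R], of 1 _ 0] by (auto simp: B_def)
      next
        case (Suc n)
        have "A i \<inter> A n = {}" if "i < n" for i
          using union.hyps(1) that by (auto simp: disjoint_family_on_def)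
        then have eq: "(\<lambda>t. indicator (B (Suc n) \<inter> {-R..R}) t :: real) =
          (\<lambda>t. indicator (B n \<inter> {-R..R}) t + indicator (A n \<inter> {-R..R}) t)"
          by (auto simp: indicator_def B_def lessThan_Suc fun_eq_iff)
        show ?case
          using Suc.IH union.IH[of n] unfolding eq
          by eventually_elim (elim exE, rule exI, rule has_pv_add[OF indicator_cL2[OF B] indicator_cL2[OF A]])
      qed
    qed
  qed
qed

text \<open>In the induction that builds nonnegative Borel functions from indicators, membership in
  \<open>cL2\<close> is assumed only for the function being built. Summands and increasing
  approximants inherit it because they are dominated by that function.\<close>

lemma pv_exists_nonneg:
  fixes u :: "real \<Rightarrow> real"
  assumes u: "u \<in> borel_measurable borel" "\<And>x. 0 \<le> u x" and c: "(\<lambda>t. u t * indicator {-R..R} t) \<in> cL2"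
  shows "AE x in lborel. \<exists>l. has_pv (\<lambda>t. u t * indicator {-R..R} t) x l"
  using u c
proof (induction rule: borel_measurable_induct_real)
  case (set A)
  then show ?case using pv_exists_indicator[of A R] by (simp add: indicator_inter_arith)
next
  case (mult u c)
  show ?case
  \<comment> \<open>The induction hypothesis needs \<open>u\<close> itself in \<open>cL2\<close>,
    which can be recovered from the multiple only for nonzero c.\<close>
  proof (cases "c = 0")
    case True
    then show ?thesis using pv_exists_locally_constant[OF mult.prems, of 1 _ 0] by auto
  next
    case False
    have "(\<lambda>t. u t * indicator {-R..R} t) \<in> cL2"
      using cL2_cmult[OF mult.prems, of "1 / c"] False by simp
    from mult.IH[OF this] show ?thesis
      by eventually_elim (elim exE, simp only: mult.assoc, rule exI, erule has_pv_cmult)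
  qed
next
  case (add u v)
  have u: "(\<lambda>t. u t * indicator {-R..R} t) \<in> cL2"
    by (rule cL2_bound[OF add.prems]) (use add.hyps in \<open>auto simp: indicator_def\<close>)
  have v: "(\<lambda>t. v t * indicator {-R..R} t) \<in> cL2"
    by (rule cL2_bound[OF add.prems]) (use add.hyps in \<open>auto simp: indicator_def\<close>)
  show ?case
    using add.IH(1)[OF u] add.IH(2)[OF v] unfolding distrib_right
    by eventually_elim (elim exE, rule exI, rule has_pv_add[OF v u])
next
  case (seq U)
  have le: "U i t \<le> u t" for i t
    using seq.hyps(3) seq.hyps(4)[of t] by (intro incseq_le[of "\<lambda>i. U i t"]) (auto simp: incseq_def le_fun_def)
  have m: "(\<lambda>t. U i t * indicator {-R..R} t) \<in> borel_measurable borel" for i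
    using seq.hyps(1) by (intro borel_measurable_times borel_measurable_indicator) auto
  have ab: "\<bar>U i t * indicator {-R..R} t\<bar> \<le> \<bar>u t * indicator {-R..R} t\<bar>" for i t
    using le[of i t] seq.hyps(2)[of i t] by (auto simp: indicator_def)
  show ?case
  proof (rule pv_exists_dominated[OF seq.prems m ab])
    show "(\<lambda>n. U n t * indicator {-R..R} t) \<longlonglongrightarrow> u t * indicator {-R..R} t" for t
      using seq.hyps(4)[of t] by (intro tendsto_mult_right) auto
    show "AE x in lborel. \<exists>l. has_pv (\<lambda>t. U n t * indicator {-R..R} t) x l" for n
      by (rule seq.IH[OF cL2_bound[OF seq.prems m ab]])
  qed
qed

theorem pv_exists:
  assumes f: "f \<in> cL2"
  shows "AE x in lborel. \<exists>l. has_pv f x l"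
proof -
  note [measurable] = cL2D(1)[OF f]
  obtain R where R: "\<And>t. R < \<bar>t\<bar> \<Longrightarrow> f t = 0" using f by (auto simp: cL2_def)
  have z: "f t = 0" if "t \<notin> {-R..R}" for t using R[of t] that by auto
  define p where "p t = max 0 (f t) * indicator {-R..R} t" for t
  define q where "q t = max 0 (- f t) * indicator {-R..R} t" for t
  have "p \<in> borel_measurable borel" unfolding p_def by measurable
  then have p: "p \<in> cL2" by (rule cL2_bound[OF f]) (auto simp: p_def indicator_def)
  have "q \<in> borel_measurable borel" unfolding q_def by measurable
  then have q: "q \<in> cL2" by (rule cL2_bound[OF f]) (auto simp: q_def indicator_def)
  have pq: "f = (\<lambda>t. p t - q t)" using z by (auto simp: p_def q_def indicator_def fun_eq_iff)
  have comb: "\<exists>l. has_pv f x l" if "\<exists>l. has_pv p x l" "\<exists>l. has_pv q x l" for x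
    unfolding pq using that by (elim exE) (rule exI, rule has_pv_diff[OF p q])
  have "AE x in lborel. \<exists>l. has_pv p x l"
    unfolding p_def by (rule pv_exists_nonneg) (use p in \<open>auto simp: p_def[abs_def]\<close>)
  moreover have "AE x in lborel. \<exists>l. has_pv q x l"
    unfolding q_def by (rule pv_exists_nonneg) (use q in \<open>auto simp: q_def[abs_def]\<close>)
  ultimately show ?thesis
    by eventually_elim (rule comb)
qed

section \<open>Explicit transforms of the weight\<close>

text \<open>For a < b the maximum extends the square root by zero, which makes it continuous on the
  line and lets integrals over \<open>{a..b}\<close> be taken over all reals.\<close>

definition weight :: "real \<Rightarrow> real \<Rightarrow> real \<Rightarrow> real" where
  "weight a b y = sqrt (max 0 ((y - a) * (b - y)))"

lemma weight_cont: "isCont (weight a b) y"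
  unfolding weight_def by (intro continuous_intros)

lemma weight_continuous_on: "continuous_on S (weight a b)"
  using weight_cont continuous_at_imp_continuous_on by blast

lemma weight_measurable[measurable]: "weight a b \<in> borel_measurable borel"
  unfolding weight_def by measurable

lemma weight_nonneg: "0 \<le> weight a b y"
  by (simp add: weight_def)

lemma weight_outside: "a < b \<Longrightarrow> y \<notin> {a<..<b} \<Longrightarrow> weight a b y = 0"
  by (auto simp: weight_def max_def mult_le_0_iff zero_le_mult_iff not_less)

lemma weight_pos: "y \<in> {a<..<b} \<Longrightarrow> 0 < weight a b y"
  by (auto simp: weight_def max_def not_le intro: mult_pos_pos)

lemma weight_sq:
  assumes "y \<in> {a..b}"
  shows "(weight a b y)\<^sup>2 = ((b - a) / 2)\<^sup>2 - (y - (a + b) / 2)\<^sup>2"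
proof -
  have "0 \<le> (y - a) * (b - y)" using assms by auto
  then show ?thesis by (simp add: weight_def) (simp add: field_simps power2_eq_square)
qed

lemma weight_le:
  assumes "a < b"
  shows "weight a b y \<le> b - a"
proof (cases "y \<in> {a..b}")
  case True
  have "(weight a b y)\<^sup>2 \<le> ((b - a) / 2)\<^sup>2" using weight_sq[OF True] by simp
  then have "weight a b y \<le> (b - a) / 2" by (rule power2_le_imp_le) (use assms in simp)
  then show ?thesis using assms by simp
qed (use weight_outside[OF assms, of y] assms in auto)

lemma cL2_bounded:
  assumes "f \<in> borel_measurable borel" and bd: "\<And>t. \<bar>f t\<bar> \<le> K" and out: "\<And>t. t \<notin> {a..b} \<Longrightarrow> f t = 0"
  shows "f \<in> cL2"
proof -
  define R where "R = max \<bar>a\<bar> \<bar>b\<bar>"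
  have sub: "{a..b} \<subseteq> {-R..R}" unfolding R_def by auto
  have "(\<lambda>t. K * indicator ({-R..R} \<inter> {-R..R}) t) \<in> cL2"
    by (rule cL2_cmult[OF indicator_cL2]) simp
  then show ?thesis
  proof (rule cL2_bound)
    show "\<bar>f t\<bar> \<le> \<bar>K * indicator ({-R..R} \<inter> {-R..R}) t\<bar>" for t
      using bd[of t] out[of t] sub by (cases "t \<in> {a..b}") (auto simp: indicator_def)
  qed fact
qed

lemma weight_cL2: "a < b \<Longrightarrow> weight a b \<in> cL2"
  by (rule cL2_bounded[where K = "b - a" and a = a and b = b])
    (use weight_nonneg[of a b] weight_le[of a b] weight_outside[of a b] in auto)

lemma weight_deriv:
  assumes y: "y \<in> {a<..<b}"
  shows "(weight a b has_real_derivative - (y - (a + b) / 2) / weight a b y) (at y)"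
proof -
  have pos: "0 < (y - a) * (b - y)" using y by auto
  have "((\<lambda>y. sqrt ((y - a) * (b - y))) has_real_derivative - (y - (a + b) / 2) / sqrt ((y - a) * (b - y))) (at y)"
    using pos by (auto intro!: derivative_eq_intros simp: field_simps)
  moreover have "weight a b y = sqrt ((y - a) * (b - y))" if "y \<in> {a<..<b}" for y
    using that by (simp add: weight_def max_def)
  ultimately show ?thesis
    using y by (subst has_field_derivative_cong_eventually[where g = "\<lambda>y. sqrt ((y - a) * (b - y))"])
      (auto simp: eventually_at_topological intro!: exI[of _ "{a<..<b}"])
qed

lemma arcsin_scaled_deriv:
  assumes y: "y \<in> {a<..<b}"
  shows "((\<lambda>y. arcsin ((y - (a + b) / 2) / ((b - a) / 2))) has_real_derivative 1 / weight a b y) (at y)"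
proof -
  define h where "h = (b - a) / 2"
  define Y where "Y = y - (a + b) / 2"
  have h: "0 < h" "\<bar>Y\<bar> < h" using y by (auto simp: h_def Y_def abs_less_iff field_simps)
  have w: "weight a b y = sqrt (h\<^sup>2 - Y\<^sup>2)"
    using weight_sq[of y a b] y weight_nonneg[of a b y] unfolding h_def Y_def
    by (intro real_sqrt_unique[symmetric]) auto
  have q: "-1 < Y / h" "Y / h < 1" using h by (auto simp: field_simps)
  have "1 - (Y / h)\<^sup>2 = (h\<^sup>2 - Y\<^sup>2) / h\<^sup>2" using h by (simp add: field_simps)
  then have s: "sqrt (1 - (Y / h)\<^sup>2) = weight a b y / h"
    using h by (simp add: w real_sqrt_divide)
  have "((\<lambda>y. arcsin ((y - (a + b) / 2) / h)) has_real_derivative inverse (sqrt (1 - (Y / h)\<^sup>2)) * (1 / h)) (at y)"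
  proof (rule DERIV_chain2[where f = arcsin])
    show "(arcsin has_real_derivative inverse (sqrt (1 - (Y / h)\<^sup>2))) (at ((y - (a + b) / 2) / h))"
      using DERIV_arcsin[OF q] by (simp only: Y_def)
    show "((\<lambda>y. (y - (a + b) / 2) / h) has_real_derivative 1 / h) (at y)"
      using h by (auto intro!: derivative_eq_intros)
  qed
  then show ?thesis unfolding s h_def[symmetric] using h by (simp add: field_simps)
qed

text \<open>The restriction to the real line outside the interval of the branch of the square root
  of (z - a)(z - b) that behaves like z at infinity; the sign factor distinguishes the two
  sides.\<close>

definition kappa :: "real \<Rightarrow> real \<Rightarrow> real \<Rightarrow> real" where
  "kappa a b z = sgn (z - (a + b) / 2) * sqrt ((z - a) * (z - b))"

text \<open>An explicit primitive exists. In coordinates centred at the midpoint m, with half length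
  h and Z = z - m, the integrand is the derivative of the weight minus Z times the scaled arcsine,
  plus a third term (Z^2 - h^2) / (w(y)(z - y)) that a second arcsine integrates.\<close>

lemma weight_Cauchy_integral:
  assumes ab: "a < b" and z: "z \<notin> {a..b}"
  shows "(LINT y|lborel. weight a b y / (y - z)) = pi * ((a + b) / 2 - z + kappa a b z)"
proof -
  define m h where "m = (a + b) / 2" and "h = (b - a) / 2"
  define Z where "Z = z - m"
  define k where "k = kappa a b z"
  have h: "0 < h" and Zh: "h < \<bar>Z\<bar>" using ab z by (auto simp: h_def m_def Z_def abs_less_iff field_simps)
  have pos: "0 < (z - a) * (z - b)" using z ab by (auto simp: zero_less_mult_iff)
  have zz: "(z - a) * (z - b) = Z\<^sup>2 - h\<^sup>2" by (simp add: Z_def m_def h_def field_simps power2_eq_square)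
  have k: "k = sgn Z * sqrt (Z\<^sup>2 - h\<^sup>2)" by (simp add: k_def kappa_def zz Z_def m_def)
  \<comment> \<open>The Moebius map taking a to -1 and b to 1 for which the arcsine of
    \<open>q\<close> has derivative k / (w(y)(z - y)); the factor k in \<open>F\<close> completes
    this to Z^2 - h^2.\<close>
  define q where "q y = (Z * (y - m) - h\<^sup>2) / (h * (Z - (y - m)))" for y
  define F where "F y = weight a b y - Z * arcsin ((y - m) / h) + k * arcsin (q y)" for y
  have nz: "Z - (y - m) \<noteq> 0" "y - z \<noteq> 0" if "y \<in> {a..b}" for y using that z by (auto simp: Z_def)
  have Yh: "\<bar>y - m\<bar> \<le> h" if "y \<in> {a..b}" for y using that by (auto simp: m_def h_def abs_le_iff field_simps)
  have q2: "1 - (q y)\<^sup>2 = (Z\<^sup>2 - h\<^sup>2) * (weight a b y)\<^sup>2 / (h * (Z - (y - m)))\<^sup>2" if y: "y \<in> {a..b}" for y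
  proof -
    have "1 - (q y)\<^sup>2 = ((h * (Z - (y - m)))\<^sup>2 - (Z * (y - m) - h\<^sup>2)\<^sup>2) / (h * (Z - (y - m)))\<^sup>2"
    proof -
      have "h * (Z - (y - m)) \<noteq> 0" using nz[OF y] h by simp
      then have "(h * (Z - (y - m)))\<^sup>2 / (h * (Z - (y - m)))\<^sup>2 = 1" by (metis divide_self power_not_zero)
      then show ?thesis unfolding q_def power_divide diff_divide_distrib[of "(h * (Z - (y - m)))\<^sup>2"] by (simp only:)
    qed
    also have "(h * (Z - (y - m)))\<^sup>2 - (Z * (y - m) - h\<^sup>2)\<^sup>2 = (Z\<^sup>2 - h\<^sup>2) * (h\<^sup>2 - (y - m)\<^sup>2)"
      by algebra
    finally show ?thesis using weight_sq[OF y] by (simp add: h_def m_def)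
  qed
  have Z2: "0 < Z\<^sup>2 - h\<^sup>2" using pos zz by simp
  have q1: "-1 \<le> q y \<and> q y \<le> 1" if "y \<in> {a..b}" for y
  proof -
    have "0 \<le> 1 - (q y)\<^sup>2" unfolding q2[OF that] using Z2 by simp
    then have "(q y)\<^sup>2 \<le> 1" by simp
    then show ?thesis by (simp add: abs_square_le_1 abs_le_iff)
  qed
  have cont: "continuous_on {a..b} F"
    unfolding F_def
  proof (intro continuous_intros weight_continuous_on)
    show "continuous_on {a..b} q" unfolding q_def using nz h by (intro continuous_intros) auto
    show "\<forall>y\<in>{a..b}. -1 \<le> q y \<and> q y \<le> 1" using q1 by blast
    show "\<forall>y\<in>{a..b}. -1 \<le> (y - m) / h \<and> (y - m) / h \<le> 1"
      using Yh h by (auto simp: abs_le_iff field_simps)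
  qed (use h in auto)
  have der: "(F has_vector_derivative weight a b y / (y - z)) (at y)" if y: "y \<in> {a<..<b}" for y
  proof -
    have y': "y \<in> {a..b}" using y by auto
    define D where "D = h * (Z - (y - m))"
    have D: "D \<noteq> 0" using nz[OF y'] h by (simp add: D_def)
    define w where "w = weight a b y"
    have w: "0 < w" using weight_pos[OF y] by (simp add: w_def)
    have w2: "w\<^sup>2 = h\<^sup>2 - (y - m)\<^sup>2" using weight_sq[OF y'] by (simp add: w_def h_def m_def)
    have "0 < 1 - (q y)\<^sup>2" unfolding q2[OF y'] w_def[symmetric] D_def[symmetric] using Z2 w D by simp
    then have qq: "-1 < q y" "q y < 1" by (auto simp: abs_square_less_1 abs_less_iff)
    have sq: "sqrt (1 - (q y)\<^sup>2) = sqrt (Z\<^sup>2 - h\<^sup>2) * w / \<bar>D\<bar>"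
      unfolding q2[OF y'] w_def[symmetric] D_def[symmetric] using w by (simp add: real_sqrt_divide real_sqrt_mult)
    have dq: "(q has_real_derivative h * (Z\<^sup>2 - h\<^sup>2) / D\<^sup>2) (at y)"
    proof -
      have "(q has_real_derivative (Z * D - (Z * (y - m) - h\<^sup>2) * (- h)) / (D * D)) (at y)"
        unfolding q_def D_def using D by (auto intro!: derivative_eq_intros simp: D_def)
      moreover have "Z * D - (Z * (y - m) - h\<^sup>2) * (- h) = h * (Z\<^sup>2 - h\<^sup>2)"
        unfolding D_def by algebra
      ultimately show ?thesis by (simp add: power2_eq_square)
    qed
    \<comment> \<open>The square root produces the absolute value of \<open>D\<close>; the sign
      built into \<open>kappa\<close> undoes it, so both positions of z are treated at once.\<close>
    have sg: "sgn Z * \<bar>D\<bar> = D"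
    proof (cases "0 < Z")
      case True
      then have "0 < Z - (y - m)" using Yh[OF y'] Zh by linarith
      then show ?thesis using True h by (simp add: D_def abs_mult)
    next
      case False
      then have "Z < 0" "Z - (y - m) < 0" using Yh[OF y'] Zh h by linarith+
      then have "\<bar>D\<bar> = h * (- (Z - (y - m)))" unfolding D_def abs_mult using h by (simp only: abs_of_neg abs_of_pos)
      then show ?thesis using \<open>Z < 0\<close> unfolding D_def by (simp only: sgn_neg mult_minus_left mult_minus_right mult_1_left minus_minus)
    qed
    have "((\<lambda>y. k * arcsin (q y)) has_real_derivative k * (inverse (sqrt (1 - (q y)\<^sup>2)) * (h * (Z\<^sup>2 - h\<^sup>2) / D\<^sup>2))) (at y)"
      by (intro DERIV_cmult DERIV_chain2[OF DERIV_arcsin[OF qq] dq])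
    moreover have "k * (inverse (sqrt (1 - (q y)\<^sup>2)) * (h * (Z\<^sup>2 - h\<^sup>2) / D\<^sup>2)) = h * (Z\<^sup>2 - h\<^sup>2) / (w * D)"
    proof -
      define s where "s = sqrt (Z\<^sup>2 - h\<^sup>2)"
      have s: "0 < s" using Z2 by (simp add: s_def)
      have "k * (inverse (sqrt (1 - (q y)\<^sup>2)) * (h * (Z\<^sup>2 - h\<^sup>2) / D\<^sup>2)) = (sgn Z * \<bar>D\<bar>) * h * (Z\<^sup>2 - h\<^sup>2) / (w * D\<^sup>2)"
        unfolding sq k s_def[symmetric] using s w D by (simp add: field_simps)
      then show ?thesis unfolding sg using D by (simp add: power2_eq_square)
    qed
    ultimately have dk: "((\<lambda>y. k * arcsin (q y)) has_real_derivative h * (Z\<^sup>2 - h\<^sup>2) / (w * D)) (at y)"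
      by (simp only:)
    have "(F has_real_derivative - (y - m) / w - Z * (1 / w) + h * (Z\<^sup>2 - h\<^sup>2) / (w * D)) (at y)"
      unfolding F_def
      by (intro DERIV_add DERIV_diff DERIV_cmult dk weight_deriv[OF y, folded m_def w_def]
          arcsin_scaled_deriv[OF y, folded m_def h_def w_def])
    moreover have "- (y - m) / w - Z * (1 / w) + h * (Z\<^sup>2 - h\<^sup>2) / (w * D) = w / (y - z)"
    proof -
      have E: "Z - (y - m) = z - y" by (simp add: Z_def)
      have zy: "z - y \<noteq> 0" "y - z \<noteq> 0" using nz[OF y'] by auto
      have "h * (Z\<^sup>2 - h\<^sup>2) / (w * D) = (Z\<^sup>2 - h\<^sup>2) / (w * (z - y))" using h by (simp add: D_def E)
      moreover have "- (y - m) / w - Z * (1 / w) = - ((y - m) + Z) * (z - y) / (w * (z - y))"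
        using zy w by (simp add: field_simps)
      ultimately have "- (y - m) / w - Z * (1 / w) + h * (Z\<^sup>2 - h\<^sup>2) / (w * D)
          = (- ((y - m) + Z) * (z - y) + (Z\<^sup>2 - h\<^sup>2)) / (w * (z - y))"
        by (simp add: add_divide_distrib)
      also have "- ((y - m) + Z) * (z - y) + (Z\<^sup>2 - h\<^sup>2) = - w\<^sup>2"
        unfolding w2 E[symmetric] by algebra
      also have "- w\<^sup>2 / (w * (z - y)) = w / (y - z)"
        using w zy by (simp add: field_simps power2_eq_square)
      finally show ?thesis .
    qed
    ultimately show ?thesis by (simp add: has_real_derivative_iff_has_vector_derivative w_def)
  qed
  \<comment> \<open>The derivatives of the single terms blow up at the end points, so only
    continuity of \<open>F\<close> is used there.\<close>
  have "((\<lambda>y. weight a b y / (y - z)) has_integral (F b - F a)) {a..b}"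
    by (rule fundamental_theorem_of_calculus_interior[OF _ cont der]) (use ab in auto)
  then have HK: "((\<lambda>y. weight a b y / (y - z)) has_integral (F b - F a)) UNIV"
    by (rule has_integral_on_superset) (use weight_outside[OF ab] in auto)
  obtain \<delta> where \<delta>: "0 < \<delta>" "\<And>y. y \<in> {a..b} \<Longrightarrow> \<delta> \<le> \<bar>y - z\<bar>"
    by (rule that[of "if z < a then a - z else z - b"]) (use z in auto)
  have "(\<lambda>y. weight a b y / (y - z)) \<in> cL2"
  proof (rule cL2_bounded)
    show "\<bar>weight a b y / (y - z)\<bar> \<le> (b - a) / \<delta>" for y
    proof (cases "y \<in> {a..b}")
      case True
      then show ?thesis using \<delta>(1) \<delta>(2)[OF True] weight_nonneg[of a b y] weight_le[OF ab, of y]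
        by (auto simp: abs_divide intro!: frac_le)
    qed (use weight_outside[OF ab, of y] ab \<delta> in auto)
    show "weight a b y / (y - z) = 0" if "y \<notin> {a..b}" for y
      using weight_outside[OF ab, of y] that by auto
  qed measurable
  from has_integral_integral_lborel[OF cL2D(3)[OF this]] HK
  have "(LINT y|lborel. weight a b y / (y - z)) = F b - F a"
    by (rule has_integral_unique)
  also have "\<dots> = pi * (- Z + k)"
  proof -
    have e: "b - m = h" "a - m = - h" by (simp_all add: m_def h_def field_simps)
    have "q b = 1" "q a = -1"
    proof -
      have "h * (Z - h) \<noteq> 0" "h * (Z + h) \<noteq> 0" using Zh h by auto
      moreover have "Z * h - h\<^sup>2 = h * (Z - h)" "Z * (- h) - h\<^sup>2 = - (h * (Z + h))"
        by (simp_all add: algebra_simps power2_eq_square)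
      ultimately show "q b = 1" "q a = -1" unfolding q_def e by (simp_all add: divide_minus_left)
    qed
    moreover have "weight a b a = 0" "weight a b b = 0" using weight_outside[OF ab] by auto
    ultimately show ?thesis using h by (simp add: F_def e algebra_simps)
  qed
  finally show ?thesis by (simp add: Z_def m_def k_def)
qed


text \<open>On either side of \<open>x\<close> the integrand has the primitive \<open>F\<close>; the logarithmic singularities of
  \<open>F (x - e)\<close> and \<open>F (x + e)\<close> cancel.\<close>

lemma weight_has_pv:
  assumes x: "x \<in> {a<..<b}"
  shows "has_pv (weight a b) x (pi * ((a + b) / 2 - x))"
proof -
  have ab: "a < b" using x by auto
  define m h where "m = (a + b) / 2" and "h = (b - a) / 2"
  define X where "X = x - m"
  define wx where "wx = weight a b x"
  have h: "0 < h" and Xh: "\<bar>X\<bar> < h" using x by (auto simp: h_def m_def X_def abs_less_iff field_simps)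
  have wx: "0 < wx" using weight_pos[OF x] by (simp add: wx_def)
  have wx2: "wx\<^sup>2 = h\<^sup>2 - X\<^sup>2" using weight_sq[of x a b] x by (simp add: wx_def h_def m_def X_def)
  \<comment> \<open>Chosen so that ln(\<bar>y - x\<bar> / N(y)) has derivative wx / (w(y)(y - x)).
    As \<open>N\<close> is positive on all of \<open>{a..b}\<close>, the part \<open>C\<close> of
    the primitive is continuous there.\<close>
  define N where "N y = h\<^sup>2 - X * (y - m) + wx * weight a b y" for y
  define C where "C y = weight a b y - X * arcsin ((y - m) / h) - wx * ln (N y)" for y
  \<comment> \<open>Half the logarithm of the square is ln \<bar>y - x\<bar> on both sides of x, and
    it takes the same value at x - e and x + e.\<close>
  define F where "F y = C y + wx * (ln ((y - x)\<^sup>2) / 2)" for y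
  have Yh: "\<bar>y - m\<bar> \<le> h" if "y \<in> {a..b}" for y using that by (auto simp: m_def h_def abs_le_iff field_simps)
  have Npos: "0 < N y" if y: "y \<in> {a..b}" for y
  proof -
    have "X * (y - m) \<le> \<bar>X\<bar> * \<bar>y - m\<bar>" unfolding abs_mult[symmetric] by (rule abs_ge_self)
    also have "\<dots> \<le> \<bar>X\<bar> * h" using Yh[OF y] by (intro mult_left_mono) auto
    also have "\<dots> < h * h" using Xh h by (intro mult_strict_right_mono) auto
    finally have "0 < h\<^sup>2 - X * (y - m)" by (simp add: power2_eq_square)
    moreover have "0 \<le> wx * weight a b y" using wx weight_nonneg by simp
    ultimately show ?thesis by (simp add: N_def)
  qed
  have contC: "continuous_on {a..b} C"
    unfolding C_def
  proof (intro continuous_intros weight_continuous_on)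
    show "continuous_on {a..b} N" unfolding N_def by (intro continuous_intros weight_continuous_on)
    show "\<forall>y\<in>{a..b}. N y \<noteq> 0" using Npos by fastforce
    show "\<forall>y\<in>{a..b}. -1 \<le> (y - m) / h \<and> (y - m) / h \<le> 1"
      using Yh h by (auto simp: abs_le_iff field_simps)
  qed (use h in auto)
  have contF: "continuous_on S F" if "S \<subseteq> {a..b}" "x \<notin> S" for S
    unfolding F_def
    by (intro continuous_intros continuous_on_subset[OF contC that(1)]) (use that(2) in auto)
  have der: "(F has_vector_derivative weight a b y / (y - x)) (at y)" if y: "y \<in> {a<..<b}" "y \<noteq> x" for y
  proof -
    have y': "y \<in> {a..b}" using y by auto
    define w where "w = weight a b y"
    have w: "0 < w" using weight_pos[OF y(1)] by (simp add: w_def)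
    have w2: "w\<^sup>2 = h\<^sup>2 - (y - m)\<^sup>2" using weight_sq[OF y'] by (simp add: w_def h_def m_def)
    have Np: "0 < N y" by (rule Npos[OF y'])
    note dw = weight_deriv[OF y(1), folded m_def w_def] arcsin_scaled_deriv[OF y(1), folded m_def h_def w_def]
    have dN: "(N has_real_derivative - X + wx * (- (y - m) / w)) (at y)"
      unfolding N_def by (auto intro!: derivative_eq_intros dw)
    have dln: "((\<lambda>y. ln ((y - x)\<^sup>2) / 2) has_real_derivative 1 / (y - x)) (at y)"
    proof -
      have "((\<lambda>y. ln ((y - x)\<^sup>2)) has_real_derivative 1 / (y - x)\<^sup>2 * (2 * (y - x))) (at y)"
      proof (rule DERIV_chain2[where f = ln])
        show "(ln has_real_derivative 1 / (y - x)\<^sup>2) (at ((y - x)\<^sup>2))"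
          using y(2) by (intro DERIV_ln_divide) simp
        show "((\<lambda>y. (y - x)\<^sup>2) has_real_derivative 2 * (y - x)) (at y)"
          by (auto intro!: derivative_eq_intros)
      qed
      moreover have "1 / u\<^sup>2 * (2 * u) / 2 = 1 / u" if "u \<noteq> 0" for u :: real
        using that by (simp add: power2_eq_square)
      then have "1 / (y - x)\<^sup>2 * (2 * (y - x)) / 2 = 1 / (y - x)" using y(2) by (metis right_minus_eq)
      ultimately show ?thesis by (metis DERIV_cdivide)
    qed
    have "((\<lambda>y. ln (N y)) has_real_derivative (- X + wx * (- (y - m) / w)) / N y) (at y)"
      using dN Np by (auto intro!: derivative_eq_intros)
    note dlnN = this
    have "(F has_real_derivative - (y - m) / w - X * (1 / w)
        - wx * ((- X + wx * (- (y - m) / w)) / N y) + wx * (1 / (y - x))) (at y)"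
      unfolding F_def C_def by (intro DERIV_add DERIV_diff DERIV_cmult dln dw dlnN)
    moreover have "- (y - m) / w - X * (1 / w)
        - wx * ((- X + wx * (- (y - m) / w)) / N y) + wx * (1 / (y - x)) = w / (y - x)"
    proof -
      define Y where "Y = y - m"
      have E: "y - x = Y - X" by (simp add: Y_def X_def)
      have nz: "Y - X \<noteq> 0" "w \<noteq> 0" "N y \<noteq> 0" using y(2) w Np by (auto simp: Y_def X_def)
      have Ny: "N y = h\<^sup>2 - X * Y + wx * w" by (simp add: N_def Y_def w_def)
      have w2': "w * w = h\<^sup>2 - Y\<^sup>2" "wx * wx = h\<^sup>2 - X\<^sup>2"
        using w2 wx2 by (simp_all add: Y_def power2_eq_square)
      have "((- X) * w - wx * Y) * (Y - X) - N y * w = - wx * N y"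
        unfolding Ny using w2' by algebra
      then have key: "(- X + wx * (- Y / w)) / N y - 1 / (Y - X) = - wx / (w * (Y - X))"
        using nz by (simp add: divide_simps) (simp add: algebra_simps)
      have "- Y / w - X * (1 / w) - wx * ((- X + wx * (- Y / w)) / N y) + wx * (1 / (Y - X))
        = - Y / w - X * (1 / w) - wx * ((- X + wx * (- Y / w)) / N y - 1 / (Y - X))"
        by (simp add: algebra_simps)
      also have "\<dots> = - Y / w - X * (1 / w) + wx * wx / (w * (Y - X))"
        unfolding key by simp
      also have "\<dots> = (- (Y + X) * (Y - X) + wx * wx) / (w * (Y - X))"
        using nz by (simp add: divide_simps)
      also have "- (Y + X) * (Y - X) + wx * wx = w * w" unfolding w2' by algebra
      also have "w * w / (w * (Y - X)) = w / (Y - X)" using nz by simp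
      finally show ?thesis unfolding E Y_def .
    qed
    ultimately show ?thesis by (simp add: has_real_derivative_iff_has_vector_derivative w_def)
  qed
  have tr: "trunc e (weight a b) x = F b - F a + (C (x - e) - C (x + e))" if e: "0 < e" "e < x - a" "e < b - x" for e
  proof -
    define g where "g y = kern e (y - x) * weight a b y" for y
    have "((\<lambda>y. weight a b y / (y - x)) has_integral (F (x - e) - F a)) {a..x - e}"
      by (rule fundamental_theorem_of_calculus_interior[OF _ contF der]) (use e in auto)
    then have 1: "(g has_integral (F (x - e) - F a)) {a..x - e}"
      by (rule has_integral_eq[rotated]) (use e in \<open>auto simp: g_def kern_def\<close>)
    have "((\<lambda>y. weight a b y / (y - x)) has_integral (F b - F (x + e))) {x + e..b}"
      by (rule fundamental_theorem_of_calculus_interior[OF _ contF der]) (use e in auto)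
    then have 2: "(g has_integral (F b - F (x + e))) {x + e..b}"
      by (rule has_integral_eq[rotated]) (use e in \<open>auto simp: g_def kern_def\<close>)
    have 3: "(g has_integral 0) {x - e..x + e}"
      by (rule has_integral_spike_finite[where f = "\<lambda>_. 0" and S = "{x - e, x + e}"])
        (auto simp: g_def kern_def abs_if)
    have "(g has_integral (F (x - e) - F a + 0 + (F b - F (x + e)))) {a..b}"
      using has_integral_combine[OF _ _ has_integral_combine[OF _ _ 1 3] 2] e by simp
    then have HK: "(g has_integral (F (x - e) - F a + 0 + (F b - F (x + e)))) UNIV"
      by (rule has_integral_on_superset) (use weight_outside[OF ab] in \<open>auto simp: g_def\<close>)
    have "integrable lborel g"
      unfolding g_def by (rule trunc_integrable[OF weight_cL2[OF ab] e(1)])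
    from has_integral_integral_lborel[OF this] HK
    have "(LINT y|lborel. g y) = F (x - e) - F a + 0 + (F b - F (x + e))"
      by (rule has_integral_unique)
    then show ?thesis by (simp add: trunc_def g_def F_def)
  qed
  have xin: "x \<in> interior {a..b}" using x by simp
  have isC: "isCont C x"
    using contC xin by (rule continuous_on_interior)
  have L: "((\<lambda>e. C (x - e)) \<longlongrightarrow> C x) (at_right 0)" "((\<lambda>e. C (x + e)) \<longlongrightarrow> C x) (at_right 0)"
    by (rule isCont_tendsto_compose[OF isC]; auto intro!: tendsto_eq_intros)+
  have "((\<lambda>e. F b - F a + (C (x - e) - C (x + e))) \<longlongrightarrow> F b - F a + (C x - C x)) (at_right 0)"
    by (intro tendsto_intros L)
  moreover have "\<forall>\<^sub>F e in at_right 0. F b - F a + (C (x - e) - C (x + e)) = trunc e (weight a b) x"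
  proof -
    have "\<forall>\<^sub>F e in at_right (0::real). e < min (x - a) (b - x)"
      using x by (intro eventually_at_right_real[THEN eventually_mono, of 0 "min (x - a) (b - x)"]) auto
    with eventually_at_right_less[of "0::real"] show ?thesis
      by eventually_elim (use tr in auto)
  qed
  ultimately have "has_pv (weight a b) x (F b - F a + (C x - C x))"
    unfolding has_pv_def by (rule Lim_transform_eventually)
  moreover have "F b - F a = pi * (m - x)"
  proof -
    have e: "b - m = h" "a - m = - h" by (simp_all add: m_def h_def field_simps)
    have w0: "weight a b a = 0" "weight a b b = 0" using weight_outside[OF ab] by auto
    have bx: "b - x = h - X" "a - x = - (h + X)" by (auto simp: X_def m_def h_def field_simps)
    have hX: "0 < h - X" "0 < h + X" using Xh by auto
    have "ln ((b - x)\<^sup>2) / 2 = ln (h - X)" "ln ((a - x)\<^sup>2) / 2 = ln (h + X)"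
      unfolding bx power2_minus using hX by (simp_all add: ln_realpow)
    moreover have "ln (N b) = ln h + ln (h - X)" "ln (N a) = ln h + ln (h + X)"
    proof -
      have "N b = h * (h - X)" "N a = h * (h + X)" by (simp_all add: N_def w0 e algebra_simps power2_eq_square)
      then show "ln (N b) = ln h + ln (h - X)" "ln (N a) = ln h + ln (h + X)"
        using hX h by (simp_all add: ln_mult)
    qed
    ultimately have "F b - F a = - X * pi"
      using h by (simp add: F_def C_def w0 e algebra_simps)
    then show ?thesis by (simp add: X_def algebra_simps)
  qed
  ultimately show ?thesis by (simp add: m_def)
qed

section \<open>Weighted Cauchy kernels\<close>

definition cauchy_weight :: "real \<Rightarrow> real \<Rightarrow> real \<Rightarrow> real \<Rightarrow> real" where
  "cauchy_weight a b z y = weight a b y / (y - z)"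

lemma cauchy_weight_measurable[measurable]: "cauchy_weight a b z \<in> borel_measurable borel"
  unfolding cauchy_weight_def by measurable

lemma cauchy_weight_le:
  assumes ab: "a < b" and \<delta>: "0 < \<delta>" and z: "z \<le> a - \<delta> \<or> b + \<delta> \<le> z"
  shows "\<bar>cauchy_weight a b z y\<bar> \<le> (b - a) / \<delta>"
proof (cases "y \<in> {a..b}")
  case True
  then have "\<delta> \<le> \<bar>y - z\<bar>" using z by auto
  then show ?thesis using \<delta> weight_nonneg[of a b y] weight_le[OF ab, of y]
    by (auto simp: cauchy_weight_def abs_divide intro!: frac_le)
qed (use weight_outside[OF ab, of y] ab \<delta> in \<open>auto simp: cauchy_weight_def\<close>)

lemma cauchy_weight_outside: "a < b \<Longrightarrow> y \<notin> {a..b} \<Longrightarrow> cauchy_weight a b z y = 0"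
  using weight_outside[of a b y] by (auto simp: cauchy_weight_def)

lemma cauchy_weight_cL2:
  assumes ab: "a < b" and z: "z \<notin> {a..b}"
  shows "cauchy_weight a b z \<in> cL2"
proof (rule cL2_bounded[OF cauchy_weight_measurable _ cauchy_weight_outside[OF ab]])
  define \<delta> where "\<delta> = (if z < a then a - z else z - b)"
  show "\<bar>cauchy_weight a b z y\<bar> \<le> (b - a) / \<delta>" for y
    using z by (intro cauchy_weight_le[OF ab]) (auto simp: \<delta>_def)
qed

text \<open>Partial fractions of 1 / ((y - x)(y - z)) isolate the truncation of the weight alone
  from an integral without singularity. Since this holds at each fixed e, it yields both the limit
  and bounds that are uniform in z.\<close>

lemma trunc_cauchy_weight:
  assumes ab: "a < b" and x: "x \<in> {a<..<b}" and z: "z \<notin> {a..b}" and e: "0 < e"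
  shows "trunc e (cauchy_weight a b z) x = (trunc e (weight a b) x
      - (LINT y|lborel. indicator {y. e \<le> \<bar>y - x\<bar>} y * cauchy_weight a b z y)) / (x - z)"
proof -
  have xz: "x - z \<noteq> 0" using x z by auto
  have iv: "integrable lborel (cauchy_weight a b z)" using cL2D(3)[OF cauchy_weight_cL2[OF ab z]] .
  have i: "integrable lborel (\<lambda>y. indicator {y. e \<le> \<bar>y - x\<bar>} y * cauchy_weight a b z y)"
    using integrable_mult_indicator[OF _ iv, of "{y. e \<le> \<bar>y - x\<bar>}"] by simp
  have eq: "kern e (y - x) * cauchy_weight a b z y * (x - z) = kern e (y - x) * weight a b y -
      indicator {y. e \<le> \<bar>y - x\<bar>} y * cauchy_weight a b z y" for y
  proof (cases "e \<le> \<bar>y - x\<bar> \<and> y \<in> {a..b}")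
    case True
    then have "y - x \<noteq> 0" "y - z \<noteq> 0" using e z by auto
    then show ?thesis using True by (simp add: kern_def cauchy_weight_def field_simps)
  next
    case False
    then show ?thesis using weight_outside[OF ab, of y] by (auto simp: kern_def cauchy_weight_def)
  qed
  have "trunc e (cauchy_weight a b z) x * (x - z) =
      (LINT y|lborel. kern e (y - x) * cauchy_weight a b z y * (x - z))"
    unfolding trunc_def by simp
  also have "\<dots> = trunc e (weight a b) x - (LINT y|lborel. indicator {y. e \<le> \<bar>y - x\<bar>} y * cauchy_weight a b z y)"
    unfolding eq trunc_def using trunc_integrable[OF weight_cL2[OF ab] e] i by simp
  finally show ?thesis using xz by (simp add: field_simps)
qed

lemma cauchy_weight_integral:
  assumes "a < b" "z \<notin> {a..b}"
  shows "(LINT y|lborel. cauchy_weight a b z y) = pi * ((a + b) / 2 - z + kappa a b z)"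
  using weight_Cauchy_integral[OF assms] by (simp add: cauchy_weight_def)

text \<open>The limits of the two terms in the partial fraction formula are the explicit transforms
  of the weight inside and outside the interval; in their difference the midpoint (a + b) / 2
  cancels.\<close>

lemma cauchy_weight_has_pv:
  assumes ab: "a < b" and x: "x \<in> {a<..<b}" and z: "z \<notin> {a..b}"
  shows "has_pv (cauchy_weight a b z) x (pi * (kappa a b z / (z - x) - 1))"
proof -
  have xz: "x - z \<noteq> 0" using x z by auto
  have iv: "integrable lborel (cauchy_weight a b z)" using cL2D(3)[OF cauchy_weight_cL2[OF ab z]] .
  have "((\<lambda>e. LINT y|lborel. indicator {y. e \<le> \<bar>y - x\<bar>} y * cauchy_weight a b z y)
      \<longlongrightarrow> (LINT y|lborel. cauchy_weight a b z y)) (at_right 0)"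
  proof (rule tendsto_at_right_sequentially[of 0 1])
    fix S :: "nat \<Rightarrow> real" assume S: "\<And>n. 0 < S n" "\<And>n. S n < 1" "decseq S" "S \<longlonglongrightarrow> 0"
    show "(\<lambda>n. LINT y|lborel. indicator {y. S n \<le> \<bar>y - x\<bar>} y * cauchy_weight a b z y)
        \<longlonglongrightarrow> (LINT y|lborel. cauchy_weight a b z y)"
    proof (rule integral_dominated_convergence[where w = "\<lambda>y. \<bar>cauchy_weight a b z y\<bar>"])
      show "AE y in lborel. (\<lambda>n. indicator {y. S n \<le> \<bar>y - x\<bar>} y * cauchy_weight a b z y) \<longlonglongrightarrow> cauchy_weight a b z y"
        using AE_lborel_singleton[of x]
      proof eventually_elim
        fix y assume "y \<noteq> x"
        then have "\<forall>\<^sub>F n in sequentially. S n < \<bar>y - x\<bar>" by (intro order_tendstoD(2)[OF S(4)]) simp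
        then have "\<forall>\<^sub>F n in sequentially. cauchy_weight a b z y = indicator {y. S n \<le> \<bar>y - x\<bar>} y * cauchy_weight a b z y"
          by eventually_elim simp
        then show "(\<lambda>n. indicator {y. S n \<le> \<bar>y - x\<bar>} y * cauchy_weight a b z y) \<longlonglongrightarrow> cauchy_weight a b z y"
          by (rule Lim_transform_eventually[OF tendsto_const])
      qed
      show "AE y in lborel. norm (indicator {y. S n \<le> \<bar>y - x\<bar>} y * cauchy_weight a b z y) \<le> \<bar>cauchy_weight a b z y\<bar>" for n
        by (simp add: indicator_def)
    qed (use iv in auto)
  qed simp
  then have "((\<lambda>e. (trunc e (weight a b) x
      - (LINT y|lborel. indicator {y. e \<le> \<bar>y - x\<bar>} y * cauchy_weight a b z y)) / (x - z)) \<longlongrightarrow>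
      (pi * ((a + b) / 2 - x) - (LINT y|lborel. cauchy_weight a b z y)) / (x - z)) (at_right 0)"
    using weight_has_pv[OF x] xz unfolding has_pv_def by (intro tendsto_intros) auto
  moreover have "\<forall>\<^sub>F e in at_right 0. (trunc e (weight a b) x
      - (LINT y|lborel. indicator {y. e \<le> \<bar>y - x\<bar>} y * cauchy_weight a b z y)) / (x - z) = trunc e (cauchy_weight a b z) x"
    using eventually_at_right_less[of "0::real"] by eventually_elim (simp add: trunc_cauchy_weight[OF ab x z])
  ultimately have "has_pv (cauchy_weight a b z) x ((pi * ((a + b) / 2 - x) - (LINT y|lborel. cauchy_weight a b z y)) / (x - z))"
    unfolding has_pv_def by (rule Lim_transform_eventually)
  moreover have "(pi * ((a + b) / 2 - x) - (LINT y|lborel. cauchy_weight a b z y)) / (x - z) = pi * (kappa a b z / (z - x) - 1)"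
    unfolding cauchy_weight_integral[OF ab z] using xz by (simp add: divide_simps) (simp add: algebra_simps)
  ultimately show ?thesis by simp
qed

section \<open>The range and its constants\<close>

lemma kappa_measurable[measurable]: "kappa a b \<in> borel_measurable borel"
  unfolding kappa_def sgn_real_def by measurable

lemma kappa_sq:
  assumes "a < b" "z \<notin> {a..b}"
  shows "(kappa a b z)\<^sup>2 = (z - a) * (z - b)" "0 < (z - a) * (z - b)"
proof -
  show pos: "0 < (z - a) * (z - b)" using assms by (auto simp: zero_less_mult_iff)
  have "z - (a + b) / 2 \<noteq> 0" using assms by auto
  then have "(sgn (z - (a + b) / 2))\<^sup>2 = 1" by (auto simp: sgn_if)
  then show "(kappa a b z)\<^sup>2 = (z - a) * (z - b)"
    using pos by (simp add: kappa_def power_mult_distrib)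
qed

lemma abs_kappa_ge:
  assumes ab: "a < b" and \<delta>: "0 < \<delta>" and z: "z \<le> a - \<delta> \<or> b + \<delta> \<le> z"
  shows "\<delta> \<le> \<bar>kappa a b z\<bar>"
proof (rule power2_le_imp_le)
  have "\<delta> * \<delta> \<le> \<bar>z - a\<bar> * \<bar>z - b\<bar>" using z ab \<delta> by (intro mult_mono) auto
  moreover have "z \<notin> {a..b}" using z ab \<delta> by auto
  ultimately show "\<delta>\<^sup>2 \<le> \<bar>kappa a b z\<bar>\<^sup>2"
    using kappa_sq[OF ab, of z] unfolding power2_abs by (simp add: power2_eq_square abs_mult[symmetric])
qed simp

text \<open>Superpose the functions \<open>cauchy_weight a b s\<close> with density K = f / (pi
  kappa). The principal value of each layer contributes f(s) / (s - x) - f(s) / kappa(s), so the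
  constant is the integral of f / kappa. The distance \<delta> keeps \<open>kappa\<close> away from
  zero and the layers bounded.\<close>

lemma Cauchy_integral_in_range:
  fixes f :: "real \<Rightarrow> real"
  assumes ab: "a < b" and \<delta>: "0 < \<delta>" and f: "integrable lborel f"
    and f0: "\<And>t. a - \<delta> < t \<Longrightarrow> t < b + \<delta> \<Longrightarrow> f t = 0"
  shows "\<exists>u\<in>cL2. (\<forall>t. t \<notin> {a..b} \<longrightarrow> u t = 0) \<and>
    (\<exists>c. \<forall>x\<in>{a<..<b}. has_pv u x ((LINT t|lborel. f t / (t - x)) - c))"
proof -
  have [measurable]: "f \<in> borel_measurable borel" using f by auto
  define K where "K s = f s / (pi * kappa a b s)" for s
  have [measurable]: "K \<in> borel_measurable borel" unfolding K_def by measurable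
  have away: "s \<le> a - \<delta> \<or> b + \<delta> \<le> s" "s \<notin> {a..b}" "\<delta> \<le> \<bar>kappa a b s\<bar>" if "f s \<noteq> 0" for s
  proof -
    show *: "s \<le> a - \<delta> \<or> b + \<delta> \<le> s" using f0[of s] that by force
    then show "s \<notin> {a..b}" using \<delta> by auto
    show "\<delta> \<le> \<bar>kappa a b s\<bar>" by (rule abs_kappa_ge[OF ab \<delta> *])
  qed
  have Kle: "\<bar>K s\<bar> \<le> 1 / (pi * \<delta>) * \<bar>f s\<bar>" for s
  proof (cases "f s = 0")
    case False
    then have "\<bar>f s\<bar> / (pi * \<bar>kappa a b s\<bar>) \<le> \<bar>f s\<bar> / (pi * \<delta>)"
      using away(3)[OF False] \<delta> by (intro divide_left_mono mult_left_mono mult_pos_pos) auto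
    then show ?thesis by (simp add: K_def abs_mult)
  qed (simp add: K_def)
  have K: "integrable lborel K"
    by (rule Bochner_Integration.integrable_bound[of _ "\<lambda>s. 1 / (pi * \<delta>) * f s"])
      (use f Kle \<delta> in \<open>auto simp: abs_mult\<close>)
  have Kcw: "\<bar>K s * cauchy_weight a b s y\<bar> \<le> \<bar>K s\<bar> * ((b - a) / \<delta>)" for s y
  proof (cases "f s = 0")
    case False
    show ?thesis unfolding abs_mult
      by (intro mult_left_mono cauchy_weight_le[OF ab \<delta> away(1)[OF False]]) auto
  qed (simp add: K_def)
  have Kcw_int: "integrable lborel (\<lambda>s. K s * cauchy_weight a b s y)" for y
    by (rule Bochner_Integration.integrable_bound[of _ "\<lambda>s. (b - a) / \<delta> * K s"])
      (use K Kcw[of _ y] ab \<delta> in \<open>auto simp: cauchy_weight_def abs_mult mult.commute\<close>)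
  define u where "u y = (LINT s|lborel. K s * cauchy_weight a b s y)" for y
  have [measurable]: "u \<in> borel_measurable borel"
    unfolding u_def cauchy_weight_def by measurable
  have u_out: "u t = 0" if "t \<notin> {a..b}" for t
    unfolding u_def using cauchy_weight_outside[OF ab that] by simp
  have u: "u \<in> cL2"
  proof (rule cL2_bounded[OF _ _ u_out])
    show "\<bar>u y\<bar> \<le> (LINT s|lborel. \<bar>K s\<bar> * ((b - a) / \<delta>))" for y
      unfolding u_def
      by (rule order.trans[OF integral_abs_bound], rule integral_mono)
        (use Kcw_int K Kcw in auto)
  qed measurable
  define c where "c = (LINT s|lborel. f s / kappa a b s)"
  have fk: "integrable lborel (\<lambda>s. f s / kappa a b s)"
  proof -
    have "f s / kappa a b s = pi * K s" for s by (simp add: K_def)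
    then show ?thesis using K by simp
  qed
  have "has_pv u x ((LINT t|lborel. f t / (t - x)) - c)" if x: "x \<in> {a<..<b}" for x
  proof -
    \<comment> \<open>At a fixed truncation level the kernel is bounded by 1 / e, so the
      integrations in s and y may be exchanged.\<close>
    have tr: "trunc e u x = (LINT s|lborel. K s * trunc e (cauchy_weight a b s) x)" if e: "0 < e" for e
    proof -
      define g where "g s y = kern e (y - x) * (K s * cauchy_weight a b s y)" for s y
      have gm: "(\<lambda>(s, y). g s y) \<in> borel_measurable (lborel \<Otimes>\<^sub>M lborel)"
        unfolding g_def cauchy_weight_def by measurable
      have "integrable (lborel \<Otimes>\<^sub>M lborel) (\<lambda>(s, y). g s y)"
      proof (rule Bochner_Integration.integrable_bound[OF integrable_tensor[OF K] gm])
        show "integrable lborel (\<lambda>y. 1 / e * ((b - a) / \<delta>) * indicator {a..b} y)"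
          using ab by (intro integrable_mult_right integrable_real_indicator) (auto simp: emeasure_lborel_Icc_eq)
        have "\<bar>g s y\<bar> \<le> \<bar>K s * (1 / e * ((b - a) / \<delta>) * indicator {a..b} y)\<bar>" for s y
        proof (cases "y \<in> {a..b}")
          case True
          have "\<bar>g s y\<bar> \<le> 1 / e * (\<bar>K s\<bar> * ((b - a) / \<delta>))"
            unfolding g_def abs_mult[of "kern e (y - x)"] by (intro mult_mono kern_bound Kcw) (use e in auto)
          also have "\<dots> = \<bar>K s * (1 / e * ((b - a) / \<delta>) * indicator {a..b} y)\<bar>"
            using True e \<delta> ab by (simp add: abs_mult)
          finally show ?thesis .
        qed (simp add: g_def cauchy_weight_outside[OF ab])
        then show "AE p in lborel \<Otimes>\<^sub>M lborel. norm (case p of (s, y) \<Rightarrow> g s y)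
            \<le> norm (case p of (s, y) \<Rightarrow> K s * (1 / e * ((b - a) / \<delta>) * indicator {a..b} y))"
          by (intro AE_I2) (auto split: prod.split)
      qed
      from lborel_pair.Fubini_integral[OF this]
      have "(LINT y|lborel. LINT s|lborel. g s y) = (LINT s|lborel. LINT y|lborel. g s y)" .
      moreover have "(LINT s|lborel. g s y) = kern e (y - x) * u y" for y
        by (simp add: g_def u_def)
      moreover have "(LINT y|lborel. g s y) = K s * trunc e (cauchy_weight a b s) x" for s
        unfolding g_def trunc_def by (subst mult.left_commute) simp
      ultimately show ?thesis by (simp add: trunc_def)
    qed
    have "((\<lambda>e. trunc e u x) \<longlongrightarrow> (LINT s|lborel. K s * (pi * (kappa a b s / (s - x) - 1)))) (at_right 0)"
    proof (rule tendsto_at_right_sequentially[of 0 1])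
      fix S :: "nat \<Rightarrow> real" assume S: "\<And>n. 0 < S n" "\<And>n. S n < 1" "decseq S" "S \<longlonglongrightarrow> 0"
      have S0: "filterlim S (at_right 0) sequentially"
        using S(4) S(1)[THEN less_imp_neq, THEN not_sym] S(1) by (auto simp: filterlim_at intro!: always_eventually)
      have "(\<lambda>n. trunc (S n) (weight a b) x) \<longlonglongrightarrow> pi * ((a + b) / 2 - x)"
        using weight_has_pv[OF x] S0 unfolding has_pv_def by (rule filterlim_compose)
      \<comment> \<open>Convergence at the single point x bounds these truncations along the
        sequence. By the partial fraction formula the bound becomes uniform over all s with f(s)
        nonzero, which gives the majorant for the limit under the integral.\<close>
      then have "Bseq (\<lambda>n. trunc (S n) (weight a b) x)" by (rule convergent_imp_Bseq[OF convergentI])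
      then obtain T where T: "\<And>n. \<bar>trunc (S n) (weight a b) x\<bar> \<le> T" by (auto simp: Bseq_def)
      define B where "B = (T + (b - a) / \<delta> * (b - a)) / \<delta>"
      have cwB: "\<bar>trunc (S n) (cauchy_weight a b s) x\<bar> \<le> B" if s: "f s \<noteq> 0" for s n
      proof -
        note cw = cauchy_weight_le[OF ab \<delta> away(1)[OF s]]
        have iv: "integrable lborel (cauchy_weight a b s)"
          using cL2D(3)[OF cauchy_weight_cL2[OF ab away(2)[OF s]]] .
        have i: "integrable lborel (\<lambda>y. indicator {y. S n \<le> \<bar>y - x\<bar>} y * cauchy_weight a b s y)"
          using integrable_mult_indicator[OF _ iv, of "{y. S n \<le> \<bar>y - x\<bar>}"] by simp
        have "\<bar>LINT y|lborel. indicator {y. S n \<le> \<bar>y - x\<bar>} y * cauchy_weight a b s y\<bar>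
            \<le> (LINT y|lborel. \<bar>indicator {y. S n \<le> \<bar>y - x\<bar>} y * cauchy_weight a b s y\<bar>)"
          by (rule integral_abs_bound)
        also have "\<dots> \<le> (LINT y|lborel. (b - a) / \<delta> * indicator {a..b} y)"
        proof (rule integral_mono)
          show "integrable lborel (\<lambda>y. \<bar>indicator {y. S n \<le> \<bar>y - x\<bar>} y * cauchy_weight a b s y\<bar>)"
            using i by simp
          show "integrable lborel (\<lambda>y. (b - a) / \<delta> * indicator {a..b} y)"
            using ab by (intro integrable_mult_right integrable_real_indicator) (auto simp: emeasure_lborel_Icc_eq)
          show "\<bar>indicator {y. S n \<le> \<bar>y - x\<bar>} y * cauchy_weight a b s y\<bar> \<le> (b - a) / \<delta> * indicator {a..b} y" for y
            using cw[of y] cauchy_weight_outside[OF ab, of y s] ab \<delta> by (auto simp: indicator_def)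
        qed
        also have "\<dots> = (b - a) / \<delta> * (b - a)" using ab by simp
        finally have I: "\<bar>LINT y|lborel. indicator {y. S n \<le> \<bar>y - x\<bar>} y * cauchy_weight a b s y\<bar> \<le> (b - a) / \<delta> * (b - a)" .
        have "\<delta> \<le> \<bar>x - s\<bar>" using away(1)[OF s] x by auto
        moreover have "\<bar>trunc (S n) (weight a b) x - (LINT y|lborel. indicator {y. S n \<le> \<bar>y - x\<bar>} y * cauchy_weight a b s y)\<bar>
            \<le> T + (b - a) / \<delta> * (b - a)"
          by (rule order.trans[OF abs_triangle_ineq4 add_mono[OF T I]])
        ultimately show ?thesis
          unfolding trunc_cauchy_weight[OF ab x away(2)[OF s] S(1)] B_def abs_divide
          using \<delta> by (intro frac_le) auto
      qed
      have "(\<lambda>n. LINT s|lborel. K s * trunc (S n) (cauchy_weight a b s) x) \<longlonglongrightarrow>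
        (LINT s|lborel. K s * (pi * (kappa a b s / (s - x) - 1)))"
      proof (rule integral_dominated_convergence[where w = "\<lambda>s. B * \<bar>K s\<bar>"])
        show "(\<lambda>s. K s * trunc (S n) (cauchy_weight a b s) x) \<in> borel_measurable lborel" for n
          unfolding trunc_def cauchy_weight_def by measurable
        show "AE s in lborel. (\<lambda>n. K s * trunc (S n) (cauchy_weight a b s) x) \<longlonglongrightarrow> K s * (pi * (kappa a b s / (s - x) - 1))"
        proof (intro AE_I2)
          fix s
          show "(\<lambda>n. K s * trunc (S n) (cauchy_weight a b s) x) \<longlonglongrightarrow> K s * (pi * (kappa a b s / (s - x) - 1))"
          proof (cases "f s = 0")
            case False
            have "(\<lambda>n. trunc (S n) (cauchy_weight a b s) x) \<longlonglongrightarrow> pi * (kappa a b s / (s - x) - 1)"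
              using cauchy_weight_has_pv[OF ab x away(2)[OF False]] S0 unfolding has_pv_def by (rule filterlim_compose)
            then show ?thesis by (rule tendsto_mult_left)
          qed (simp add: K_def)
        qed
        show "AE s in lborel. norm (K s * trunc (S n) (cauchy_weight a b s) x) \<le> B * \<bar>K s\<bar>" for n
        proof (intro AE_I2)
          fix s
          show "norm (K s * trunc (S n) (cauchy_weight a b s) x) \<le> B * \<bar>K s\<bar>"
          proof (cases "f s = 0")
            case False
            have "\<bar>K s\<bar> * \<bar>trunc (S n) (cauchy_weight a b s) x\<bar> \<le> \<bar>K s\<bar> * B"
              by (intro mult_left_mono cwB[OF False]) auto
            then show ?thesis by (simp add: abs_mult mult.commute)
          qed (simp add: K_def)
        qed
      qed (use K in auto)
      then show "(\<lambda>n. trunc (S n) u x) \<longlonglongrightarrow> (LINT s|lborel. K s * (pi * (kappa a b s / (s - x) - 1)))"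
        using tr S(1) by simp
    qed simp
    moreover have "(LINT s|lborel. K s * (pi * (kappa a b s / (s - x) - 1))) = (LINT t|lborel. f t / (t - x)) - c"
    proof -
      have "K s * (pi * (kappa a b s / (s - x) - 1)) = f s / (s - x) - f s / kappa a b s" for s
      proof (cases "f s = 0")
        case False
        have "kappa a b s \<noteq> 0" using away(3)[OF False] \<delta> by auto
        then show ?thesis by (simp add: K_def right_diff_distrib diff_divide_distrib)
      qed (simp add: K_def)
      moreover have "integrable lborel (\<lambda>s. f s / (s - x))"
      proof (rule Bochner_Integration.integrable_bound[of _ "\<lambda>s. 1 / \<delta> * f s"])
        show "AE s in lborel. norm (f s / (s - x)) \<le> norm (1 / \<delta> * f s)"
        proof (intro AE_I2)
          fix s
          show "norm (f s / (s - x)) \<le> norm (1 / \<delta> * f s)"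
          proof (cases "f s = 0")
            case False
            then have "\<delta> \<le> \<bar>s - x\<bar>" using away(1)[OF False] x by auto
            then show ?thesis using \<delta> by (auto simp: abs_mult intro!: frac_le)
          qed simp
        qed
      qed (use f in auto)
      ultimately show ?thesis using fk by (simp add: c_def)
    qed
    ultimately show ?thesis by (simp add: has_pv_def)
  qed
  then show ?thesis using u u_out by blast
qed

section \<open>Duality and uniqueness of the constant\<close>

text \<open>By Young's inequality \<bar>d g\<bar> \<le> \<eta> d^2 + g^2 / (4 \<eta>). The excess of
  \<bar>d g\<bar> over \<eta> d^2 is thus dominated by a fixed integrable function and tends to
  zero, while \<eta> d^2 contributes at most \<eta> K.\<close>

lemma weak_convergence_L2:
  fixes d :: "nat \<Rightarrow> real \<Rightarrow> real"
  assumes d: "\<And>n. d n \<in> borel_measurable borel" "\<And>n. integrable lborel (\<lambda>x. (d n x)\<^sup>2)"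
    "\<And>n. (LINT x|lborel. (d n x)\<^sup>2) \<le> K"
    and lim: "AE x in lborel. (\<lambda>n. d n x) \<longlonglongrightarrow> 0"
    and g: "g \<in> borel_measurable borel" "integrable lborel (\<lambda>x. (g x)\<^sup>2)"
  shows "(\<lambda>n. LINT x|lborel. d n x * g x) \<longlonglongrightarrow> 0"
proof (rule LIMSEQ_I)
  fix r :: real assume r: "0 < r"
  note [measurable] = d(1) g(1)
  have K: "0 \<le> K" using d(3)[of 0] by (rule order.trans[rotated]) simp
  \<comment> \<open>The summand 1 in the denominator also covers K = 0; only \<eta> K < r is
    required.\<close>
  define \<eta> where "\<eta> = r / (2 * (K + 1))"
  have \<eta>: "0 < \<eta>" "\<eta> * K < r"
    using r K mult_nonneg_nonneg[of K r] by (auto simp: \<eta>_def field_simps add_nonneg_pos)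
  define e where "e n x = max 0 (\<bar>d n x * g x\<bar> - \<eta> * (d n x)\<^sup>2)" for n x
  have [measurable]: "e n \<in> borel_measurable borel" for n unfolding e_def by measurable
  have eb: "\<bar>e n x\<bar> \<le> 1 / (4 * \<eta>) * (g x)\<^sup>2" for n x
  proof -
    have "0 \<le> (2 * \<eta> * \<bar>d n x\<bar> - \<bar>g x\<bar>)\<^sup>2" by simp
    also have "\<dots> = 4 * \<eta> * (\<eta> * (d n x)\<^sup>2 - \<bar>d n x * g x\<bar>) + (g x)\<^sup>2"
      by (simp add: power2_diff abs_mult power_mult_distrib algebra_simps power2_eq_square)
    finally have "4 * \<eta> * (\<bar>d n x * g x\<bar> - \<eta> * (d n x)\<^sup>2) \<le> (g x)\<^sup>2" by (simp add: algebra_simps)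
    then have "\<bar>d n x * g x\<bar> - \<eta> * (d n x)\<^sup>2 \<le> 1 / (4 * \<eta>) * (g x)\<^sup>2"
      using \<eta>(1) by (simp add: field_simps)
    moreover have "0 \<le> 1 / (4 * \<eta>) * (g x)\<^sup>2" using \<eta>(1) by simp
    ultimately show ?thesis by (simp add: e_def)
  qed
  have ei: "integrable lborel (e n)" for n
    by (rule Bochner_Integration.integrable_bound[of _ "\<lambda>x. 1 / (4 * \<eta>) * (g x)\<^sup>2"])
      (use g eb[of n] \<eta>(1) in auto)
  have "(\<lambda>n. LINT x|lborel. e n x) \<longlonglongrightarrow> (LINT x::real|lborel. 0::real)"
  proof (rule integral_dominated_convergence[where w = "\<lambda>x. 1 / (4 * \<eta>) * (g x)\<^sup>2"])
    show "AE x in lborel. (\<lambda>n. e n x) \<longlonglongrightarrow> 0"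
      using lim
    proof eventually_elim
      fix x assume l: "(\<lambda>n. d n x) \<longlonglongrightarrow> 0"
      have "(\<lambda>n. e n x) \<longlonglongrightarrow> max 0 (\<bar>0 * g x\<bar> - \<eta> * 0\<^sup>2)"
        unfolding e_def by (intro tendsto_intros l)
      then show "(\<lambda>n. e n x) \<longlonglongrightarrow> 0" by simp
    qed
  qed (use g eb in auto)
  then have "(\<lambda>n. LINT x|lborel. e n x) \<longlonglongrightarrow> 0" by simp
  then have "\<forall>\<^sub>F n in sequentially. (LINT x|lborel. e n x) < r - \<eta> * K"
    by (rule order_tendstoD) (use \<eta> in simp)
  then obtain N where N: "\<And>n. N \<le> n \<Longrightarrow> (LINT x|lborel. e n x) < r - \<eta> * K"
    by (auto simp: eventually_sequentially)
  have "\<bar>LINT x|lborel. d n x * g x\<bar> < r" if n: "N \<le> n" for n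
  proof -
    have pt: "\<bar>d n x * g x\<bar> \<le> e n x + \<eta> * (d n x)\<^sup>2" for x by (simp add: e_def)
    have i2: "integrable lborel (\<lambda>x. e n x + \<eta> * (d n x)\<^sup>2)" using ei d(2) by simp
    have "integrable lborel (\<lambda>x. d n x * g x)"
      by (rule Bochner_Integration.integrable_bound[OF i2]) (auto intro!: order.trans[OF pt abs_ge_self])
    then have "(LINT x|lborel. \<bar>d n x * g x\<bar>) \<le> (LINT x|lborel. e n x + \<eta> * (d n x)\<^sup>2)"
      by (intro integral_mono i2 pt integrable_abs)
    also have "\<dots> = (LINT x|lborel. e n x) + \<eta> * (LINT x|lborel. (d n x)\<^sup>2)" using ei d(2) by simp
    also have "\<dots> \<le> (LINT x|lborel. e n x) + \<eta> * K"
      using d(3) \<eta>(1) by (intro add_left_mono mult_left_mono) auto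
    also have "\<dots> < r" using N[OF n] by simp
    finally show ?thesis using integral_abs_bound[of lborel "\<lambda>x. d n x * g x"] by linarith
  qed
  then show "\<exists>N. \<forall>n\<ge>N. norm ((LINT x|lborel. d n x * g x) - 0) < r" by auto
qed

text \<open>The kernel is odd, and truncation makes the double integral absolutely convergent, so
  Fubini applies. The duality of principal values is the limit of this relation.\<close>

lemma trunc_antisym:
  assumes f: "f \<in> cL2" and g: "g \<in> cL2" and e: "0 < e"
  shows "(LINT x|lborel. g x * trunc e f x) = - (LINT x|lborel. f x * trunc e g x)"
proof -
  note [measurable] = cL2D(1)[OF f] cL2D(1)[OF g]
  define h where "h x t = g x * (kern e (t - x) * f t)" for x t
  have "integrable (lborel \<Otimes>\<^sub>M lborel) (\<lambda>(x, t). h x t)"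
  proof (rule Bochner_Integration.integrable_bound[OF integrable_tensor[OF cL2D(3)[OF g] integrable_mult_right[OF cL2D(3)[OF f]]]])
    show "(\<lambda>(x, t). h x t) \<in> borel_measurable (lborel \<Otimes>\<^sub>M lborel)" unfolding h_def by measurable
    have "\<bar>h x t\<bar> \<le> \<bar>g x * (1 / e * f t)\<bar>" for x t
    proof -
      have "\<bar>kern e (t - x)\<bar> * \<bar>f t\<bar> \<le> 1 / e * \<bar>f t\<bar>" by (intro mult_right_mono kern_bound e) simp
      then show ?thesis unfolding h_def abs_mult using e by (intro mult_left_mono) auto
    qed
    then show "AE p in lborel \<Otimes>\<^sub>M lborel. norm (case p of (x, t) \<Rightarrow> h x t) \<le> norm (case p of (x, t) \<Rightarrow> g x * (1 / e * f t))"
      by (intro AE_I2) (auto split: prod.split)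
  qed
  from lborel_pair.Fubini_integral[OF this]
  have "(LINT x|lborel. LINT t|lborel. h x t) = (LINT t|lborel. LINT x|lborel. h x t)" by simp
  moreover have "(LINT t|lborel. h x t) = g x * trunc e f x" for x
    by (simp add: h_def trunc_def)
  moreover have "(LINT x|lborel. h x t) = - (f t * trunc e g t)" for t
  proof -
    have "h x t = - (f t * (kern e (x - t) * g x))" for x
      using kern_odd[of e "x - t"] by (simp add: h_def)
    then show ?thesis by (simp add: trunc_def)
  qed
  ultimately show ?thesis by simp
qed

text \<open>The bound in \<open>trunc_L2\<close> and almost everywhere convergence give weak
  convergence, which is enough inside a pairing. Boundedness of \<open>p\<close> stands in for an L2
  bound on the principal value; in both applications \<open>p\<close> is explicit.\<close>

lemma trunc_weak_limit:
  assumes f: "f \<in> cL2" and g: "g \<in> cL2" and ab: "a < b" and g0: "\<And>t. t \<notin> {a..b} \<Longrightarrow> g t = 0"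
    and p[measurable]: "p \<in> borel_measurable borel" and P: "\<And>x. x \<in> {a<..<b} \<Longrightarrow> \<bar>p x\<bar> \<le> P"
    and pv: "AE x in lborel. x \<in> {a<..<b} \<longrightarrow> has_pv f x (p x)"
  shows "(\<lambda>n. LINT x|lborel. g x * trunc (1 / real (Suc n)) f x) \<longlonglongrightarrow>
    (LINT x|lborel. indicator {a<..<b} x * p x * g x)"
proof -
  note [measurable] = cL2D(1)[OF f] cL2D(1)[OF g] trunc_measurable[OF cL2D(1)[OF f]]
  define I where "I = (indicator {a<..<b} :: real \<Rightarrow> real)"
  have [measurable]: "I \<in> borel_measurable borel" unfolding I_def by measurable
  define ee where "ee n = 1 / real (Suc n)" for n
  have ee: "0 < ee n" for n by (simp add: ee_def)
  have S0: "filterlim ee (at_right 0) sequentially"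
  proof -
    have "ee \<longlonglongrightarrow> 0" unfolding ee_def using LIMSEQ_inverse_real_of_nat by (simp add: inverse_eq_divide)
    then show ?thesis
      using ee ee[THEN less_imp_neq, THEN not_sym] by (auto simp: filterlim_at intro!: always_eventually)
  qed
  \<comment> \<open>The limit \<open>p\<close> is controlled only on the open interval, hence the
    cut-off; in the pairing it changes nothing beyond the two end points, because \<open>g\<close>
    vanishes outside \<open>{a..b}\<close>.\<close>
  define d where "d n x = I x * (trunc (ee n) f x - p x)" for n x
  have dm: "d n \<in> borel_measurable borel" for n unfolding d_def by measurable
  have P0: "0 \<le> P" using P[of "(a + b) / 2"] ab by auto
  have iI: "integrable lborel (\<lambda>x. P\<^sup>2 * I x)"
    unfolding I_def using ab by (intro integrable_mult_right integrable_real_indicator) auto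
  have db: "(d n x)\<^sup>2 \<le> 2 * (trunc (ee n) f x)\<^sup>2 + 2 * (P\<^sup>2 * I x)" for n x
  proof (cases "x \<in> {a<..<b}")
    case True
    have "(p x)\<^sup>2 \<le> P\<^sup>2" using P[OF True] P0 by (simp add: abs_le_square_iff[symmetric])
    moreover have "0 \<le> (trunc (ee n) f x + p x)\<^sup>2" by simp
    ultimately show ?thesis using True by (simp add: d_def I_def power2_diff power2_sum)
  qed (simp add: d_def I_def)
  have i2: "integrable lborel (\<lambda>x. 2 * (trunc (ee n) f x)\<^sup>2 + 2 * (P\<^sup>2 * I x))" for n
    using iI trunc_L2(1)[OF f ee] by simp
  have di: "integrable lborel (\<lambda>x. (d n x)\<^sup>2)" for n
    by (rule Bochner_Integration.integrable_bound[OF i2]) (use dm db[of n] in \<open>auto intro!: order.trans[OF db abs_ge_self]\<close>)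
  have "(\<lambda>n. LINT x|lborel. d n x * g x) \<longlonglongrightarrow> 0"
  proof (rule weak_convergence_L2[OF dm di])
    show "(LINT x|lborel. (d n x)\<^sup>2) \<le> 32 * (LINT x|lborel. (f x)\<^sup>2) + 2 * (LINT x|lborel. P\<^sup>2 * I x)" for n
    proof -
      have "(LINT x|lborel. (d n x)\<^sup>2) \<le> (LINT x|lborel. 2 * (trunc (ee n) f x)\<^sup>2 + 2 * (P\<^sup>2 * I x))"
        by (rule integral_mono[OF di i2 db])
      also have "\<dots> = 2 * (LINT x|lborel. (trunc (ee n) f x)\<^sup>2) + 2 * (LINT x|lborel. P\<^sup>2 * I x)"
        using iI trunc_L2(1)[OF f ee] by simp
      finally show ?thesis using trunc_L2(2)[OF f ee, of n] by linarith
    qed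
    show "AE x in lborel. (\<lambda>n. d n x) \<longlonglongrightarrow> 0"
      using pv
    proof eventually_elim
      fix x assume pvx: "x \<in> {a<..<b} \<longrightarrow> has_pv f x (p x)"
      show "(\<lambda>n. d n x) \<longlonglongrightarrow> 0"
      proof (cases "x \<in> {a<..<b}")
        case True
        with pvx have "((\<lambda>e. trunc e f x) \<longlongrightarrow> p x) (at_right 0)" by (simp add: has_pv_def)
        then have "(\<lambda>n. trunc (ee n) f x) \<longlonglongrightarrow> p x" using S0 by (rule filterlim_compose)
        then have "(\<lambda>n. d n x) \<longlonglongrightarrow> I x * (p x - p x)" unfolding d_def by (intro tendsto_intros)
        then show ?thesis by simp
      qed (simp add: d_def I_def)
    qed
  qed (use cL2D(1,2)[OF g] in auto)
  moreover have "(LINT x|lborel. d n x * g x) = (LINT x|lborel. g x * trunc (ee n) f x) - (LINT x|lborel. I x * p x * g x)" for n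
  proof -
    have sq: "\<bar>x * y\<bar> \<le> x\<^sup>2 + y\<^sup>2" for x y :: real
      by (rule order.trans[OF abs_mult_le_squares]) simp
    have i1: "integrable lborel (\<lambda>x. g x * trunc (ee n) f x)"
      by (rule Bochner_Integration.integrable_bound[of _ "\<lambda>x. (g x)\<^sup>2 + (trunc (ee n) f x)\<^sup>2"])
        (use cL2D(2)[OF g] trunc_L2(1)[OF f ee] in \<open>auto intro!: order.trans[OF sq]\<close>)
    have i2: "integrable lborel (\<lambda>x. I x * p x * g x)"
    proof (rule Bochner_Integration.integrable_bound[of _ "\<lambda>x. P * g x"])
      show "AE x in lborel. norm (I x * p x * g x) \<le> norm (P * g x)"
      proof (intro AE_I2)
        fix x
        show "norm (I x * p x * g x) \<le> norm (P * g x)"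
          using P[of x] P0 by (cases "x \<in> {a<..<b}") (auto simp: I_def abs_mult intro!: mult_right_mono)
      qed
    qed (use cL2D(3)[OF g] in auto)
    have "(LINT x|lborel. d n x * g x) = (LINT x|lborel. g x * trunc (ee n) f x - I x * p x * g x)"
    proof (rule integral_cong_AE)
      have "AE x in lborel. x \<noteq> a \<and> x \<noteq> b" by (intro AE_conjI AE_lborel_singleton)
      then show "AE x in lborel. d n x * g x = g x * trunc (ee n) f x - I x * p x * g x"
      proof eventually_elim
        fix x assume "x \<noteq> a \<and> x \<noteq> b"
        then show "d n x * g x = g x * trunc (ee n) f x - I x * p x * g x"
          using g0[of x] by (cases "x \<in> {a<..<b}") (auto simp: d_def I_def algebra_simps)
      qed
    qed (use dm in measurable)
    then show ?thesis using i1 i2 by simp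
  qed
  ultimately have "(\<lambda>n. (LINT x|lborel. g x * trunc (ee n) f x) - (LINT x|lborel. I x * p x * g x)) \<longlonglongrightarrow> 0" by simp
  then show ?thesis unfolding ee_def I_def by (simp only: LIM_zero_iff)
qed


text \<open>The test function \<open>cauchy_weight a b z\<close> has an explicit integral and an
  explicit principal value. Antisymmetry equates c times the former with minus the integral of
  \<open>f\<close> against the latter, and the resulting identity contains no principal
  value.\<close>

lemma pv_constant_identity:
  assumes ab: "a < b" and f: "f \<in> cL2" and f0: "\<And>t. t \<notin> {a..b} \<Longrightarrow> f t = 0"
    and pv: "AE x in lborel. x \<in> {a<..<b} \<longrightarrow> has_pv f x c" and z: "z \<notin> {a..b}"
  shows "c * ((a + b) / 2 - z + kappa a b z) =
    (LINT x|lborel. f x) - (LINT x|lborel. indicator {a..b} x * (kappa a b z / (z - x)) * f x)"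
proof -
  note [measurable] = cL2D(1)[OF f]
  let ?v = "cauchy_weight a b z"
  note v = cauchy_weight_cL2[OF ab z]
  define p where "p x = pi * (kappa a b z / (z - x) - 1)" for x
  have [measurable]: "p \<in> borel_measurable borel" unfolding p_def by measurable
  obtain \<delta> where \<delta>: "0 < \<delta>" "\<And>x. x \<in> {a..b} \<Longrightarrow> \<delta> \<le> \<bar>z - x\<bar>"
    by (rule that[of "if z < a then a - z else z - b"]) (use z in auto)
  have kb: "\<bar>kappa a b z / (z - x)\<bar> \<le> \<bar>kappa a b z\<bar> / \<delta>" if "x \<in> {a..b}" for x
    using \<delta>(1) \<delta>(2)[OF that] by (auto simp: abs_divide intro!: frac_le)
  have A: "(\<lambda>n. LINT x|lborel. ?v x * trunc (1 / real (Suc n)) f x) \<longlonglongrightarrow>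
    (LINT x|lborel. indicator {a<..<b} x * c * ?v x)"
    by (rule trunc_weak_limit[OF f v ab cauchy_weight_outside[OF ab], where P = "\<bar>c\<bar>"]) (use pv in auto)
  have B: "(\<lambda>n. LINT x|lborel. f x * trunc (1 / real (Suc n)) ?v x) \<longlonglongrightarrow>
    (LINT x|lborel. indicator {a<..<b} x * p x * f x)"
  proof (rule trunc_weak_limit[OF v f ab f0, where P = "pi * (\<bar>kappa a b z\<bar> / \<delta> + 1)"])
    show "\<bar>p x\<bar> \<le> pi * (\<bar>kappa a b z\<bar> / \<delta> + 1)" if "x \<in> {a<..<b}" for x
    proof -
      have "\<bar>kappa a b z / (z - x) - 1\<bar> \<le> \<bar>kappa a b z\<bar> / \<delta> + 1"
      proof -
        have "\<bar>k - 1\<bar> \<le> M + 1" if "\<bar>k\<bar> \<le> M" for k M :: real using that by linarith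
        then show ?thesis using kb[of x] that by fastforce
      qed
      then show ?thesis unfolding p_def abs_mult by (intro mult_mono) auto
    qed
    show "AE x in lborel. x \<in> {a<..<b} \<longrightarrow> has_pv ?v x (p x)"
      using cauchy_weight_has_pv[OF ab _ z] by (auto simp: p_def)
  qed auto
  have "(\<lambda>n. LINT x|lborel. ?v x * trunc (1 / real (Suc n)) f x) \<longlonglongrightarrow>
    - (LINT x|lborel. indicator {a<..<b} x * p x * f x)"
    using tendsto_minus[OF B] trunc_antisym[OF f v] by simp
  from LIMSEQ_unique[OF A this]
  have eq: "(LINT x|lborel. indicator {a<..<b} x * c * ?v x) = - (LINT x|lborel. indicator {a<..<b} x * p x * f x)" .
  have "(LINT x|lborel. indicator {a<..<b} x * c * ?v x) = (LINT x|lborel. c * ?v x)"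
    by (rule Bochner_Integration.integral_cong) (use weight_outside[OF ab] in \<open>auto simp: cauchy_weight_def indicator_def\<close>)
  also have "\<dots> = c * (pi * ((a + b) / 2 - z + kappa a b z))"
    by (simp add: cauchy_weight_integral[OF ab z])
  finally have L: "(LINT x|lborel. indicator {a<..<b} x * c * ?v x) = c * (pi * ((a + b) / 2 - z + kappa a b z))" .
  have ki: "integrable lborel (\<lambda>x. indicator {a..b} x * (kappa a b z / (z - x)) * f x)"
  proof (rule Bochner_Integration.integrable_bound[of _ "\<lambda>x. \<bar>kappa a b z\<bar> / \<delta> * f x"])
    show "AE x in lborel. norm (indicator {a..b} x * (kappa a b z / (z - x)) * f x) \<le> norm (\<bar>kappa a b z\<bar> / \<delta> * f x)"
    proof (intro AE_I2)
      fix x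
      show "norm (indicator {a..b} x * (kappa a b z / (z - x)) * f x) \<le> norm (\<bar>kappa a b z\<bar> / \<delta> * f x)"
      proof (cases "x \<in> {a..b}")
        case True
        then show ?thesis using mult_right_mono[OF kb[OF True], of "\<bar>f x\<bar>"] \<delta>(1) by (simp add: abs_mult)
      qed simp
    qed
  qed (use cL2D(3)[OF f] in auto)
  have "(LINT x|lborel. indicator {a<..<b} x * p x * f x) =
    (LINT x|lborel. pi * (indicator {a..b} x * (kappa a b z / (z - x)) * f x) - pi * f x)"
  proof (rule integral_cong_AE)
    have "AE x in lborel. x \<noteq> a \<and> x \<noteq> b" by (intro AE_conjI AE_lborel_singleton)
    then show "AE x in lborel. indicator {a<..<b} x * p x * f x =
      pi * (indicator {a..b} x * (kappa a b z / (z - x)) * f x) - pi * f x"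
    proof eventually_elim
      fix x assume "x \<noteq> a \<and> x \<noteq> b"
      then show "indicator {a<..<b} x * p x * f x = pi * (indicator {a..b} x * (kappa a b z / (z - x)) * f x) - pi * f x"
        using f0[of x] by (cases "x \<in> {a<..<b}") (auto simp: p_def algebra_simps)
    qed
  qed measurable
  also have "\<dots> = pi * (LINT x|lborel. indicator {a..b} x * (kappa a b z / (z - x)) * f x) - pi * (LINT x|lborel. f x)"
    using Bochner_Integration.integral_diff[OF integrable_mult_right[OF ki, of pi] integrable_mult_right[OF cL2D(3)[OF f], of pi]]
    by (simp only: integral_mult_right_zero)
  finally have "pi * (c * ((a + b) / 2 - z + kappa a b z)) =
    pi * ((LINT x|lborel. f x) - (LINT x|lborel. indicator {a..b} x * (kappa a b z / (z - x)) * f x))"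
    using eq L by (simp add: algebra_simps)
  then show ?thesis by simp
qed

text \<open>The integral of 1 / (z - x)^2 over the interval is (b - a) / ((z - a)(z - b)), and the
  denominator is the square of \<open>kappa\<close>. The norm thus does not depend on z, which
  provides the uniform bound as z approaches an end point.\<close>

lemma kappa_kernel_L2:
  assumes ab: "a < b" and z: "z \<notin> {a..b}"
  shows "has_bochner_integral lborel (\<lambda>x. (indicator {a..b} x * (kappa a b z / (z - x)))\<^sup>2) (b - a)"
proof -
  note k = kappa_sq[OF ab z]
  have nz: "z - a \<noteq> 0" "z - b \<noteq> 0" using z ab by auto
  have "has_bochner_integral lborel (\<lambda>x. (kappa a b z)\<^sup>2 / (z - x)\<^sup>2 * indicator {a..b} x)
      ((kappa a b z)\<^sup>2 / (z - b) - (kappa a b z)\<^sup>2 / (z - a))"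
  proof (rule has_bochner_integral_FTC_Icc_nonneg)
    show "DERIV (\<lambda>x. (kappa a b z)\<^sup>2 / (z - x)) x :> (kappa a b z)\<^sup>2 / (z - x)\<^sup>2" if "x \<in> {a..b}" for x
      using that z by (auto intro!: derivative_eq_intros simp: power2_eq_square)
  qed (use ab in auto)
  moreover have "(kappa a b z)\<^sup>2 / (z - b) - (kappa a b z)\<^sup>2 / (z - a) = b - a"
    unfolding k(1) using nz by simp
  moreover have "(kappa a b z)\<^sup>2 / (z - x)\<^sup>2 * indicator {a..b} x = (indicator {a..b} x * (kappa a b z / (z - x)))\<^sup>2" for x
    by (simp add: indicator_def power_divide)
  ultimately show ?thesis by simp
qed

text \<open>Letting \<open>z\<close> tend to an end point \<open>q\<close> in the identity above: \<open>kappa a b z / (z - x)\<close> stays bounded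
  in \<open>L\<^sup>2\<close> and tends to \<open>0\<close> almost everywhere.\<close>

lemma pv_constant_endpoint:
  assumes ab: "a < b" and f: "f \<in> cL2" and f0: "\<And>t. t \<notin> {a..b} \<Longrightarrow> f t = 0"
    and pv: "AE x in lborel. x \<in> {a<..<b} \<longrightarrow> has_pv f x c"
    and q: "(q - a) * (q - b) = 0" and S: "S \<longlonglongrightarrow> q" "\<And>n. S n \<notin> {a..b}"
  shows "c * ((a + b) / 2 - q) = (LINT x|lborel. f x)"
proof -
  define d where "d n x = indicator {a..b} x * (kappa a b (S n) / (S n - x))" for n x
  have [measurable]: "d n \<in> borel_measurable borel" for n unfolding d_def by measurable
  have kap: "(\<lambda>n. kappa a b (S n)) \<longlonglongrightarrow> 0"
  proof (rule tendsto_rabs_zero_cancel)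
    have eq: "\<bar>kappa a b (S n)\<bar> = sqrt ((S n - a) * (S n - b))" for n
      unfolding kappa_sq(1)[OF ab S(2)[of n], symmetric] by simp
    have "(\<lambda>n. sqrt ((S n - a) * (S n - b))) \<longlonglongrightarrow> sqrt ((q - a) * (q - b))"
      by (intro tendsto_intros S)
    then show "(\<lambda>n. \<bar>kappa a b (S n)\<bar>) \<longlonglongrightarrow> 0" unfolding eq q by simp
  qed
  have "(\<lambda>n. LINT x|lborel. d n x * f x) \<longlonglongrightarrow> 0"
  proof (rule weak_convergence_L2[where K = "b - a"])
    show "integrable lborel (\<lambda>x. (d n x)\<^sup>2)" "(LINT x|lborel. (d n x)\<^sup>2) \<le> b - a" for n
      using kappa_kernel_L2[OF ab S(2)[of n]] by (auto simp: d_def has_bochner_integral_iff)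
    show "AE x in lborel. (\<lambda>n. d n x) \<longlonglongrightarrow> 0"
      using AE_lborel_singleton[of q]
    proof eventually_elim
      fix x assume "x \<noteq> q"
      then have "(\<lambda>n. d n x) \<longlonglongrightarrow> indicator {a..b} x * (0 / (q - x))"
        unfolding d_def by (intro tendsto_intros kap S) auto
      then show "(\<lambda>n. d n x) \<longlonglongrightarrow> 0" by simp
    qed
  qed (use cL2D(1,2)[OF f] in auto)
  then have "(\<lambda>n. (LINT x|lborel. f x) - (LINT x|lborel. d n x * f x)) \<longlonglongrightarrow> (LINT x|lborel. f x) - 0"
    by (intro tendsto_intros)
  moreover have "(\<lambda>n. c * ((a + b) / 2 - S n + kappa a b (S n))) \<longlonglongrightarrow> c * ((a + b) / 2 - q + 0)"
    by (intro tendsto_intros S kap)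
  moreover have "c * ((a + b) / 2 - S n + kappa a b (S n)) = (LINT x|lborel. f x) - (LINT x|lborel. d n x * f x)" for n
    using pv_constant_identity[OF ab f f0 pv S(2)] by (simp add: d_def)
  ultimately show ?thesis using LIMSEQ_unique by auto
qed

theorem pv_constant_zero:
  assumes ab: "a < b" and f: "f \<in> cL2" and f0: "\<And>t. t \<notin> {a..b} \<Longrightarrow> f t = 0"
    and pv: "AE x in lborel. x \<in> {a<..<b} \<longrightarrow> has_pv f x c"
  shows "c = 0"
proof -
  have l: "(\<lambda>n. inverse (real (Suc n))) \<longlonglongrightarrow> 0" by (rule LIMSEQ_inverse_real_of_nat)
  have pos: "0 < inverse (real (Suc n))" for n by simp
  have "(\<lambda>n. b + inverse (real (Suc n))) \<longlonglongrightarrow> b + 0" "(\<lambda>n. a - inverse (real (Suc n))) \<longlonglongrightarrow> a - 0"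
    by (intro tendsto_intros l)+
  then have S: "(\<lambda>n. b + inverse (real (Suc n))) \<longlonglongrightarrow> b" "(\<lambda>n. a - inverse (real (Suc n))) \<longlonglongrightarrow> a"
    by (simp_all only: add_0_right diff_0_right)
  have "c * ((a + b) / 2 - b) = (LINT x|lborel. f x)"
    by (rule pv_constant_endpoint[OF ab f f0 pv _ S(1)]) (use pos in \<open>auto simp: not_le simp del: of_nat_Suc\<close>)
  moreover have "c * ((a + b) / 2 - a) = (LINT x|lborel. f x)"
    by (rule pv_constant_endpoint[OF ab f f0 pv _ S(2)]) (use pos in \<open>auto simp: not_le simp del: of_nat_Suc\<close>)
  ultimately have "c * ((a + b) / 2 - b) = c * ((a + b) / 2 - a)" by simp
  then show ?thesis using ab by auto
qed

section \<open>The finite Hilbert transform of complex functions\<close>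

text \<open>The real finite Hilbert transform of \<open>p\<close> as a limit relation instead of a
  value of \<open>Lim\<close>, so that linearity is a statement about limits. The factor pi
  compensates the normalisation 1 / pi.\<close>

definition pv_of :: "real \<Rightarrow> real \<Rightarrow> (real \<Rightarrow> real) \<Rightarrow> (real \<Rightarrow> real) \<Rightarrow> bool" where
  "pv_of a b p f \<longleftrightarrow> p \<in> cL2 \<and> (\<forall>t. t \<notin> {a..b} \<longrightarrow> p t = 0) \<and>
     (AE x in lborel. x \<in> {a<..<b} \<longrightarrow> has_pv p x (pi * f x))"

text \<open>Links a function that is only Lebesgue measurable on the interval, with no condition
  outside it, to real and imaginary parts in \<open>cL2\<close> that vanish outside.\<close>

definition represents :: "real \<Rightarrow> real \<Rightarrow> (real \<Rightarrow> complex) \<Rightarrow> (real \<Rightarrow> real) \<Rightarrow> (real \<Rightarrow> real) \<Rightarrow> bool" where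
  "represents a b \<phi> p q \<longleftrightarrow> \<phi> \<in> borel_measurable (lebesgue_on {a..b}) \<and> p \<in> cL2 \<and> q \<in> cL2 \<and> (\<forall>t. t \<notin> {a..b} \<longrightarrow> p t = 0 \<and> q t = 0) \<and>
     (AE t in lborel. t \<in> {a..b} \<longrightarrow> \<phi> t = Complex (p t) (q t))"

lemma AE_lebesgue_on_Icc:
  fixes a b :: real
  shows "(AE x in lebesgue_on {a..b}. P x) \<longleftrightarrow> (AE x in lborel. x \<in> {a<..<b} \<longrightarrow> P x)"
proof -
  have "(AE x in lebesgue_on {a..b}. P x) \<longleftrightarrow> (AE x in lborel. x \<in> {a..b} \<longrightarrow> P x)"
    by (simp add: AE_restrict_space_iff AE_completion_iff)
  also have "\<dots> \<longleftrightarrow> (AE x in lborel. x \<in> {a<..<b} \<longrightarrow> P x)"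
  proof -
    have "AE x in lborel. x \<noteq> a \<and> x \<noteq> b" by (intro AE_conjI AE_lborel_singleton)
    then have "AE x in lborel. (x \<in> {a..b} \<longrightarrow> P x) \<longleftrightarrow> (x \<in> {a<..<b} \<longrightarrow> P x)"
      by eventually_elim auto
    then show ?thesis by (rule eventually_subst)
  qed
  finally show ?thesis .
qed

lemma cL2_representative:
  fixes h :: "real \<Rightarrow> real"
  assumes h: "h \<in> borel_measurable (lebesgue_on {a..b})" "integrable (lebesgue_on {a..b}) (\<lambda>x. (h x)\<^sup>2)"
  shows "\<exists>p\<in>cL2. (\<forall>t. t \<notin> {a..b} \<longrightarrow> p t = 0) \<and> (AE t in lborel. t \<in> {a..b} \<longrightarrow> h t = p t)"
proof -
  define h0 where "h0 t = (if t \<in> {a..b} then h t else 0)" for t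
  have h0: "h0 \<in> borel_measurable lebesgue"
    using h(1) unfolding h0_def by (subst borel_measurable_if) auto
  have i0: "integrable lebesgue (\<lambda>t. (h0 t)\<^sup>2)"
  proof -
    have "integrable lebesgue (\<lambda>t. indicator {a..b} t *\<^sub>R (h t)\<^sup>2)"
      using h(2) by (subst (asm) integrable_restrict_space) auto
    moreover have "indicator {a..b} t *\<^sub>R (h t)\<^sup>2 = (h0 t)\<^sup>2" for t by (simp add: h0_def)
    ultimately show ?thesis by simp
  qed
  obtain p where p[measurable]: "p \<in> borel_measurable lborel" and hp: "AE x in lborel. h0 x = p x"
    using completion_ex_borel_measurable_real[OF h0] by blast
  define p0 where "p0 t = indicator {a..b} t * p t" for t
  have [measurable]: "p0 \<in> borel_measurable borel" unfolding p0_def using p by measurable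
  have hp0: "AE x in lborel. h0 x = p0 x"
    using hp by eventually_elim (auto simp: h0_def p0_def indicator_def split: if_splits)
  have "integrable lborel (\<lambda>t. (p0 t)\<^sup>2)"
  proof -
    have "integrable lebesgue (\<lambda>t. (p0 t)\<^sup>2)"
    proof (rule integrable_cong_AE_imp[OF i0])
      show "AE x in lebesgue. (h0 x)\<^sup>2 = (p0 x)\<^sup>2"
        using hp0 by (intro AE_completion) (auto elim: eventually_mono)
    qed (rule measurable_completion, measurable)
    then show ?thesis by (subst (asm) integrable_completion) auto
  qed
  moreover have out: "p0 t = 0" if "t \<notin> {a..b}" for t using that by (simp add: p0_def)
  moreover have "\<exists>R. \<forall>t. R < \<bar>t\<bar> \<longrightarrow> p0 t = 0"
  proof (intro exI[of _ "max \<bar>a\<bar> \<bar>b\<bar>"] allI impI out)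
    fix t assume "max \<bar>a\<bar> \<bar>b\<bar> < \<bar>t\<bar>"
    then show "t \<notin> {a..b}" by auto
  qed
  ultimately have "p0 \<in> cL2" by (auto simp: cL2_def)
  moreover have "AE t in lborel. t \<in> {a..b} \<longrightarrow> h t = p0 t"
    using hp0 by eventually_elim (auto simp: h0_def)
  ultimately show ?thesis using out by blast
qed

lemma L2_on_represents:
  assumes "\<phi> \<in> L2_on {a..b}"
  shows "\<exists>p q. represents a b \<phi> p q"
proof -
  have m[measurable]: "\<phi> \<in> borel_measurable (lebesgue_on {a..b})"
    and i: "integrable (lebesgue_on {a..b}) (\<lambda>x. (cmod (\<phi> x))\<^sup>2)"
    using assms by (auto simp: L2_on_def)
  have b: "(Re z)\<^sup>2 \<le> (cmod z)\<^sup>2" "(Im z)\<^sup>2 \<le> (cmod z)\<^sup>2" for z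
    by (simp_all add: cmod_power2)
  have "integrable (lebesgue_on {a..b}) (\<lambda>x. (Re (\<phi> x))\<^sup>2)"
    by (rule Bochner_Integration.integrable_bound[OF i]) (use b in auto)
  then obtain p where p: "p \<in> cL2" "\<And>t. t \<notin> {a..b} \<Longrightarrow> p t = 0" "AE t in lborel. t \<in> {a..b} \<longrightarrow> Re (\<phi> t) = p t"
    using cL2_representative[of "\<lambda>x. Re (\<phi> x)" a b] by auto
  have "integrable (lebesgue_on {a..b}) (\<lambda>x. (Im (\<phi> x))\<^sup>2)"
    by (rule Bochner_Integration.integrable_bound[OF i]) (use b in auto)
  then obtain q where q: "q \<in> cL2" "\<And>t. t \<notin> {a..b} \<Longrightarrow> q t = 0" "AE t in lborel. t \<in> {a..b} \<longrightarrow> Im (\<phi> t) = q t"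
    using cL2_representative[of "\<lambda>x. Im (\<phi> x)" a b] by auto
  have "AE t in lborel. t \<in> {a..b} \<longrightarrow> \<phi> t = Complex (p t) (q t)"
    using p(3) q(3) by eventually_elim (auto simp: complex_eq_iff)
  then show ?thesis using m p q unfolding represents_def by blast
qed

lemma represents_L2_on:
  assumes "p \<in> cL2" "q \<in> cL2"
  shows "(\<lambda>t. Complex (p t) (q t)) \<in> L2_on {a..b}"
proof -
  note [measurable] = cL2D(1)[OF assms(1)] cL2D(1)[OF assms(2)]
  have eq: "(cmod (Complex (p t) (q t)))\<^sup>2 = (p t)\<^sup>2 + (q t)\<^sup>2" for t by (simp add: cmod_power2)
  have "integrable lborel (\<lambda>t. (p t)\<^sup>2 + (q t)\<^sup>2)" using cL2D(2)[OF assms(1)] cL2D(2)[OF assms(2)] by simp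
  then have "integrable lebesgue (\<lambda>t. (p t)\<^sup>2 + (q t)\<^sup>2)" by (subst integrable_completion) auto
  then have "integrable lebesgue (\<lambda>t. indicator {a..b} t *\<^sub>R ((p t)\<^sup>2 + (q t)\<^sup>2))"
    by (rule integrable_mult_indicator[rotated]) simp
  then have "integrable (lebesgue_on {a..b}) (\<lambda>t. (cmod (Complex (p t) (q t)))\<^sup>2)"
    unfolding eq by (subst integrable_restrict_space) auto
  moreover have "(\<lambda>t. Complex (p t) (q t)) \<in> borel_measurable borel"
    unfolding Complex_eq by measurable
  then have "(\<lambda>t. Complex (p t) (q t)) \<in> borel_measurable (lebesgue_on {a..b})"
    by (intro measurable_restrict_space1 measurable_completion) simp
  ultimately show ?thesis by (simp add: L2_on_def)
qed

text \<open>The kernel \<open>k\<close> is prescribed on \<open>{a..b}\<close> only, because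
  \<open>p\<close> and \<open>q\<close> vanish elsewhere. One lemma therefore serves both the
  truncated kernel and the full kernel 1 / (t - z) off the interval.\<close>

lemma represents_set_integral:
  assumes r: "represents a b \<phi> p q" and k[measurable]: "k \<in> borel_measurable borel"
    and A[measurable]: "A \<in> sets borel" and sub: "A \<subseteq> {a..b}"
    and kA: "\<And>t. t \<in> {a..b} \<Longrightarrow> k t = indicator A t / (t - z)"
    and ip: "integrable lborel (\<lambda>t. k t * p t)" and iq: "integrable lborel (\<lambda>t. k t * q t)"
  shows "(LINT t:A|lebesgue. \<phi> t / of_real (t - z)) = Complex (LINT t|lborel. k t * p t) (LINT t|lborel. k t * q t)"
proof -
  define F where "F t = complex_of_real (k t * p t) + \<i> * complex_of_real (k t * q t)" for t
  have [measurable]: "(\<lambda>t. k t * p t) \<in> borel_measurable borel" "(\<lambda>t. k t * q t) \<in> borel_measurable borel"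
    using ip iq by auto
  have F: "F \<in> borel_measurable lborel" unfolding F_def by measurable
  have ae: "AE t in lborel. F t = indicator A t *\<^sub>R (\<phi> t / of_real (t - z))"
  proof -
    have "AE t in lborel. t \<in> {a..b} \<longrightarrow> \<phi> t = Complex (p t) (q t)" using r by (simp add: represents_def)
    then show ?thesis
    proof eventually_elim
      fix t assume t: "t \<in> {a..b} \<longrightarrow> \<phi> t = Complex (p t) (q t)"
      show "F t = indicator A t *\<^sub>R (\<phi> t / of_real (t - z))"
      proof (cases "t \<in> {a..b}")
        case True
        then show ?thesis using t kA[OF True] by (simp add: F_def complex_eq_iff Complex_eq indicator_def)
      next
        case False
        then have "t \<notin> A" "p t = 0" "q t = 0" using sub r by (auto simp: represents_def)
        then show ?thesis by (simp add: F_def)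
      qed
    qed
  qed
  have AE': "AE t in lebesgue. F t = indicator A t *\<^sub>R (\<phi> t / of_real (t - z))"
    using ae by (rule AE_completion)
  have FL: "F \<in> borel_measurable lebesgue" using F by (rule measurable_completion)
  have GL: "(\<lambda>t. indicator A t *\<^sub>R (\<phi> t / of_real (t - z))) \<in> borel_measurable lebesgue"
  proof -
    have "\<phi> \<in> borel_measurable (lebesgue_on {a..b})" using r by (simp add: represents_def)
    then have "(\<lambda>t. indicator {a..b} t *\<^sub>R \<phi> t) \<in> borel_measurable lebesgue"
      by (subst (asm) borel_measurable_restrict_space_iff) auto
    moreover have "(\<lambda>t. complex_of_real (indicator A t / (t - z))) \<in> borel_measurable lborel" by measurable
    then have "(\<lambda>t. complex_of_real (indicator A t / (t - z))) \<in> borel_measurable lebesgue"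
      by (rule measurable_completion)
    ultimately have "(\<lambda>t. (indicator {a..b} t *\<^sub>R \<phi> t) * complex_of_real (indicator A t / (t - z))) \<in> borel_measurable lebesgue"
      by (rule borel_measurable_times)
    moreover have "(indicator {a..b} t *\<^sub>R \<phi> t) * complex_of_real (indicator A t / (t - z)) =
        indicator A t *\<^sub>R (\<phi> t / of_real (t - z))" for t
      using sub by (auto simp: indicator_def)
    ultimately show ?thesis by simp
  qed
  have "(LINT t:A|lebesgue. \<phi> t / of_real (t - z)) = (LINT t|lebesgue. F t)"
    unfolding set_lebesgue_integral_def
    by (rule integral_cong_AE[OF GL FL]) (use AE' in \<open>auto elim: eventually_mono\<close>)
  also have "\<dots> = (LINT t|lborel. F t)" using F by (rule integral_completion)
  also have "\<dots> = of_real (LINT t|lborel. k t * p t) + \<i> * of_real (LINT t|lborel. k t * q t)"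
    unfolding F_def using ip iq by (subst Bochner_Integration.integral_add) (auto simp del: of_real_mult)
  finally show ?thesis by (simp add: Complex_eq)
qed

lemma represents_trunc:
  assumes r: "represents a b \<phi> p q" and e: "0 < e"
  shows "(LINT t:{a..b} - {z - e<..<z + e}|lebesgue. \<phi> t / of_real (t - z)) = Complex (trunc e p z) (trunc e q z)"
  unfolding trunc_def
proof (rule represents_set_integral[OF r])
  show "integrable lborel (\<lambda>t. kern e (t - z) * p t)" "integrable lborel (\<lambda>t. kern e (t - z) * q t)"
    using r e by (auto simp: represents_def intro: trunc_integrable)
  show "kern e (t - z) = indicator ({a..b} - {z - e<..<z + e}) t / (t - z)" if "t \<in> {a..b}" for t
    using that by (auto simp: kern_def indicator_def abs_if)
qed auto

text \<open>The only place where \<open>Lim\<close> is evaluated: it needs the limits of both real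
  parts of the transform, which exist at almost every point.\<close>

lemma represents_pv:
  assumes r: "represents a b \<phi> p q" and z: "z \<in> {a..b}" and p: "has_pv p z l" and q: "has_pv q z m"
  shows "finite_Hilbert a b \<phi> z = of_real (1 / pi) * Complex l m"
proof -
  have "((\<lambda>e. Complex (trunc e p z) (trunc e q z)) \<longlongrightarrow> Complex l m) (at_right 0)"
    using p q unfolding has_pv_def by (intro tendsto_Complex)
  moreover have "\<forall>\<^sub>F e in at_right 0. Complex (trunc e p z) (trunc e q z) =
      (LINT t:{a..b} - {z - e<..<z + e}|lebesgue. \<phi> t / of_real (t - z))"
    using eventually_at_right_less[of "0::real"] by eventually_elim (simp add: represents_trunc[OF r] del: of_real_diff)
  ultimately have "((\<lambda>e. LINT t:{a..b} - {z - e<..<z + e}|lebesgue. \<phi> t / of_real (t - z)) \<longlongrightarrow> Complex l m) (at_right 0)"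
    by (rule Lim_transform_eventually)
  then have "Lim (at_right 0) (\<lambda>e. LINT t:{a..b} - {z - e<..<z + e}|lebesgue. \<phi> t / of_real (t - z)) = Complex l m"
    by (rule tendsto_Lim[OF trivial_limit_at_right_real])
  then show ?thesis using z unfolding finite_Hilbert_def by simp
qed

lemma represents_off:
  assumes r: "represents a b \<phi> p q" and \<delta>: "0 < \<delta>" and z: "z \<le> a - \<delta> \<or> b + \<delta> \<le> z" and ab: "a < b"
  shows "finite_Hilbert a b \<phi> z = of_real (1 / pi) * Complex (LINT t|lborel. p t / (t - z)) (LINT t|lborel. q t / (t - z))"
    and "integrable lborel (\<lambda>t. p t / (t - z))" "integrable lborel (\<lambda>t. q t / (t - z))"
proof -
  have *: "integrable lborel (\<lambda>t. f t / (t - z))" if f: "f \<in> cL2" "\<And>t. t \<notin> {a..b} \<Longrightarrow> f t = 0" for f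
  proof (rule Bochner_Integration.integrable_bound[of _ "\<lambda>t. 1 / \<delta> * f t"])
    show "AE t in lborel. norm (f t / (t - z)) \<le> norm (1 / \<delta> * f t)"
    proof (intro AE_I2)
      fix t
      show "norm (f t / (t - z)) \<le> norm (1 / \<delta> * f t)"
      proof (cases "t \<in> {a..b}")
        case True
        then have "\<delta> \<le> \<bar>t - z\<bar>" using z by auto
        then show ?thesis using \<delta> by (auto simp: abs_mult intro!: frac_le)
      qed (simp add: f(2))
    qed
  qed (use cL2D[OF f(1)] in auto)
  show p: "integrable lborel (\<lambda>t. p t / (t - z))" using r * by (auto simp: represents_def)
  show q: "integrable lborel (\<lambda>t. q t / (t - z))" using r * by (auto simp: represents_def)
  have "(LINT t:{a..b}|lebesgue. \<phi> t / of_real (t - z)) =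
      Complex (LINT t|lborel. 1 / (t - z) * p t) (LINT t|lborel. 1 / (t - z) * q t)"
    by (rule represents_set_integral[OF r]) (use p q in auto)
  moreover have "z \<notin> {a..b}" using z \<delta> ab by auto
  ultimately show "finite_Hilbert a b \<phi> z = of_real (1 / pi) * Complex (LINT t|lborel. p t / (t - z)) (LINT t|lborel. q t / (t - z))"
    by (simp add: finite_Hilbert_def del: atLeastAtMost_iff of_real_diff)
qed

lemma pv_of_lincomb:
  assumes "pv_of a b p f" "pv_of a b q g"
  shows "pv_of a b (\<lambda>t. c * p t + d * q t) (\<lambda>x. c * f x + d * g x)"
proof -
  have p: "p \<in> cL2" "\<And>t. t \<notin> {a..b} \<Longrightarrow> p t = 0" "AE x in lborel. x \<in> {a<..<b} \<longrightarrow> has_pv p x (pi * f x)"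
    and q: "q \<in> cL2" "\<And>t. t \<notin> {a..b} \<Longrightarrow> q t = 0" "AE x in lborel. x \<in> {a<..<b} \<longrightarrow> has_pv q x (pi * g x)"
    using assms by (auto simp: pv_of_def)
  have "AE x in lborel. x \<in> {a<..<b} \<longrightarrow> has_pv (\<lambda>t. c * p t + d * q t) x (pi * (c * f x + d * g x))"
    using p(3) q(3)
  proof eventually_elim
    fix x assume h: "x \<in> {a<..<b} \<longrightarrow> has_pv p x (pi * f x)" "x \<in> {a<..<b} \<longrightarrow> has_pv q x (pi * g x)"
    show "x \<in> {a<..<b} \<longrightarrow> has_pv (\<lambda>t. c * p t + d * q t) x (pi * (c * f x + d * g x))"
    proof
      assume "x \<in> {a<..<b}"
      with h have "has_pv (\<lambda>t. c * p t + d * q t) x (c * (pi * f x) + d * (pi * g x))"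
        by (intro has_pv_add cL2_cmult has_pv_cmult p(1) q(1)) auto
      then show "has_pv (\<lambda>t. c * p t + d * q t) x (pi * (c * f x + d * g x))" by (simp add: algebra_simps)
    qed
  qed
  then show ?thesis using p q by (auto simp: pv_of_def intro!: cL2_add cL2_cmult)
qed

lemma pv_of_cong:
  assumes "pv_of a b p f" "AE x in lborel. x \<in> {a<..<b} \<longrightarrow> f x = g x"
  shows "pv_of a b p g"
proof -
  have "AE x in lborel. x \<in> {a<..<b} \<longrightarrow> has_pv p x (pi * f x)" using assms(1) by (simp add: pv_of_def)
  with assms(2) have "AE x in lborel. x \<in> {a<..<b} \<longrightarrow> has_pv p x (pi * g x)"
    by eventually_elim auto
  then show ?thesis using assms(1) by (simp add: pv_of_def)
qed

lemma pv_of_constant: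
  assumes "a < b" "pv_of a b p (\<lambda>x. c)"
  shows "c = 0"
  using pv_constant_zero[OF assms(1), of p "pi * c"] assms(2) by (auto simp: pv_of_def)

text \<open>Here \<open>pv_exists\<close> removes the arbitrariness of \<open>Lim\<close>: almost
  everywhere the value of the transform is a true limit.\<close>

lemma finite_Hilbert_pv_of:
  assumes "\<phi> \<in> L2_on {a..b}"
  shows "\<exists>p q. pv_of a b p (\<lambda>x. Re (finite_Hilbert a b \<phi> x)) \<and> pv_of a b q (\<lambda>x. Im (finite_Hilbert a b \<phi> x))"
proof -
  obtain p q where r: "represents a b \<phi> p q" using L2_on_represents[OF assms] by blast
  then have p: "p \<in> cL2" and q: "q \<in> cL2" and out: "\<And>t. t \<notin> {a..b} \<Longrightarrow> p t = 0 \<and> q t = 0"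
    by (auto simp: represents_def)
  have key: "AE x in lborel. x \<in> {a<..<b} \<longrightarrow> has_pv p x (pi * Re (finite_Hilbert a b \<phi> x)) \<and>
      has_pv q x (pi * Im (finite_Hilbert a b \<phi> x))"
    using pv_exists[OF p] pv_exists[OF q]
  proof eventually_elim
    fix x assume "\<exists>l. has_pv p x l" "\<exists>l. has_pv q x l"
    then obtain l m where lm: "has_pv p x l" "has_pv q x m" by (elim exE)
    have "pi * Re (finite_Hilbert a b \<phi> x) = l \<and> pi * Im (finite_Hilbert a b \<phi> x) = m" if "x \<in> {a<..<b}"
      using represents_pv[OF r _ lm] that by simp
    then show "x \<in> {a<..<b} \<longrightarrow> has_pv p x (pi * Re (finite_Hilbert a b \<phi> x)) \<and>
      has_pv q x (pi * Im (finite_Hilbert a b \<phi> x))" using lm by simp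
  qed
  have "pv_of a b p (\<lambda>x. Re (finite_Hilbert a b \<phi> x))"
    unfolding pv_of_def using p out by (auto intro: eventually_mono[OF key])
  moreover have "pv_of a b q (\<lambda>x. Im (finite_Hilbert a b \<phi> x))"
    unfolding pv_of_def using q out by (auto intro: eventually_mono[OF key])
  ultimately show ?thesis by blast
qed

lemma pv_of_finite_Hilbert:
  assumes "pv_of a b p (\<lambda>x. Re (f x))" "pv_of a b q (\<lambda>x. Im (f x))"
  shows "\<exists>\<phi>\<in>L2_on {a..b}. AE x in lebesgue_on {a..b}. finite_Hilbert a b \<phi> x = f x"
proof
  have p: "p \<in> cL2" "\<And>t. t \<notin> {a..b} \<Longrightarrow> p t = 0" "AE x in lborel. x \<in> {a<..<b} \<longrightarrow> has_pv p x (pi * Re (f x))"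
    and q: "q \<in> cL2" "\<And>t. t \<notin> {a..b} \<Longrightarrow> q t = 0" "AE x in lborel. x \<in> {a<..<b} \<longrightarrow> has_pv q x (pi * Im (f x))"
    using assms by (auto simp: pv_of_def)
  show "(\<lambda>t. Complex (p t) (q t)) \<in> L2_on {a..b}" by (rule represents_L2_on[OF p(1) q(1)])
  have r: "represents a b (\<lambda>t. Complex (p t) (q t)) p q"
    using p q represents_L2_on[OF p(1) q(1), of a b] by (simp add: represents_def L2_on_def)
  show "AE x in lebesgue_on {a..b}. finite_Hilbert a b (\<lambda>t. Complex (p t) (q t)) x = f x"
    unfolding AE_lebesgue_on_Icc using p(3) q(3)
  proof eventually_elim
    fix x assume h: "x \<in> {a<..<b} \<longrightarrow> has_pv p x (pi * Re (f x))" "x \<in> {a<..<b} \<longrightarrow> has_pv q x (pi * Im (f x))"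
    show "x \<in> {a<..<b} \<longrightarrow> finite_Hilbert a b (\<lambda>t. Complex (p t) (q t)) x = f x"
    proof
      assume x: "x \<in> {a<..<b}"
      then have "finite_Hilbert a b (\<lambda>t. Complex (p t) (q t)) x = of_real (1 / pi) * Complex (pi * Re (f x)) (pi * Im (f x))"
        using h by (intro represents_pv[OF r]) auto
      then show "finite_Hilbert a b (\<lambda>t. Complex (p t) (q t)) x = f x" by (simp add: complex_eq_iff)
    qed
  qed
qed

section \<open>Membership in the range, component by component\<close>

definition in_Hilbert_range :: "real \<Rightarrow> real \<Rightarrow> (real \<Rightarrow> complex) \<Rightarrow> bool" where
  "in_Hilbert_range a b f \<longleftrightarrow> f \<in> L2_on {a..b} \<and>
     (\<exists>\<phi>\<in>L2_on {a..b}. AE x in lebesgue_on {a..b}. finite_Hilbert a b \<phi> x = f x)"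

text \<open>Trades equations for \<open>finite_Hilbert\<close> for the relation
  \<open>pv_of\<close>, which is linear without exceptions; sums and differences are formed on that
  side.\<close>

lemma in_Hilbert_range_iff:
  "in_Hilbert_range a b f \<longleftrightarrow> f \<in> L2_on {a..b} \<and>
     (\<exists>p q. pv_of a b p (\<lambda>x. Re (f x)) \<and> pv_of a b q (\<lambda>x. Im (f x)))"
proof (intro iffI conjI)
  assume "in_Hilbert_range a b f"
  then obtain \<phi> where f: "f \<in> L2_on {a..b}" and \<phi>: "\<phi> \<in> L2_on {a..b}"
    and eq: "AE x in lebesgue_on {a..b}. finite_Hilbert a b \<phi> x = f x"
    by (auto simp: in_Hilbert_range_def)
  show "f \<in> L2_on {a..b}" by fact
  obtain p q where pq: "pv_of a b p (\<lambda>x. Re (finite_Hilbert a b \<phi> x))" "pv_of a b q (\<lambda>x. Im (finite_Hilbert a b \<phi> x))"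
    using finite_Hilbert_pv_of[OF \<phi>] by blast
  have "pv_of a b p (\<lambda>x. Re (f x))"
    by (rule pv_of_cong[OF pq(1)]) (use eq in \<open>auto simp: AE_lebesgue_on_Icc elim!: eventually_mono\<close>)
  moreover have "pv_of a b q (\<lambda>x. Im (f x))"
    by (rule pv_of_cong[OF pq(2)]) (use eq in \<open>auto simp: AE_lebesgue_on_Icc elim!: eventually_mono\<close>)
  ultimately show "\<exists>p q. pv_of a b p (\<lambda>x. Re (f x)) \<and> pv_of a b q (\<lambda>x. Im (f x))" by blast
next
  assume "f \<in> L2_on {a..b} \<and> (\<exists>p q. pv_of a b p (\<lambda>x. Re (f x)) \<and> pv_of a b q (\<lambda>x. Im (f x)))"
  then show "in_Hilbert_range a b f"
    unfolding in_Hilbert_range_def using pv_of_finite_Hilbert by blast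
qed

lemma Hilbert_range_iff:
  "f \<in> Hilbert_range \<alpha> \<beta> \<longleftrightarrow> (\<forall>m. in_Hilbert_range (\<alpha> m) (\<beta> m) (f m))"
proof
  assume "f \<in> Hilbert_range \<alpha> \<beta>"
  then show "\<forall>m. in_Hilbert_range (\<alpha> m) (\<beta> m) (f m)"
    by (auto simp: Hilbert_range_def L2_vec_def eq_ae_def Hilbert_vec_def in_Hilbert_range_def)
next
  assume r: "\<forall>m. in_Hilbert_range (\<alpha> m) (\<beta> m) (f m)"
  then have "\<forall>m. \<exists>\<phi>. \<phi> \<in> L2_on {\<alpha> m..\<beta> m} \<and>
      (AE x in lebesgue_on {\<alpha> m..\<beta> m}. finite_Hilbert (\<alpha> m) (\<beta> m) \<phi> x = f m x)"
    by (auto simp: in_Hilbert_range_def)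
  from choice[OF this] obtain \<phi> where "\<forall>m. \<phi> m \<in> L2_on {\<alpha> m..\<beta> m} \<and>
      (AE x in lebesgue_on {\<alpha> m..\<beta> m}. finite_Hilbert (\<alpha> m) (\<beta> m) (\<phi> m) x = f m x)" ..
  then show "f \<in> Hilbert_range \<alpha> \<beta>"
    using r unfolding Hilbert_range_def L2_vec_def eq_ae_def Hilbert_vec_def in_Hilbert_range_def
    by (auto intro!: bexI[of _ \<phi>])
qed

lemma L2_on_bounded:
  assumes m: "f \<in> borel_measurable borel" and b: "\<And>x. x \<in> {a..b} \<Longrightarrow> cmod (f x) \<le> K"
  shows "f \<in> L2_on {a..b}"
proof -
  have m': "f \<in> borel_measurable (lebesgue_on {a..b})"
    using m by (intro measurable_restrict_space1 measurable_completion) simp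
  have fin: "integrable (lebesgue_on {a..b}) (\<lambda>x. K\<^sup>2)"
    by (rule finite_measure.integrable_const)
      (auto intro!: finite_measureI simp: emeasure_restrict_space space_restrict_space emeasure_lborel_Icc_eq)
  have "integrable (lebesgue_on {a..b}) (\<lambda>x. (cmod (f x))\<^sup>2)"
    by (rule Bochner_Integration.integrable_bound[OF fin])
      (use m' b in \<open>auto intro!: AE_I2 power_mono simp: space_restrict_space\<close>)
  then show ?thesis using m' by (simp add: L2_on_def)
qed

lemma L2_on_diff:
  assumes "f \<in> L2_on S" "g \<in> L2_on S"
  shows "(\<lambda>x. f x - g x) \<in> L2_on S"
proof -
  have [measurable]: "f \<in> borel_measurable (lebesgue_on S)" "g \<in> borel_measurable (lebesgue_on S)"
    and i: "integrable (lebesgue_on S) (\<lambda>x. (cmod (f x))\<^sup>2)" "integrable (lebesgue_on S) (\<lambda>x. (cmod (g x))\<^sup>2)"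
    using assms by (auto simp: L2_on_def)
  have b: "(cmod (u - v))\<^sup>2 \<le> 2 * (cmod u)\<^sup>2 + 2 * (cmod v)\<^sup>2" for u v
  proof -
    have "(cmod (u - v))\<^sup>2 \<le> (cmod u + cmod v)\<^sup>2" by (intro power_mono norm_triangle_ineq4) simp
    moreover have "0 \<le> (cmod u - cmod v)\<^sup>2" by simp
    ultimately show ?thesis by (simp add: power2_sum power2_diff)
  qed
  have "integrable (lebesgue_on S) (\<lambda>x. (cmod (f x - g x))\<^sup>2)"
    by (rule Bochner_Integration.integrable_bound[of _ "\<lambda>x. 2 * (cmod (f x))\<^sup>2 + 2 * (cmod (g x))\<^sup>2"])
      (use i b in auto)
  then show ?thesis by (simp add: L2_on_def)
qed

lemma L2_on_minus_const: "f \<in> L2_on {a..b} \<Longrightarrow> (\<lambda>x. f x - of_real c) \<in> L2_on {a..b}"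
  by (rule L2_on_diff, assumption) (rule L2_on_bounded[where K = "\<bar>c\<bar>"], auto)

text \<open>The scalar form of the statement, with \<open>g\<close> the off-diagonal part.  The constant is real because
  the imaginary part of \<open>\<theta> H \<phi> + g\<close> vanishes, so that the constant belonging to \<open>Im g\<close> lies in the range.\<close>

lemma scalar_constant:
  assumes ab: "a < b" and \<phi>: "\<phi> \<in> L2_on {a..b}" and \<psi>: "\<psi> \<in> L2_on {a..b}" and g: "g \<in> L2_on {a..b}"
    and eq: "AE x in lebesgue_on {a..b}. of_real \<theta> * finite_Hilbert a b \<phi> x + g x = \<psi> x"
    and real: "AE x in lebesgue_on {a..b}. \<psi> x \<in> \<real>"
    and u: "pv_of a b u (\<lambda>x. Re (g x) - c)" and v: "pv_of a b v (\<lambda>x. Im (g x) - d)"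
  shows "in_Hilbert_range a b (\<lambda>x. g x - of_real c)"
    and "in_Hilbert_range a b (\<lambda>x. \<psi> x - of_real c') \<longleftrightarrow> c' = c"
proof -
  obtain p q where p: "pv_of a b p (\<lambda>x. Re (finite_Hilbert a b \<phi> x))"
    and q: "pv_of a b q (\<lambda>x. Im (finite_Hilbert a b \<phi> x))"
    using finite_Hilbert_pv_of[OF \<phi>] by blast
  have e: "AE x in lborel. x \<in> {a<..<b} \<longrightarrow> \<theta> * Re (finite_Hilbert a b \<phi> x) + Re (g x) = Re (\<psi> x) \<and>
      \<theta> * Im (finite_Hilbert a b \<phi> x) + Im (g x) = 0 \<and> Im (\<psi> x) = 0"
    using eq real unfolding AE_lebesgue_on_Icc
  proof eventually_elim
    fix x
    assume h: "x \<in> {a<..<b} \<longrightarrow> of_real \<theta> * finite_Hilbert a b \<phi> x + g x = \<psi> x" "x \<in> {a<..<b} \<longrightarrow> \<psi> x \<in> \<real>"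
    show "x \<in> {a<..<b} \<longrightarrow> \<theta> * Re (finite_Hilbert a b \<phi> x) + Re (g x) = Re (\<psi> x) \<and>
      \<theta> * Im (finite_Hilbert a b \<phi> x) + Im (g x) = 0 \<and> Im (\<psi> x) = 0"
    proof
      assume x: "x \<in> {a<..<b}"
      then have "\<psi> x = of_real \<theta> * finite_Hilbert a b \<phi> x + g x" and "Im (\<psi> x) = 0"
        using h by (auto simp: complex_is_Real_iff)
      then show "\<theta> * Re (finite_Hilbert a b \<phi> x) + Re (g x) = Re (\<psi> x) \<and>
          \<theta> * Im (finite_Hilbert a b \<phi> x) + Im (g x) = 0 \<and> Im (\<psi> x) = 0" by simp
    qed
  qed
  have P: "pv_of a b (\<lambda>t. \<theta> * p t + 1 * u t) (\<lambda>x. Re (\<psi> x) - c)"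
    by (rule pv_of_cong[OF pv_of_lincomb[OF p u]]) (rule eventually_mono[OF e], auto)
  have Q: "pv_of a b (\<lambda>t. \<theta> * q t + 1 * v t) (\<lambda>x. - d)"
    by (rule pv_of_cong[OF pv_of_lincomb[OF q v]]) (rule eventually_mono[OF e], auto)
  have d: "d = 0" using pv_of_constant[OF ab Q] by simp
  show "in_Hilbert_range a b (\<lambda>x. g x - of_real c)"
    unfolding in_Hilbert_range_iff using L2_on_minus_const[OF g] u v d by auto
  have Q0: "pv_of a b (\<lambda>t. \<theta> * q t + 1 * v t) (\<lambda>x. Im (\<psi> x))"
    by (rule pv_of_cong[OF Q]) (rule eventually_mono[OF e], auto simp: d)
  show "in_Hilbert_range a b (\<lambda>x. \<psi> x - of_real c') \<longleftrightarrow> c' = c"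
  proof
    assume "in_Hilbert_range a b (\<lambda>x. \<psi> x - of_real c')"
    then obtain r where "pv_of a b r (\<lambda>x. Re (\<psi> x) - c')"
      unfolding in_Hilbert_range_iff by auto
    \<comment> \<open>Subtracting the two preimages gives a function whose transform is the constant
      c - c', and only zero is possible.\<close>
    from pv_of_lincomb[OF this P, of 1 "-1"]
    have "pv_of a b (\<lambda>t. 1 * r t + (-1) * (\<theta> * p t + 1 * u t)) (\<lambda>x. c - c')" by simp
    from pv_of_constant[OF ab this] show "c' = c" by simp
  next
    assume "c' = c"
    then show "in_Hilbert_range a b (\<lambda>x. \<psi> x - of_real c')"
      unfolding in_Hilbert_range_iff using L2_on_minus_const[OF \<psi>] P Q0 by auto
  qed
qed

section \<open>The off-diagonal part\<close>

lemma finite_gap: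
  fixes \<alpha> \<beta> :: "'n::{finite,linorder} \<Rightarrow> real"
  assumes "\<And>j k. j < k \<Longrightarrow> \<beta> j < \<alpha> k"
  shows "\<exists>\<delta>>0. \<forall>k. k \<noteq> m \<longrightarrow> \<beta> k \<le> \<alpha> m - \<delta> \<or> \<beta> m + \<delta> \<le> \<alpha> k"
proof -
  \<comment> \<open>The value 1 at k = m is a positive filler, so that the minimum over all indices
    is positive also when there is a single interval.\<close>
  define gap where "gap k = (if k < m then \<alpha> m - \<beta> k else if m < k then \<alpha> k - \<beta> m else 1)" for k
  define \<delta> where "\<delta> = Min (range gap)"
  have "0 < gap k" for k using assms by (auto simp: gap_def)
  then have "0 < \<delta>" by (simp add: \<delta>_def)
  moreover have le: "\<delta> \<le> gap k" for k by (simp add: \<delta>_def)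
  have "\<beta> k \<le> \<alpha> m - \<delta> \<or> \<beta> m + \<delta> \<le> \<alpha> k" if "k \<noteq> m" for k
  proof (rule linorder_cases[of k m])
    show ?thesis if "k < m" using that le[of k] by (auto simp: gap_def dest: less_asym split: if_splits)
    show ?thesis if "m < k" using that le[of k] by (auto simp: gap_def dest: less_asym split: if_splits)
    show ?thesis if "k = m" using that \<open>k \<noteq> m\<close> by simp
  qed
  ultimately show ?thesis by blast
qed

lemma Cauchy_transform_bound:
  fixes f :: "real \<Rightarrow> real"
  assumes f: "integrable lborel f" and \<delta>: "0 < \<delta>" and f0: "\<And>t. a - \<delta> < t \<Longrightarrow> t < b + \<delta> \<Longrightarrow> f t = 0"
    and x: "x \<in> {a..b}"
  shows "\<bar>LINT t|lborel. f t / (t - x)\<bar> \<le> (LINT t|lborel. \<bar>f t\<bar>) / \<delta>"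
proof -
  have b: "\<bar>f t / (t - x)\<bar> \<le> \<bar>f t\<bar> / \<delta>" for t
  proof (cases "f t = 0")
    case False
    then have "t \<le> a - \<delta> \<or> b + \<delta> \<le> t" using f0[of t] by (meson not_le)
    then have "\<delta> \<le> \<bar>t - x\<bar>" using x by auto
    then show ?thesis using \<delta> by (auto simp: abs_divide intro!: frac_le)
  qed simp
  have i: "integrable lborel (\<lambda>t. \<bar>f t\<bar> / \<delta>)" using f by simp
  have "integrable lborel (\<lambda>t. f t / (t - x))"
    by (rule Bochner_Integration.integrable_bound[OF i]) (use f b \<delta> in auto)
  then have "(LINT t|lborel. \<bar>f t / (t - x)\<bar>) \<le> (LINT t|lborel. \<bar>f t\<bar> / \<delta>)"
    by (intro integral_mono i b integrable_abs)
  then show ?thesis using integral_abs_bound[of lborel "\<lambda>t. f t / (t - x)"] by simp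
qed

text \<open>The vanishing diagonal entry leaves only intervals at positive distance from the m-th
  one, so the real and the imaginary part are each a Cauchy integral of the kind treated in
  \<open>Cauchy_integral_in_range\<close>.\<close>

lemma off_diagonal_range:
  fixes \<alpha> \<beta> :: "'n::{finite,linorder} \<Rightarrow> real" and A :: "real ^ ('n::{finite,linorder}) ^ ('n::{finite,linorder})"
  assumes ab: "\<And>j. \<alpha> j < \<beta> j" and sep: "\<And>j k. j < k \<Longrightarrow> \<beta> j < \<alpha> k"
    and \<phi>: "\<phi> \<in> L2_vec \<alpha> \<beta>" and A0: "A $ m $ m = 0"
  defines "g \<equiv> mat_app A (Hilbert_vec \<alpha> \<beta> \<phi>) m"
  shows "g \<in> L2_on {\<alpha> m..\<beta> m}"
    and "\<exists>u c. pv_of (\<alpha> m) (\<beta> m) u (\<lambda>x. Re (g x) - c)"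
    and "\<exists>v d. pv_of (\<alpha> m) (\<beta> m) v (\<lambda>x. Im (g x) - d)"
proof -
  obtain \<delta> where \<delta>: "0 < \<delta>" and gap: "\<And>k. k \<noteq> m \<Longrightarrow> \<beta> k \<le> \<alpha> m - \<delta> \<or> \<beta> m + \<delta> \<le> \<alpha> k"
    using finite_gap[where \<alpha> = \<alpha> and \<beta> = \<beta> and m = m, OF sep] by blast
  have "\<forall>k. \<exists>pq. represents (\<alpha> k) (\<beta> k) (\<phi> k) (fst pq) (snd pq)"
    using \<phi> L2_on_represents by (fastforce simp: L2_vec_def)
  from choice[OF this] obtain pq where pq: "\<And>k. represents (\<alpha> k) (\<beta> k) (\<phi> k) (fst (pq k)) (snd (pq k))" by blast
  define p where "p k = fst (pq k)" for k
  define q where "q k = snd (pq k)" for k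
  have r: "represents (\<alpha> k) (\<beta> k) (\<phi> k) (p k) (q k)" for k using pq by (simp add: p_def q_def)
  \<comment> \<open>All the other intervals are merged into one density, so that each part requires
    a single Cauchy integral and a single constant.\<close>
  define P where "P t = (\<Sum>k\<in>UNIV. A $ m $ k * p k t)" for t
  define Q where "Q t = (\<Sum>k\<in>UNIV. A $ m $ k * q k t)" for t
  have pc: "p k \<in> cL2" and qc: "q k \<in> cL2" for k using r[of k] by (auto simp: represents_def)
  have P: "integrable lborel P" and Q: "integrable lborel Q"
    unfolding P_def Q_def using cL2D(3)[OF pc] cL2D(3)[OF qc] by auto
  have zero: "A $ m $ k * p k t = 0 \<and> A $ m $ k * q k t = 0" if t: "\<alpha> m - \<delta> < t" "t < \<beta> m + \<delta>" for k t
  proof (cases "k = m")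
    case False
    then have "t \<notin> {\<alpha> k..\<beta> k}" using gap[OF False] t by auto
    then show ?thesis using r[of k] by (simp add: represents_def)
  qed (simp add: A0)
  have P0: "P t = 0" and Q0: "Q t = 0" if "\<alpha> m - \<delta> < t" "t < \<beta> m + \<delta>" for t
    using zero[OF that] by (auto simp: P_def Q_def intro!: sum.neutral)
  have gx: "g x = of_real (1 / pi) * Complex (LINT t|lborel. P t / (t - x)) (LINT t|lborel. Q t / (t - x))"
    if x: "x \<in> {\<alpha> m..\<beta> m}" for x
  proof -
    have off: "A $ m $ k * (LINT t|lborel. f t / (t - x)) = (LINT t|lborel. A $ m $ k * f t / (t - x))" for k and f :: "real \<Rightarrow> real"
      by (simp flip: integral_mult_right_zero)
    have each: "integrable lborel (\<lambda>t. A $ m $ k * p k t / (t - x)) \<and> integrable lborel (\<lambda>t. A $ m $ k * q k t / (t - x)) \<and>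
      of_real (A $ m $ k) * finite_Hilbert (\<alpha> k) (\<beta> k) (\<phi> k) x =
      of_real (1 / pi) * Complex (LINT t|lborel. A $ m $ k * p k t / (t - x)) (LINT t|lborel. A $ m $ k * q k t / (t - x))" for k
    proof (cases "k = m")
      case True
      then show ?thesis by (simp add: A0 complex_eq_iff)
    next
      case False
      have z: "x \<le> \<alpha> k - \<delta> \<or> \<beta> k + \<delta> \<le> x" using gap[OF False] x by auto
      note R = represents_off[OF r \<delta> z ab]
      have "of_real (A $ m $ k) * finite_Hilbert (\<alpha> k) (\<beta> k) (\<phi> k) x =
        of_real (1 / pi) * Complex (A $ m $ k * (LINT t|lborel. p k t / (t - x))) (A $ m $ k * (LINT t|lborel. q k t / (t - x)))"
        unfolding R(1) by (simp add: complex_eq_iff)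
      then show ?thesis
        using integrable_mult_right[OF R(2), of "A $ m $ k"] integrable_mult_right[OF R(3), of "A $ m $ k"]
        unfolding off by simp
    qed
    then have ii: "integrable lborel (\<lambda>t. A $ m $ k * p k t / (t - x))" "integrable lborel (\<lambda>t. A $ m $ k * q k t / (t - x))" for k
      by blast+
    have "g x = (\<Sum>k\<in>UNIV. of_real (1 / pi) * Complex (LINT t|lborel. A $ m $ k * p k t / (t - x)) (LINT t|lborel. A $ m $ k * q k t / (t - x)))"
      unfolding g_def mat_app_def Hilbert_vec_def by (rule sum.cong) (use each in auto)
    also have "\<dots> = of_real (1 / pi) * Complex (\<Sum>k\<in>UNIV. LINT t|lborel. A $ m $ k * p k t / (t - x)) (\<Sum>k\<in>UNIV. LINT t|lborel. A $ m $ k * q k t / (t - x))"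
      by (simp add: complex_eq_iff sum_divide_distrib)
    also have "(\<Sum>k\<in>UNIV. LINT t|lborel. A $ m $ k * p k t / (t - x)) = (LINT t|lborel. P t / (t - x))"
      unfolding P_def sum_divide_distrib using ii by (intro Bochner_Integration.integral_sum[symmetric])
    also have "(\<Sum>k\<in>UNIV. LINT t|lborel. A $ m $ k * q k t / (t - x)) = (LINT t|lborel. Q t / (t - x))"
      unfolding Q_def sum_divide_distrib using ii by (intro Bochner_Integration.integral_sum[symmetric])
    finally show ?thesis .
  qed
  have [measurable]: "P \<in> borel_measurable borel" "Q \<in> borel_measurable borel" using P Q by auto
  \<comment> \<open>A version of \<open>g\<close> that is Borel on the whole line and agrees with it
    on the m-th interval.\<close>
  define G where "G x = of_real (1 / pi) * Complex (LINT t|lborel. P t / (t - x)) (LINT t|lborel. Q t / (t - x))" for x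
  have Gm: "G \<in> borel_measurable borel" unfolding G_def Complex_eq by measurable
  define K where "K = (LINT t|lborel. \<bar>P t\<bar>) / \<delta> + (LINT t|lborel. \<bar>Q t\<bar>) / \<delta>"
  have Gb: "cmod (G x) \<le> 1 / pi * K" if x: "x \<in> {\<alpha> m..\<beta> m}" for x
  proof -
    have "cmod (Complex (LINT t|lborel. P t / (t - x)) (LINT t|lborel. Q t / (t - x))) \<le> K"
      using cmod_le[of "Complex (LINT t|lborel. P t / (t - x)) (LINT t|lborel. Q t / (t - x))"]
        Cauchy_transform_bound[OF P \<delta> P0 x] Cauchy_transform_bound[OF Q \<delta> Q0 x] unfolding K_def by simp
    then show ?thesis unfolding G_def norm_mult norm_of_real by (intro mult_mono) auto
  qed
  have GL: "G \<in> L2_on {\<alpha> m..\<beta> m}" by (rule L2_on_bounded[OF Gm Gb])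
  have gG: "g x = G x" if "x \<in> space (lebesgue_on {\<alpha> m..\<beta> m})" for x
    using gx[of x] that by (simp add: G_def)
  have "g \<in> borel_measurable (lebesgue_on {\<alpha> m..\<beta> m}) \<longleftrightarrow> G \<in> borel_measurable (lebesgue_on {\<alpha> m..\<beta> m})"
    by (rule measurable_cong[OF gG])
  moreover have "integrable (lebesgue_on {\<alpha> m..\<beta> m}) (\<lambda>x. (cmod (g x))\<^sup>2) \<longleftrightarrow> integrable (lebesgue_on {\<alpha> m..\<beta> m}) (\<lambda>x. (cmod (G x))\<^sup>2)"
    by (rule Bochner_Integration.integrable_cong[OF refl]) (simp add: gG)
  ultimately show "g \<in> L2_on {\<alpha> m..\<beta> m}" using GL by (simp add: L2_on_def)
  have pvs: "\<exists>u c. pv_of (\<alpha> m) (\<beta> m) u (\<lambda>x. h x - c)"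
    if F: "integrable lborel F" "\<And>t. \<alpha> m - \<delta> < t \<Longrightarrow> t < \<beta> m + \<delta> \<Longrightarrow> F t = 0"
      and h: "\<And>x. x \<in> {\<alpha> m..\<beta> m} \<Longrightarrow> pi * h x = (LINT t|lborel. F t / (t - x))" for F and h :: "real \<Rightarrow> real"
  proof -
    obtain u c where u: "u \<in> cL2" "\<And>t. t \<notin> {\<alpha> m..\<beta> m} \<Longrightarrow> u t = 0"
      and pv: "\<And>x. x \<in> {\<alpha> m<..<\<beta> m} \<Longrightarrow> has_pv u x ((LINT t|lborel. F t / (t - x)) - c)"
      using Cauchy_integral_in_range[OF ab[of m] \<delta> F] by blast
    have "has_pv u x (pi * (h x - c / pi))" if "x \<in> {\<alpha> m<..<\<beta> m}" for x
    proof -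
      have "pi * (h x - c / pi) = (LINT t|lborel. F t / (t - x)) - c"
        using h[of x] that by (simp add: right_diff_distrib)
      then show ?thesis using pv[OF that] by simp
    qed
    \<comment> \<open>The constant is divided by pi because \<open>pv_of\<close> contains the
      normalisation that \<open>has_pv\<close> lacks.\<close>
    then have "pv_of (\<alpha> m) (\<beta> m) u (\<lambda>x. h x - c / pi)" using u by (simp add: pv_of_def)
    then show ?thesis by blast
  qed
  show "\<exists>u c. pv_of (\<alpha> m) (\<beta> m) u (\<lambda>x. Re (g x) - c)" by (rule pvs[OF P P0]) (simp_all add: gx)
  show "\<exists>v d. pv_of (\<alpha> m) (\<beta> m) v (\<lambda>x. Im (g x) - d)" by (rule pvs[OF Q Q0]) (simp_all add: gx)
qed

theorem lemma2p4:
  fixes \<alpha> \<beta> :: "'n::{finite,linorder} \<Rightarrow> real"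
    and \<Theta> :: "real ^ ('n::{finite,linorder}) ^ ('n::{finite,linorder})"
    and \<psi> \<phi> :: "'n \<Rightarrow> real \<Rightarrow> complex"
  assumes "\<And>j. \<alpha> j < \<beta> j"
    and "\<And>j k. j < k \<Longrightarrow> \<beta> j < \<alpha> k"
    and "invertible (diag_part \<Theta>)"
    and "\<psi> \<in> L2_vec \<alpha> \<beta>"
    and "\<And>j. AE x in lebesgue_on {\<alpha> j..\<beta> j}. \<psi> j x \<in> \<real>"
    and "\<phi> \<in> L2_vec \<alpha> \<beta>"
    and "eq_ae \<alpha> \<beta> (mat_app \<Theta> (Hilbert_vec \<alpha> \<beta> \<phi>)) \<psi>"
  shows "minus_const (mat_app (\<Theta> - diag_part \<Theta>) (Hilbert_vec \<alpha> \<beta> \<phi>)) (const_vec \<alpha> \<beta> \<psi>)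
           \<in> Hilbert_range \<alpha> \<beta>"
proof -
  define g where "g = mat_app (\<Theta> - diag_part \<Theta>) (Hilbert_vec \<alpha> \<beta> \<phi>)"
  have diag: "(\<Theta> - diag_part \<Theta>) $ m $ m = 0" for m by (simp add: diag_part_def)
  have split: "mat_app \<Theta> f m x = of_real (\<Theta> $ m $ m) * f m x + mat_app (\<Theta> - diag_part \<Theta>) f m x" for f m x
  proof -
    have "mat_app \<Theta> f m x = (\<Sum>k\<in>UNIV. of_real (diag_part \<Theta> $ m $ k) * f k x) + mat_app (\<Theta> - diag_part \<Theta>) f m x"
      unfolding mat_app_def sum.distrib[symmetric] by (rule sum.cong) (simp_all add: algebra_simps)
    also have "(\<Sum>k\<in>UNIV. of_real (diag_part \<Theta> $ m $ k) * f k x) = (\<Sum>k\<in>UNIV. if k = m then of_real (\<Theta> $ m $ m) * f m x else 0)"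
      by (rule sum.cong) (auto simp: diag_part_def)
    finally show ?thesis by simp
  qed
  \<comment> \<open>The same constant serves \<open>g\<close> and, as the only possible one, \<psi>.
    The equivalence form allows the definite description in \<open>const_vec\<close> to be rewritten
    into a vector equation.\<close>
  have "\<forall>m. \<exists>c. in_Hilbert_range (\<alpha> m) (\<beta> m) (\<lambda>x. g m x - of_real c) \<and>
      (\<forall>c'. in_Hilbert_range (\<alpha> m) (\<beta> m) (\<lambda>x. \<psi> m x - of_real c') \<longleftrightarrow> c' = c)"
  proof
    fix m
    note off = off_diagonal_range[OF assms(1,2,6) diag, of m, folded g_def]
    obtain u c v d where uv: "pv_of (\<alpha> m) (\<beta> m) u (\<lambda>x. Re (g m x) - c)" "pv_of (\<alpha> m) (\<beta> m) v (\<lambda>x. Im (g m x) - d)"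
      using off(2,3) by blast
    have L2: "\<phi> m \<in> L2_on {\<alpha> m..\<beta> m}" "\<psi> m \<in> L2_on {\<alpha> m..\<beta> m}" using assms(4,6) by (auto simp: L2_vec_def)
    have "AE x in lebesgue_on {\<alpha> m..\<beta> m}. mat_app \<Theta> (Hilbert_vec \<alpha> \<beta> \<phi>) m x = \<psi> m x"
      using assms(7) by (simp add: eq_ae_def)
    then have "AE x in lebesgue_on {\<alpha> m..\<beta> m}.
        of_real (\<Theta> $ m $ m) * finite_Hilbert (\<alpha> m) (\<beta> m) (\<phi> m) x + g m x = \<psi> m x"
      unfolding split g_def by (simp add: Hilbert_vec_def)
    note sc = scalar_constant[OF assms(1) L2 off(1) this assms(5) uv]
    show "\<exists>c. in_Hilbert_range (\<alpha> m) (\<beta> m) (\<lambda>x. g m x - of_real c) \<and>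
      (\<forall>c'. in_Hilbert_range (\<alpha> m) (\<beta> m) (\<lambda>x. \<psi> m x - of_real c') \<longleftrightarrow> c' = c)"
      using sc by (intro exI[of _ c]) blast
  qed
  from choice[OF this] obtain c where
    c: "\<And>m. in_Hilbert_range (\<alpha> m) (\<beta> m) (\<lambda>x. g m x - of_real (c m))"
      "\<And>m c'. in_Hilbert_range (\<alpha> m) (\<beta> m) (\<lambda>x. \<psi> m x - of_real c') \<longleftrightarrow> c' = c m" by blast
  have "const_vec \<alpha> \<beta> \<psi> = (\<chi> m. c m)"
    unfolding const_vec_def Hilbert_range_iff minus_const_def c(2)
    by (rule the_equality) (simp_all add: vec_eq_iff)
  then show ?thesis
    unfolding g_def[symmetric] Hilbert_range_iff minus_const_def using c(1) by simp
qed

end
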